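(* Let $d\ge6$ and $\epsilon>0$. Let $\mathcal{M}=(\mathbb{R}^d,d,\mu,X_t,P^x)$ be a metric measure Dirichlet space which is a bounded modification of the quintuple consisting of $\mathbb{R}^d$, the Euclidean distance $d$, the Lebesgue measure and the standard Brownian motion on $\mathbb{R}^d$. Let $E^x_{\mathcal{M}}$ denote expectation with respect to $P^x$. Assume that $\mathrm{FHK}(2)$ holds for $\mathcal{M}$ and that there is a constant $C$ with $\sup_{x\in\mathbb{R}^d}\mu(B(x,R))\le CR^d$ for every $R>0$. Then for every $x\in\mathbb{R}^d$, the limit $$\lim_{t\to\infty}\Big(E^x_{\mathcal{M}}[V_\epsilon(t)]-t\,\mathrm{Cap}_{\mathbb{R}^d}(\overline B(0,\epsilon))\Big)$$ exists and is finite.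
   Context: A metric measure Dirichlet space $(M,d,\mu,X_t,P^x)$ means: $(M,d)$ non-compact, connected, complete, separable metric space with relatively compact open balls $B(x,r)=\{y:d(x,y)<r\}$; $\mu$ a Borel measure with $0<\mu(U)\le\mu(\overline U)<\infty$ for relatively compact open $U$; every sphere $\{y:d(x,y)=r\}$ nonempty and $\mu$-null; $(X_t,P^x)$ the Hunt process of a strongly local, regular, symmetric, conservative Dirichlet form on $L^2(M,\mu)$ with jointly continuous heat kernel $p(t,x,y)$, $E^x[g(X_t)]=\int p(t,x,y)g(y)\mu(dy)$ for all $x$. $V_\epsilon(t)=\mu(\bigcup_{s\in[0,t]}B(X_s,\epsilon))$. Bounded modification: $(\mathbb{R}^d,d,\widetilde\mu,\widetilde X_t,\widetilde P^x)$ is a bounded modification of $(\mathbb{R}^d,d,\mu',X'_t,P'^x)$ if there is a bounded domain $D\subset\mathbb{R}^d$ with (M1) $\widetilde\mu(A)=\mu'(A)$ for Borel $A\subset\mathbb{R}^d\setminus D$, and (M2) for every $x\notin D$ the law of $\widetilde X_{\cdot\wedge\widetilde T_D}$ under $\widetilde P^x$ equals the law of $X'_{\cdot\wedge T_D}$ under $P'^x$ ($\widetilde T_D,T_D$ first hitting times of $D$). $\mathrm{FHK}(2)$: there are constants $c_5,\dots,c_8>0$ with $c_5e^{-c_6d(x,y)^2/t}/\mu(B(x,\sqrt t))\le p(t,x,y)\le c_7e^{-c_8d(x,y)^2/t}/\mu(B(x,\sqrt t))$ for all $t>0,x,y$. $\mathrm{Cap}_{\mathbb{R}^d}(\overline B(0,\epsilon))$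 is the Newtonian capacity (for standard Brownian motion) of the closed ball, equal to $1/G(x,y)$ for $|x-y|=\epsilon$, $G(x,y)=\int_0^\infty(2\pi t)^{-d/2}e^{-|x-y|^2/(2t)}dt$. *)

theory Defs
  imports "HOL-Probability.Probability"
begin

definition cpaths :: "(real \<Rightarrow> 'a::topological_space) set" where
  "cpaths = {\<omega>. continuous_on UNIV \<omega> \<and> (\<forall>t\<le>0. \<omega> t = \<omega> 0)}"

definition path_space :: "(real \<Rightarrow> 'a::topological_space) measure" where
  "path_space = restrict_space (PiM UNIV (\<lambda>_. borel)) cpaths"

definition mmd_measure :: "'a::euclidean_space measure \<Rightarrow> bool" where
  "mmd_measure \<mu> \<longleftrightarrow> sets \<mu> = sets borel \<and>
     (\<forall>U. open U \<and> bounded U \<and> U \<noteq> {} \<longrightarrow>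
          0 < emeasure \<mu> U \<and> emeasure \<mu> (closure U) < \<infinity>) \<and>
     (\<forall>x r. 0 < r \<longrightarrow> emeasure \<mu> (sphere x r) = 0)"

definition L2 :: "'a measure \<Rightarrow> ('a \<Rightarrow> real) set" where
  "L2 \<mu> = {f. f \<in> borel_measurable \<mu> \<and> integrable \<mu> (\<lambda>x. (f x)\<^sup>2)}"

definition Tsg :: "'a measure \<Rightarrow> (real \<Rightarrow> 'a \<Rightarrow> 'a \<Rightarrow> real) \<Rightarrow> real \<Rightarrow> ('a \<Rightarrow> real) \<Rightarrow> 'a \<Rightarrow> real" where
  "Tsg \<mu> p t f x = (\<integral>y. p t x y * f y \<partial>\<mu>)"

definition heat_kernel :: "'a::euclidean_space measure \<Rightarrow> (real \<Rightarrow> 'a \<Rightarrow> 'a \<Rightarrow> real) \<Rightarrow> bool" where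
  "heat_kernel \<mu> p \<longleftrightarrow>
     continuous_on ({0<..} \<times> UNIV \<times> UNIV) (\<lambda>(t, x, y). p t x y) \<and>
     (\<forall>t x y. 0 < t \<longrightarrow> 0 \<le> p t x y \<and> p t x y = p t y x) \<and>
     (\<forall>t x. 0 < t \<longrightarrow> integrable \<mu> (\<lambda>y. p t x y) \<and> (\<integral>y. p t x y \<partial>\<mu>) = 1) \<and>
     (\<forall>s t x y. 0 < s \<longrightarrow> 0 < t \<longrightarrow> p (s + t) x y = (\<integral>z. p s x z * p t z y \<partial>\<mu>)) \<and>
     (\<forall>f\<in>L2 \<mu>. ((\<lambda>t. \<integral>x. (Tsg \<mu> p t f x - f x)\<^sup>2 \<partial>\<mu>) \<longlongrightarrow> 0) (at_right 0))"

definition approx_form :: "'a measure \<Rightarrow> (real \<Rightarrow> 'a \<Rightarrow> 'a \<Rightarrow> real) \<Rightarrow> real \<Rightarrow> ('a \<Rightarrow> real) \<Rightarrow> ('a \<Rightarrow> real) \<Rightarrow> real" where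
  "approx_form \<mu> p t f g = (\<integral>x. (f x - Tsg \<mu> p t f x) * g x \<partial>\<mu>) / t"

definition form_domain :: "'a measure \<Rightarrow> (real \<Rightarrow> 'a \<Rightarrow> 'a \<Rightarrow> real) \<Rightarrow> ('a \<Rightarrow> real) set" where
  "form_domain \<mu> p = {f \<in> L2 \<mu>. \<exists>L. ((\<lambda>t. approx_form \<mu> p t f f) \<longlongrightarrow> L) (at_right 0)}"

definition dform :: "'a measure \<Rightarrow> (real \<Rightarrow> 'a \<Rightarrow> 'a \<Rightarrow> real) \<Rightarrow> ('a \<Rightarrow> real) \<Rightarrow> ('a \<Rightarrow> real) \<Rightarrow> real" where
  "dform \<mu> p f g = Lim (at_right 0) (\<lambda>t. approx_form \<mu> p t f g)"

definition esupp :: "'a::topological_space measure \<Rightarrow> ('a \<Rightarrow> real) \<Rightarrow> 'a set" where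
  "esupp \<mu> f = - \<Union>{U. open U \<and> (AE x in \<mu>. x \<in> U \<longrightarrow> f x = 0)}"

definition strongly_local :: "'a::euclidean_space measure \<Rightarrow> (real \<Rightarrow> 'a \<Rightarrow> 'a \<Rightarrow> real) \<Rightarrow> bool" where
  "strongly_local \<mu> p \<longleftrightarrow>
     (\<forall>u\<in>form_domain \<mu> p. \<forall>v\<in>form_domain \<mu> p.
        compact (esupp \<mu> u) \<and> compact (esupp \<mu> v) \<and>
        (\<exists>U c. open U \<and> esupp \<mu> u \<subseteq> U \<and> (AE x in \<mu>. x \<in> U \<longrightarrow> v x = c))
        \<longrightarrow> dform \<mu> p u v = 0)"

definition cc_fun :: "('a::topological_space \<Rightarrow> real) \<Rightarrow> bool" where
  "cc_fun f \<longleftrightarrow> continuous_on UNIV f \<and> compact (closure {x. f x \<noteq> 0})"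

definition regular_form :: "'a::euclidean_space measure \<Rightarrow> (real \<Rightarrow> 'a \<Rightarrow> 'a \<Rightarrow> real) \<Rightarrow> bool" where
  "regular_form \<mu> p \<longleftrightarrow>
     (\<forall>f\<in>form_domain \<mu> p. \<forall>e>0. \<exists>g\<in>form_domain \<mu> p. cc_fun g \<and>
        dform \<mu> p (\<lambda>x. f x - g x) (\<lambda>x. f x - g x) + (\<integral>x. (f x - g x)\<^sup>2 \<partial>\<mu>) < e) \<and>
     (\<forall>f. cc_fun f \<longrightarrow> (\<forall>e>0. \<exists>g\<in>form_domain \<mu> p. cc_fun g \<and> (\<forall>x. \<bar>f x - g x\<bar> < e)))"

fun kprob :: "'a measure \<Rightarrow> (real \<Rightarrow> 'a \<Rightarrow> 'a \<Rightarrow> real) \<Rightarrow> 'a \<Rightarrow> real \<Rightarrow> (real \<times> 'a set) list \<Rightarrow> real" where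
  "kprob \<mu> p x s [] = 1"
| "kprob \<mu> p x s ((t, A) # rest) = (\<integral>y. indicator A y * p (t - s) x y * kprob \<mu> p y t rest \<partial>\<mu>)"

definition markov_process :: "'a::euclidean_space measure \<Rightarrow> (real \<Rightarrow> 'a \<Rightarrow> 'a \<Rightarrow> real) \<Rightarrow> ('a \<Rightarrow> (real \<Rightarrow> 'a) measure) \<Rightarrow> bool" where
  "markov_process \<mu> p P \<longleftrightarrow>
     (\<forall>x. prob_space (P x) \<and> sets (P x) = sets path_space \<and> (AE \<omega> in P x. \<omega> 0 = x)) \<and>
     (\<forall>x ts. sorted_wrt (<) (map fst ts) \<and> (\<forall>(t, A)\<in>set ts. 0 < t \<and> A \<in> sets borel) \<longrightarrow>
        measure (P x) {\<omega> \<in> space (P x). \<forall>(t, A)\<in>set ts. \<omega> t \<in> A} = kprob \<mu> p x 0 ts)"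

definition mmd_space :: "'a::euclidean_space measure \<Rightarrow> (real \<Rightarrow> 'a \<Rightarrow> 'a \<Rightarrow> real) \<Rightarrow> ('a \<Rightarrow> (real \<Rightarrow> 'a) measure) \<Rightarrow> bool" where
  "mmd_space \<mu> p P \<longleftrightarrow> mmd_measure \<mu> \<and> heat_kernel \<mu> p \<and> strongly_local \<mu> p \<and>
     regular_form \<mu> p \<and> markov_process \<mu> p P"

definition gauss_kernel :: "real \<Rightarrow> 'a::euclidean_space \<Rightarrow> 'a \<Rightarrow> real" where
  "gauss_kernel t x y = (2 * pi * t) powr (- real DIM('a) / 2) * exp (- (dist x y)\<^sup>2 / (2 * t))"

definition stopped_at :: "'a set \<Rightarrow> (real \<Rightarrow> 'a) \<Rightarrow> real \<Rightarrow> 'a" where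
  "stopped_at D \<omega> t = (if \<exists>s\<in>{0..t}. \<omega> s \<in> D then \<omega> (Inf {s. 0 \<le> s \<and> \<omega> s \<in> D}) else \<omega> t)"

definition bounded_modification ::
  "'a::euclidean_space measure \<Rightarrow> ('a \<Rightarrow> (real \<Rightarrow> 'a) measure) \<Rightarrow> 'a measure \<Rightarrow> ('a \<Rightarrow> (real \<Rightarrow> 'a) measure) \<Rightarrow> bool" where
  "bounded_modification \<mu> P \<mu>' P' \<longleftrightarrow>
     (\<exists>D. open D \<and> connected D \<and> bounded D \<and>
        (\<forall>A\<in>sets borel. A \<subseteq> - D \<longrightarrow> emeasure \<mu> A = emeasure \<mu>' A) \<and>
        (\<forall>x. x \<notin> D \<longrightarrow> distr (P x) path_space (stopped_at D) = distr (P' x) path_space (stopped_at D)))"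

definition FHK2 :: "'a::metric_space measure \<Rightarrow> (real \<Rightarrow> 'a \<Rightarrow> 'a \<Rightarrow> real) \<Rightarrow> bool" where
  "FHK2 \<mu> p \<longleftrightarrow> (\<exists>c5 c6 c7 c8. c5 > 0 \<and> c6 > 0 \<and> c7 > 0 \<and> c8 > 0 \<and>
     (\<forall>t>0. \<forall>x y.
        c5 * exp (- c6 * (dist x y)\<^sup>2 / t) / measure \<mu> (ball x (sqrt t)) \<le> p t x y \<and>
        p t x y \<le> c7 * exp (- c8 * (dist x y)\<^sup>2 / t) / measure \<mu> (ball x (sqrt t))))"

text \<open>Newtonian capacity of a closed ball of radius eps in R^d: 1 / G(x,y) with |x-y| = eps.\<close>
definition newton_cap_ball :: "nat \<Rightarrow> real \<Rightarrow> real" where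
  "newton_cap_ball d \<epsilon> = 1 / (LBINT t:{0<..}. (2 * pi * t) powr (- real d / 2) * exp (- \<epsilon>\<^sup>2 / (2 * t)))"

definition sausage_vol :: "'a::metric_space measure \<Rightarrow> real \<Rightarrow> real \<Rightarrow> (real \<Rightarrow> 'a) \<Rightarrow> real" where
  "sausage_vol \<mu> \<epsilon> t \<omega> = measure \<mu> (\<Union>s\<in>{0..t}. ball (\<omega> s) \<epsilon>)"

end

theory Submission
  imports Defs
begin

text \<open>
  Let \<open>H(y,a,b)\<close> be the event that the path visits \<open>ball y \<epsilon>\<close> during \<open>[a,b]\<close>, so that the expected
  sausage volume is \<open>F(t) = \<integral> P\<^sup>x(H(y,0,t)) \<mu>(dy)\<close>. The Gaussian kernel bounds give
  \<open>P\<^sup>x(H(y,a,a+1)) = O((a+1)\<^bsup>-3\<^esup>)\<close> because the dimension is at least 6, so the volume that is visited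
  both before time \<open>s\<close> and during \<open>[s+u,s+u+1]\<close> is \<open>O(u\<^bsup>-2\<^esup>)\<close> on average. Hence \<open>F(t+h) - F(t)\<close>, for \<open>h \<le> 1\<close>, can be
  computed from the path after time \<open>t/2\<close> up to an error \<open>O(t\<^bsup>-2\<^esup>)\<close>. By the decay of the kernel a path that visits the
  modified region between the times \<open>t/2\<close> and \<open>t+1\<close> contributes only \<open>O(t\<^bsup>-2\<^esup>)\<close>, so the increment agrees with that of Brownian motion
  to this order. For Brownian motion the increments \<open>F\<^sub>0(u+h) - F\<^sub>0(u)\<close> decrease in \<open>u\<close>, with variation \<open>O(u\<^bsup>-2\<^esup>)\<close>
  beyond \<open>u\<close>, and comparing occupation times with the Newtonian potential identifies the rate \<open>F\<^sub>0(t)/t\<close>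
  with the capacity. So \<open>F(t+h) - F(t) = h Cap + O(t\<^bsup>-2\<^esup>)\<close>, which is summable.
\<close>

section \<open>Path space\<close>

text \<open>The exponent 3 is d/2 for d = 6: the kernel is bounded by a multiple of
  \<open>t powr -(d/2)\<close>. The delicate error comes from paths near the modified region, since
  the hypothesis on the laws says nothing after the first entrance. Restart the path at a time s of
  order t/2, at a position z. The bound on \<open>p s x z\<close> costs \<open>1/s^3\<close>
  uniformly in z, so what must be controlled is the integral over all z, a space of infinite
  measure, of the volume visited in the last unit of time by paths that also meet a large ball
  around the region. This integral grows only linearly in the elapsed time u: by symmetry of the
  kernel \<mu> is invariant, so each unit interval in which the large ball may be met contributes a
  bounded amount. Linear growth times \<open>1/s^3\<close> is the inverse square. The process is
  given by its finite-dimensional distributions only. Hence the Markov property is proved at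
  deterministic times, and hitting arguments decompose events at the first hit along a time grid. In
  the lower bound for the capacity the grid may overshoot the sphere; Gaussian tails make this error
  exponentially small in the inverse mesh.\<close>

definition stop_path :: "real \<Rightarrow> (real \<Rightarrow> 'a) \<Rightarrow> real \<Rightarrow> 'a" where
  "stop_path a \<omega> t = \<omega> (min t a)"

text \<open>The \<open>max\<close> freezes the shifted path at negative times, as membership in
  \<open>cpaths\<close> requires.\<close>

definition shift_path :: "real \<Rightarrow> (real \<Rightarrow> 'a) \<Rightarrow> real \<Rightarrow> 'a" where
  "shift_path a \<omega> t = \<omega> (a + max t 0)"

definition cyl :: "real set \<Rightarrow> (real \<Rightarrow> 'a set) \<Rightarrow> (real \<Rightarrow> 'a::topological_space) set" where
  "cyl J A = {\<omega>\<in>cpaths. \<forall>t\<in>J. \<omega> t \<in> A t}"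

text \<open>Only strictly positive times occur, because \<open>markov_process\<close> prescribes
  joint distributions only there.\<close>

definition cylinders :: "(real \<Rightarrow> 'a::topological_space) set set" where
  "cylinders = {cyl J A | J A. finite J \<and> J \<subseteq> {0<..} \<and> (\<forall>t. A t \<in> sets borel)}"

lemma space_path_space [simp]: "space path_space = cpaths"
  by (simp add: path_space_def space_restrict_space space_PiM)

lemma measurable_path_coord [measurable]:
  "(\<lambda>\<omega>. \<omega> t) \<in> path_space \<rightarrow>\<^sub>M borel"
  unfolding path_space_def by (intro measurable_restrict_space1) simp

lemma measurable_path_spaceI:
  assumes "\<And>\<omega>. \<omega> \<in> space M \<Longrightarrow> f \<omega> \<in> cpaths" and "\<And>t. (\<lambda>\<omega>. f \<omega> t) \<in> M \<rightarrow>\<^sub>M borel"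
  shows "f \<in> M \<rightarrow>\<^sub>M path_space"
  unfolding path_space_def using assms
  by (intro measurable_restrict_space2 measurable_PiM_single') (auto simp: space_PiM)

lemma cpaths_cont: "\<omega> \<in> cpaths \<Longrightarrow> continuous_on S \<omega>"
  using continuous_on_subset[of UNIV \<omega> S] unfolding cpaths_def by blast

lemma cpaths_nonpos: "\<omega> \<in> cpaths \<Longrightarrow> t \<le> 0 \<Longrightarrow> \<omega> t = \<omega> 0"
  unfolding cpaths_def by blast

lemma cpathsI: "continuous_on UNIV \<omega> \<Longrightarrow> (\<And>t. t \<le> 0 \<Longrightarrow> \<omega> t = \<omega> 0) \<Longrightarrow> \<omega> \<in> cpaths"
  unfolding cpaths_def by blast

lemma stop_path_cpaths:
  assumes "0 \<le> a" "\<omega> \<in> cpaths" shows "stop_path a \<omega> \<in> cpaths"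
proof -
  have "continuous_on UNIV (\<lambda>t. \<omega> (min t a))"
    by (rule continuous_on_compose2[OF cpaths_cont[OF assms(2), of UNIV]]) (auto intro!: continuous_intros)
  moreover have "\<omega> (min t a) = \<omega> (min 0 a)" if "t \<le> 0" for t
    using cpaths_nonpos[OF assms(2), of t] assms(1) that by (simp add: min_def)
  ultimately show ?thesis unfolding stop_path_def by (intro cpathsI)
qed

lemma shift_path_cpaths:
  assumes "0 \<le> a" "\<omega> \<in> cpaths" shows "shift_path a \<omega> \<in> cpaths"
proof -
  have "continuous_on UNIV (\<lambda>t. \<omega> (a + max t 0))"
    by (rule continuous_on_compose2[OF cpaths_cont[OF assms(2), of UNIV]]) (auto intro!: continuous_intros)
  then show ?thesis unfolding shift_path_def by (intro cpathsI) (auto simp: max_def)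
qed

lemma measurable_stop_path [measurable]: "0 \<le> a \<Longrightarrow> stop_path a \<in> path_space \<rightarrow>\<^sub>M path_space"
  by (rule measurable_path_spaceI) (auto simp: stop_path_cpaths stop_path_def)

lemma measurable_shift_path [measurable]: "0 \<le> a \<Longrightarrow> shift_path a \<in> path_space \<rightarrow>\<^sub>M path_space"
  by (rule measurable_path_spaceI) (auto simp: shift_path_cpaths shift_path_def)

lemma cyl_Int: "cyl J A \<inter> cyl K B = cyl (J \<union> K) (\<lambda>t. (if t \<in> J then A t else UNIV) \<inter> (if t \<in> K then B t else UNIV))"
  unfolding cyl_def by auto

lemma cyl_in_cylinders: "finite J \<Longrightarrow> J \<subseteq> {0<..} \<Longrightarrow> (\<And>t. A t \<in> sets borel) \<Longrightarrow> cyl J A \<in> cylinders"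
  unfolding cylinders_def by auto

lemma Int_stable_cylinders: "Int_stable cylinders"
proof (rule Int_stableI)
  fix a b :: "(real \<Rightarrow> 'a) set" assume "a \<in> cylinders" "b \<in> cylinders"
  then obtain J A K B where "a = cyl J A" "finite J" "J \<subseteq> {0<..}" "\<And>t. A t \<in> sets borel"
    "b = cyl K B" "finite K" "K \<subseteq> {0<..}" "\<And>t. B t \<in> sets borel"
    unfolding cylinders_def by auto
  then show "a \<inter> b \<in> cylinders" by (simp add: cyl_Int) (rule cyl_in_cylinders, auto)
qed

lemma cyl_sets [measurable]: "finite J \<Longrightarrow> (\<And>t. A t \<in> sets borel) \<Longrightarrow> cyl J A \<in> sets path_space"
proof -
  assume "finite J" "\<And>t. A t \<in> sets borel"
  then have "{\<omega>\<in>space path_space. \<forall>t\<in>J. \<omega> t \<in> A t} \<in> sets path_space"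
    by (intro sets.sets_Collect_finite_All measurable_sets_Collect[OF measurable_path_coord]) auto
  then show ?thesis by (simp add: cyl_def)
qed

lemma cylinders_sub_sets: "cylinders \<subseteq> sets path_space"
  unfolding cylinders_def by auto

lemma cylinders_cpaths: "cpaths \<in> cylinders"
  using cyl_in_cylinders[of "{}" "\<lambda>_. UNIV"] by (simp add: cyl_def)

lemma cylinders_sub: "cylinders \<subseteq> Pow cpaths"
  unfolding cylinders_def cyl_def by auto

text \<open>Times \<open>t > 0\<close> suffice because \<open>\<omega> 0\<close> is the limit of \<open>\<omega> (1/n)\<close>.\<close>
lemma sets_path_space: "sets (path_space :: (real \<Rightarrow> 'a::metric_space) measure) = sigma_sets cpaths cylinders"
proof
  show "sigma_sets cpaths cylinders \<subseteq> sets (path_space :: (real \<Rightarrow> 'a) measure)"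
    using sets.sigma_sets_subset[of cylinders path_space] unfolding space_path_space
    by (metis (no_types, lifting) cylinders_sub_sets)
  let ?N = "measure_of cpaths cylinders (\<lambda>_. 0) :: (real \<Rightarrow> 'a) measure"
  have sp: "space ?N = cpaths" by (rule space_measure_of_conv)
  have st: "sets ?N = sigma_sets cpaths cylinders" by (rule sets_measure_of[OF cylinders_sub])
  have pos: "(\<lambda>\<omega>. \<omega> t) \<in> ?N \<rightarrow>\<^sub>M borel" if "t > 0" for t
  proof (rule measurableI)
    fix A :: "'a set" assume "A \<in> sets borel"
    then have "cyl {t} (\<lambda>_. A) \<in> cylinders" using that by (intro cyl_in_cylinders) auto
    moreover have "(\<lambda>\<omega>. \<omega> t) -` A \<inter> space ?N = cyl {t} (\<lambda>_. A)" unfolding sp by (auto simp: cyl_def)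
    ultimately show "(\<lambda>\<omega>. \<omega> t) -` A \<inter> space ?N \<in> sets ?N" using st by auto
  qed auto
  have "(\<lambda>\<omega>. \<omega> t) \<in> ?N \<rightarrow>\<^sub>M borel" for t
  proof (cases "t > 0")
    case False
    show ?thesis
    proof (rule borel_measurable_LIMSEQ_metric)
      show "(\<lambda>\<omega>. \<omega> (1 / Suc n)) \<in> ?N \<rightarrow>\<^sub>M borel" for n by (rule pos) simp
      fix \<omega> :: "real \<Rightarrow> 'a" assume "\<omega> \<in> space ?N"
      then have w: "\<omega> \<in> cpaths" unfolding sp .
      have "(\<lambda>n. \<omega> (1 / Suc n)) \<longlonglongrightarrow> \<omega> 0"
        using cpaths_cont[OF w, of UNIV] LIMSEQ_inverse_real_of_nat
        by (intro continuous_on_tendsto_compose[of UNIV \<omega>]) (auto simp: inverse_eq_divide)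
      then show "(\<lambda>n. \<omega> (1 / Suc n)) \<longlonglongrightarrow> \<omega> t" using cpaths_nonpos[OF w, of t] False by simp
    qed
  qed (rule pos)
  then have "(\<lambda>\<omega>. \<omega>) \<in> ?N \<rightarrow>\<^sub>M path_space" by (intro measurable_path_spaceI) (auto simp only: sp)
  then show "sets (path_space :: (real \<Rightarrow> 'a) measure) \<subseteq> sigma_sets cpaths cylinders"
    unfolding st[symmetric]
  proof (intro subsetI)
    fix A :: "(real \<Rightarrow> 'a) set" assume m: "(\<lambda>\<omega>. \<omega>) \<in> ?N \<rightarrow>\<^sub>M path_space" and A: "A \<in> sets path_space"
    have "A \<subseteq> cpaths" using sets.sets_into_space[OF A] by simp
    then show "A \<in> sets ?N" using measurable_sets[OF m A] sp by (simp add: Int_absorb2)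
  qed
qed

text \<open>The pi-lambda theorem for laws of paths. The Markov property and translation invariance
  are both reduced by it to finitely many positive times.\<close>

lemma path_measure_eqI:
  fixes M N :: "(real \<Rightarrow> 'a::metric_space) measure"
  assumes "sets M = sets path_space" "sets N = sets path_space" "finite_measure M"
    and eq: "\<And>J A. finite J \<Longrightarrow> J \<subseteq> {0<..} \<Longrightarrow> (\<And>t. A t \<in> sets borel) \<Longrightarrow> emeasure M (cyl J A) = emeasure N (cyl J A)"
  shows "M = N"
proof (rule measure_eqI_generator_eq[where A="\<lambda>_. cpaths" and E=cylinders and \<Omega>=cpaths])
  show "emeasure M X = emeasure N X" if "X \<in> cylinders" for X
    using that eq unfolding cylinders_def by blast
  show "emeasure M cpaths \<noteq> \<infinity>" using finite_measure.emeasure_finite[OF assms(3)] by simp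
qed (use assms(1,2) sets_path_space Int_stable_cylinders cylinders_sub cylinders_cpaths in auto)

section \<open>Finite-dimensional distributions and the Markov property\<close>

text \<open>Extends \<open>kprob\<close> in two ways: values in \<open>ennreal\<close> make Tonelli
  and monotone convergence available without integrability conditions, and the terminal function
  \<open>f\<close> can hold the continuation of the process after the last time.\<close>

fun nnkprob :: "'a measure \<Rightarrow> (real \<Rightarrow> 'a \<Rightarrow> 'a \<Rightarrow> real) \<Rightarrow> ('a \<Rightarrow> ennreal) \<Rightarrow> 'a \<Rightarrow> real \<Rightarrow> (real \<times> 'a set) list \<Rightarrow> ennreal" where
  "nnkprob \<mu> p f x s [] = f x"
| "nnkprob \<mu> p f x s ((t, A) # rest) = (\<integral>\<^sup>+y. indicator A y * ennreal (p (t - s) x y) * nnkprob \<mu> p f y t rest \<partial>\<mu>)"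

text \<open>The current time \<open>s\<close> is a parameter so that in inductions the condition
  passes to the tail of the list with \<open>s\<close> advanced.\<close>

definition adm :: "real \<Rightarrow> (real \<times> 'a::topological_space set) list \<Rightarrow> bool" where
  "adm s ts \<longleftrightarrow> sorted_wrt (<) (map fst ts) \<and> (\<forall>(t, A)\<in>set ts. s < t \<and> A \<in> sets borel)"

lemma adm_Nil [simp]: "adm s []" by (simp add: adm_def)

lemma adm_Cons: "adm s ((t, A) # ts) \<longleftrightarrow> s < t \<and> A \<in> sets borel \<and> adm t ts"
  unfolding adm_def by force

lemma adm_append_single: "adm s (ts @ [(a, A)]) \<Longrightarrow> B \<in> sets borel \<Longrightarrow> adm s (ts @ [(a, B)])"
  unfolding adm_def by (auto simp: sorted_wrt_append)

definition lcyl :: "(real \<times> 'a::topological_space set) list \<Rightarrow> (real \<Rightarrow> 'a) set" where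
  "lcyl ts = {\<omega>\<in>cpaths. \<forall>(t, A)\<in>set ts. \<omega> t \<in> A}"

lemma lcyl_sets [measurable]: "adm s ts \<Longrightarrow> lcyl ts \<in> sets path_space"
proof -
  assume a: "adm s ts"
  have "{\<omega>\<in>space path_space. \<forall>u\<in>set ts. \<omega> (fst u) \<in> snd u} \<in> sets path_space"
    using a unfolding adm_def
    by (intro sets.sets_Collect_finite_All measurable_sets_Collect[OF measurable_path_coord]) auto
  then show ?thesis by (simp add: lcyl_def case_prod_beta)
qed

text \<open>Covers both the process on the modified space and Brownian motion with Lebesgue measure,
  so that the Markov property is proved once. No estimate of the kernel enters at this
  stage.\<close>

locale kernel_process =
  fixes \<mu> :: "'a::euclidean_space measure" and p :: "real \<Rightarrow> 'a \<Rightarrow> 'a \<Rightarrow> real"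
    and P :: "'a \<Rightarrow> (real \<Rightarrow> 'a) measure"
  assumes sets_mu [simp, measurable_cong]: "sets \<mu> = sets borel"
    and sigma_finite_mu: "sigma_finite_measure \<mu>"
    and p_measurable: "0 < t \<Longrightarrow> case_prod (p t) \<in> borel_measurable (borel \<Otimes>\<^sub>M borel)"
    and p_nonneg: "0 < t \<Longrightarrow> 0 \<le> p t x y"
    and markov: "markov_process \<mu> p P"
begin

sublocale mu: sigma_finite_measure \<mu> by (rule sigma_finite_mu)

lemma space_mu [simp]: "space \<mu> = UNIV"
  using sets_eq_imp_space_eq[OF sets_mu] by simp

lemma measurable_mu [simp]: "measurable \<mu> N = measurable borel N"
  by (rule measurable_cong_sets) auto

lemma p_measurable2 [measurable]:
  "0 < t \<Longrightarrow> f \<in> borel_measurable M \<Longrightarrow> g \<in> borel_measurable M \<Longrightarrow> (\<lambda>x. p t (f x) (g x)) \<in> borel_measurable M"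
  using measurable_compose[OF measurable_Pair p_measurable, of f M g t] by simp

lemma p_measurable1: "0 < t \<Longrightarrow> p t x \<in> borel_measurable borel"
  by (rule p_measurable2[of t "\<lambda>_. x" borel "\<lambda>y. y"]) simp_all

lemma prob_space_P: "prob_space (P x)" and sets_P [simp, measurable_cong]: "sets (P x) = sets path_space"
  and P_start: "AE \<omega> in P x. \<omega> 0 = x"
  using markov unfolding markov_process_def by blast+

sublocale P: prob_space "P x" for x by (rule prob_space_P)

lemma space_P [simp]: "space (P x) = cpaths"
  using sets_eq_imp_space_eq[OF sets_P] by simp

lemma measurable_P [simp]: "measurable (P x) N = measurable path_space N"
  by (rule measurable_cong_sets) auto

lemma P_lcyl: "adm 0 ts \<Longrightarrow> measure (P x) (lcyl ts) = kprob \<mu> p x 0 ts"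
  using markov unfolding markov_process_def adm_def lcyl_def by auto

text \<open>Conservativeness is read off from the process: the one-time cylinder over
  \<open>UNIV\<close> is the whole path space and has probability 1. Integrability comes for free,
  because the Bochner integral of a non-integrable function is 0 by default.\<close>

lemma p_integral: assumes "0 < t" shows "integrable \<mu> (p t x)" "(\<integral>y. p t x y \<partial>\<mu>) = 1"
proof -
  have a: "adm 0 [(t, UNIV)]" using assms by (simp add: adm_Cons)
  have "lcyl [(t, UNIV :: 'a set)] = space (P x)" by (simp add: lcyl_def)
  then have "(\<integral>y. p t x y \<partial>\<mu>) = 1" using P_lcyl[OF a, of x] P.prob_space[of x] by simp
  then show "(\<integral>y. p t x y \<partial>\<mu>) = 1" "integrable \<mu> (p t x)" using not_integrable_integral_eq by force+
qed

lemma p_nn_integral: assumes "0 < t" shows "(\<integral>\<^sup>+y. ennreal (p t x y) \<partial>\<mu>) = 1"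
  using nn_integral_eq_integral[OF p_integral(1)[OF assms, of x]] p_integral(2)[OF assms, of x] p_nonneg[OF assms] by simp

lemma nnkprob_measurable [measurable]:
  assumes "adm s ts" "f \<in> borel_measurable borel"
  shows "(\<lambda>x. nnkprob \<mu> p f x s ts) \<in> borel_measurable borel"
  using assms
proof (induction ts arbitrary: s)
  case (Cons u ts)
  obtain t A where u: "u = (t, A)" by force
  have [measurable]: "A \<in> sets borel" "(\<lambda>x. nnkprob \<mu> p f x t ts) \<in> borel_measurable borel" and "t - s > 0"
    using Cons u by (auto simp: adm_Cons)
  note [measurable] = p_measurable2[OF \<open>t - s > 0\<close>] p_measurable1[OF \<open>t - s > 0\<close>]
  show ?case unfolding u by simp
qed simp

text \<open>The four claims need each other in the induction: the integral of one step exists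
  because the tail is measurable with values between 0 and 1, and only then does the Bochner
  integral agree with the nonnegative one.\<close>

lemma kprob_bounds:
  assumes "adm s ts" 
  shows "(\<lambda>x. kprob \<mu> p x s ts) \<in> borel_measurable borel \<and> (\<forall>x. 0 \<le> kprob \<mu> p x s ts \<and> kprob \<mu> p x s ts \<le> 1 \<and> ennreal (kprob \<mu> p x s ts) = nnkprob \<mu> p (\<lambda>_. 1) x s ts)"
  using assms
proof (induction ts arbitrary: s)
  case (Cons u ts)
  obtain t A where u: "u = (t, A)" by force
  have IH: "(\<lambda>x. kprob \<mu> p x t ts) \<in> borel_measurable borel" "\<And>x. 0 \<le> kprob \<mu> p x t ts" "\<And>x. kprob \<mu> p x t ts \<le> 1"
    "\<And>x. ennreal (kprob \<mu> p x t ts) = nnkprob \<mu> p (\<lambda>_. 1) x t ts" and A: "A \<in> sets borel" and ts: "t - s > 0"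
    using Cons u by (auto simp: adm_Cons)
  note [measurable] = p_measurable2[OF \<open>t - s > 0\<close>] p_measurable1[OF \<open>t - s > 0\<close>] IH(1) A
  let ?g = "\<lambda>x y. indicator A y * p (t - s) x y * kprob \<mu> p y t ts"
  have g0: "0 \<le> ?g x y" and g1: "?g x y \<le> p (t - s) x y" for x y
    using IH(2,3)[of y] p_nonneg[OF ts, of x y] mult_left_le[of "kprob \<mu> p y t ts" "p (t-s) x y"] by (auto simp: indicator_def)
  have int: "integrable \<mu> (?g x)" for x
    by (rule Bochner_Integration.integrable_bound[OF p_integral(1)[OF ts, of x]]) (use g0 g1 p_nonneg[OF ts] in \<open>auto simp del: mult_nonneg_nonneg\<close>)
  have "integral\<^sup>L \<mu> (?g x) \<le> integral\<^sup>L \<mu> (p (t - s) x)" for x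
    by (rule integral_mono[OF int p_integral(1)[OF ts] g1])
  moreover have "ennreal (integral\<^sup>L \<mu> (?g x)) = nnkprob \<mu> p (\<lambda>_. 1) x s (u # ts)" for x
    unfolding u using nn_integral_eq_integral[OF int, of x] g0 
    by (simp add: ennreal_mult' IH p_nonneg[OF ts] ennreal_indicator flip: IH(4))
  moreover have "(\<lambda>x. integral\<^sup>L \<mu> (?g x)) \<in> borel_measurable borel"
    by (intro mu.borel_measurable_lebesgue_integral) simp
  ultimately show ?case unfolding u using g0 p_integral(2)[OF ts] by (auto intro!: integral_nonneg_AE)
qed simp

lemma emeasure_lcyl: "adm 0 ts \<Longrightarrow> emeasure (P x) (lcyl ts) = nnkprob \<mu> p (\<lambda>_. 1) x 0 ts"
  using kprob_bounds[of 0 ts] P_lcyl[of ts x] by (simp add: P.emeasure_eq_measure)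

text \<open>Immediate from the recursion, yet the algebraic core of the Markov property: what
  follows time \<open>a\<close> enters only through a function of the position at
  \<open>a\<close>.\<close>

lemma nnkprob_append: "nnkprob \<mu> p f x s (ts @ (a, A) # us) = nnkprob \<mu> p (\<lambda>y. nnkprob \<mu> p f y a us) x s (ts @ [(a, A)])"
  by (induction ts arbitrary: x s) auto

lemma nnkprob_indicator: "nnkprob \<mu> p (\<lambda>y. indicator B y * c) x s (ts @ [(a, A)]) = nnkprob \<mu> p (\<lambda>y. c) x s (ts @ [(a, A \<inter> B)])"
  by (induction ts arbitrary: x s) (auto simp: indicator_inter_arith mult_ac)

lemma nnkprob_shift: "nnkprob \<mu> p f x (a + s) (map (\<lambda>(t, A). (a + t, A)) ts) = nnkprob \<mu> p f x s ts"
  by (induction ts arbitrary: x s) auto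

lemma nnkprob_cmult:
  assumes "adm s ts" "f \<in> borel_measurable borel"
  shows "nnkprob \<mu> p (\<lambda>y. c * f y) x s ts = c * nnkprob \<mu> p f x s ts"
  using assms
proof (induction ts arbitrary: s x)
  case (Cons u ts)
  obtain t A where u: "u = (t, A)" by force
  have [measurable]: "A \<in> sets borel" and t: "t - s > 0" "adm t ts" using Cons u by (auto simp: adm_Cons)
  note [measurable] = p_measurable2[OF t(1)] p_measurable1[OF t(1)] nnkprob_measurable[OF t(2) Cons.prems(2)]
  show ?case unfolding u using Cons.IH[OF t(2) Cons.prems(2)] by (simp add: mult.left_commute nn_integral_cmult)
qed simp

lemma nnkprob_add:
  assumes "adm s ts" "f \<in> borel_measurable borel" "g \<in> borel_measurable borel"
  shows "nnkprob \<mu> p (\<lambda>y. f y + g y) x s ts = nnkprob \<mu> p f x s ts + nnkprob \<mu> p g x s ts"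
  using assms
proof (induction ts arbitrary: s x)
  case (Cons u ts)
  obtain t A where u: "u = (t, A)" by force
  have [measurable]: "A \<in> sets borel" and t: "t - s > 0" "adm t ts" using Cons u by (auto simp: adm_Cons)
  note [measurable] = p_measurable2[OF t(1)] p_measurable1[OF t(1)] nnkprob_measurable[OF t(2) Cons.prems(2)] nnkprob_measurable[OF t(2) Cons.prems(3)]
  show ?case unfolding u using Cons.IH[OF t(2) Cons.prems(2,3)] by (simp add: distrib_left nn_integral_add)
qed simp

lemma nnkprob_mono: "(\<And>y. f y \<le> g y) \<Longrightarrow> nnkprob \<mu> p f x s ts \<le> nnkprob \<mu> p g x s ts"
  by (induction ts arbitrary: s x) (auto intro!: nn_integral_mono mult_left_mono)

lemma nnkprob_SUP:
  assumes "adm s ts" "\<And>i. U i \<in> borel_measurable borel" "incseq U"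
  shows "nnkprob \<mu> p (\<lambda>y. SUP i. U i y) x s ts = (SUP i. nnkprob \<mu> p (U i) x s ts)"
  using assms(1)
proof (induction ts arbitrary: s x)
  case (Cons u ts)
  obtain t A where u: "u = (t, A)" by force
  have [measurable]: "A \<in> sets borel" and t: "t - s > 0" "adm t ts" using Cons u by (auto simp: adm_Cons)
  note [measurable] = p_measurable2[OF t(1)] p_measurable1[OF t(1)] nnkprob_measurable[OF t(2) assms(2)]
  show ?case unfolding u using Cons.IH[OF t(2)] 
    by (simp add: SUP_mult_left_ennreal)
       (intro nn_integral_monotone_convergence_SUP, auto intro!: incseq_SucI le_funI mult_left_mono nnkprob_mono incseqD[OF assms(3), THEN le_funD])
qed simp

text \<open>Standard induction over nonnegative measurable functions;
  \<open>nnkprob_indicator\<close>, \<open>nnkprob_cmult\<close>, \<open>nnkprob_add\<close> and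
  \<open>nnkprob_SUP\<close> are its cases.\<close>

lemma nn_integral_lcyl:
  assumes "f \<in> borel_measurable borel" "adm 0 (ts @ [(a, A)])"
  shows "(\<integral>\<^sup>+\<omega>. indicator (lcyl (ts @ [(a, A)])) \<omega> * f (\<omega> a) \<partial>P x) = nnkprob \<mu> p f x 0 (ts @ [(a, A)])"
  using assms(1)
proof (induction rule: borel_measurable_induct)
  case (cong f g)
  then have "f = g" by auto
  with cong show ?case by simp
next
  case (set B)
  have "(indicator (lcyl (ts @ [(a, A)])) \<omega> * indicator B (\<omega> a) :: ennreal) = indicator (lcyl (ts @ [(a, A \<inter> B)])) \<omega>" for \<omega>
    by (auto simp: lcyl_def indicator_def)
  moreover have adm2: "adm 0 (ts @ [(a, A \<inter> B)])" 
    using assms(2) set by (intro adm_append_single[OF assms(2)]) (auto simp: adm_def)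
  ultimately show ?case
    using emeasure_lcyl[OF adm2, of x] nnkprob_indicator[of B 1 x 0 ts a A] lcyl_sets[OF adm2] by simp
next
  case (mult u c)
  note [measurable] = lcyl_sets[OF assms(2)] mult(2)
  have "(\<integral>\<^sup>+\<omega>. indicator (lcyl (ts @ [(a, A)])) \<omega> * (c * u (\<omega> a)) \<partial>P x) = c * (\<integral>\<^sup>+\<omega>. indicator (lcyl (ts @ [(a, A)])) \<omega> * u (\<omega> a) \<partial>P x)"
    by (subst nn_integral_cmult[symmetric]) (auto simp: mult_ac)
  then show ?case using mult by (simp add: nnkprob_cmult[OF assms(2)])
next
  case (add u v)
  note [measurable] = lcyl_sets[OF assms(2)] add(1,3)
  show ?case using add by (simp add: nnkprob_add[OF assms(2)] distrib_left nn_integral_add)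
next
  case (seq U)
  note [measurable] = lcyl_sets[OF assms(2)] seq(1)
  have eq: "(SUP i. U i) = (\<lambda>y. SUP i. U i y)" by (auto simp: image_comp)
  have "(\<integral>\<^sup>+\<omega>. indicator (lcyl (ts @ [(a, A)])) \<omega> * (SUP i. U i (\<omega> a)) \<partial>P x) =
     (SUP i. \<integral>\<^sup>+\<omega>. indicator (lcyl (ts @ [(a, A)])) \<omega> * U i (\<omega> a) \<partial>P x)"
    unfolding SUP_mult_left_ennreal
    by (intro nn_integral_monotone_convergence_SUP) (auto intro!: incseq_SucI le_funI mult_left_mono incseqD[OF seq(3), THEN le_funD])
  then show ?case unfolding eq using nnkprob_SUP[OF assms(2) seq(1) seq(3)] seq by simp
qed

lemma cyl_lcyl: "finite J \<Longrightarrow> cyl J A = lcyl (map (\<lambda>t. (t, A t)) (sorted_list_of_set J))"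
  by (auto simp: cyl_def lcyl_def)

lemma adm_sorted_list: "finite J \<Longrightarrow> (\<And>t. t \<in> J \<Longrightarrow> s < t) \<Longrightarrow> (\<And>t. A t \<in> sets borel) \<Longrightarrow> adm s (map (\<lambda>t. (t, A t)) (sorted_list_of_set J))"
  unfolding adm_def by (auto simp: comp_def strict_sorted_list_of_set)

lemma emeasure_P_measurable_cyl:
  assumes "finite J" "J \<subseteq> {0<..}" "\<And>t. A t \<in> sets borel"
  shows "(\<lambda>x. emeasure (P x) (cyl J A)) \<in> borel_measurable borel"
proof -
  have a: "adm 0 (map (\<lambda>t. (t, A t)) (sorted_list_of_set J))" using assms by (intro adm_sorted_list) auto
  show ?thesis unfolding cyl_lcyl[OF assms(1)] emeasure_lcyl[OF a] by (rule nnkprob_measurable[OF a]) simp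
qed

lemma P_measurable: "P \<in> borel \<rightarrow>\<^sub>M prob_algebra path_space"
proof (rule measurable_prob_algebra_generated[where \<Omega>=cpaths and G=cylinders])
  show "(\<lambda>a. emeasure (P a) A) \<in> borel_measurable borel" if "A \<in> cylinders" for A
    using that emeasure_P_measurable_cyl unfolding cylinders_def by blast
qed (auto simp: sets_path_space Int_stable_cylinders prob_space_P dest: cylinders_sub[THEN subsetD])

lemma P_measurable_subprob [measurable]: "P \<in> borel \<rightarrow>\<^sub>M subprob_algebra path_space"
  by (rule measurable_prob_algebraD[OF P_measurable])

lemma emeasure_P_measurable [measurable]:
  "F \<in> sets path_space \<Longrightarrow> (\<lambda>x. emeasure (P x) F) \<in> borel_measurable borel"
  by (rule measurable_emeasure_kernel[OF P_measurable_subprob])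

text \<open>Stopping at \<open>a\<close> replaces each coordinate at a time \<open>t \<ge> a\<close>
  by \<open>\<omega> a\<close>, so all these constraints merge into one set \<open>A'\<close> at
  time \<open>a\<close>. The past event becomes a list cylinder ending at \<open>a\<close>, the
  future event a list of later times, and \<open>nnkprob_append\<close> separates the two.\<close>

lemma markov_cyl:
  assumes J: "finite J" "J \<subseteq> {0<..}" "\<And>t. A t \<in> sets borel"
    and K: "finite K" "K \<subseteq> {0<..}" "\<And>t. B t \<in> sets borel" and a: "0 < a"
  shows "emeasure (P x) {\<omega>\<in>cpaths. stop_path a \<omega> \<in> cyl J A \<and> shift_path a \<omega> \<in> cyl K B} =
    (\<integral>\<^sup>+\<omega>. indicator (cyl J A) (stop_path a \<omega>) * emeasure (P (\<omega> a)) (cyl K B) \<partial>P x)"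
proof -
  define J' where "J' = {t\<in>J. t < a}"
  define A' where "A' = (\<Inter>t\<in>{t\<in>J. t \<ge> a}. A t)"
  define l1 where "l1 = map (\<lambda>t. (t, A t)) (sorted_list_of_set J')"
  define l2 where "l2 = map (\<lambda>t. (t, B t)) (sorted_list_of_set K)"
  have fJ: "finite J'" using J by (simp add: J'_def)
  have A': "A' \<in> sets borel"
  \<comment> \<open>If no time of \<open>J\<close> is at least \<open>a\<close>, the intersection
    runs over the empty set and \<open>A'\<close> is \<open>UNIV\<close>.\<close>
  proof (cases "{t\<in>J. t \<ge> a} = {}")
    case True
    then show ?thesis unfolding A'_def by (simp only: True) simp
  next
    case False
    then show ?thesis unfolding A'_def using J by (intro sets.finite_INT) auto
  qed
  have l1: "adm 0 (l1 @ [(a, A')])"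
    using adm_sorted_list[OF fJ, of 0 A] J A' a fJ unfolding adm_def l1_def by (auto simp: sorted_wrt_append J'_def)
  have l2: "adm 0 l2" unfolding l2_def using K by (intro adm_sorted_list) auto
  let ?l2 = "map (\<lambda>(t, A). (a + t, A)) l2"
  have l12: "adm 0 (l1 @ (a, A') # ?l2)"
  proof -
    have "0 < fst u" "snd u \<in> sets borel" if "u \<in> set l2" for u using l2 that unfolding adm_def by auto
    moreover have "sorted_wrt (<) (map fst ?l2)" using l2 unfolding adm_def
      by (simp add: sorted_wrt_map case_prod_beta comp_def)
    moreover have "fst u < a" "0 < fst u" "snd u \<in> sets borel" if "u \<in> set l1" for u
      using l1 that unfolding adm_def by (auto simp: sorted_wrt_append)
    moreover have "sorted_wrt (<) (map fst l1)" using l1 unfolding adm_def by (simp add: sorted_wrt_append)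
    moreover from calculation have "fst u < a + fst v" if "u \<in> set l1" "v \<in> set l2" for u v
      using that by (metis add.right_neutral add_strict_mono)
    ultimately show ?thesis using a A' unfolding adm_def
      by (auto simp: sorted_wrt_append add_pos_pos split: prod.splits)
  qed
  have 1: "stop_path a \<omega> \<in> cyl J A \<longleftrightarrow> \<omega> \<in> lcyl (l1 @ [(a, A')])" if w: "\<omega> \<in> cpaths" for \<omega>
  proof -
    have "(\<forall>t\<in>J. \<omega> (min t a) \<in> A t) \<longleftrightarrow> (\<forall>t\<in>J'. \<omega> t \<in> A t) \<and> \<omega> a \<in> A'"
    proof -
      have "\<omega> (min t a) \<in> A t \<longleftrightarrow> (t < a \<longrightarrow> \<omega> t \<in> A t) \<and> (a \<le> t \<longrightarrow> \<omega> a \<in> A t)" for t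
        by (cases "t < a") (simp_all add: min_def)
      then show ?thesis unfolding J'_def A'_def by blast
    qed
    then show ?thesis using w stop_path_cpaths[OF _ w, of a] a fJ
      by (simp add: cyl_def lcyl_def l1_def stop_path_def ball_Un conj_commute)
  qed
  have 2: "shift_path a \<omega> \<in> cyl K B \<longleftrightarrow> \<omega> \<in> lcyl ?l2" if w: "\<omega> \<in> cpaths" for \<omega>
  proof -
    have "(\<forall>t\<in>K. \<omega> (a + max t 0) \<in> B t) \<longleftrightarrow> (\<forall>t\<in>K. \<omega> (a + t) \<in> B t)"
      using K(2) by (intro ball_cong) (auto simp: max_def)
    then show ?thesis using w shift_path_cpaths[OF _ w, of a] a K(1)
      by (simp add: cyl_def lcyl_def l2_def shift_path_def comp_def)
  qed
  have "{\<omega>\<in>cpaths. stop_path a \<omega> \<in> cyl J A \<and> shift_path a \<omega> \<in> cyl K B} = lcyl (l1 @ (a, A') # ?l2)"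
    using 1 2 by (auto simp: lcyl_def)
  moreover have "(\<integral>\<^sup>+\<omega>. indicator (cyl J A) (stop_path a \<omega>) * emeasure (P (\<omega> a)) (cyl K B) \<partial>P x) =
     (\<integral>\<^sup>+\<omega>. indicator (lcyl (l1 @ [(a, A')])) \<omega> * emeasure (P (\<omega> a)) (cyl K B) \<partial>P x)"
    using 1 by (intro nn_integral_cong) (auto simp: indicator_def)
  moreover have "\<dots> = nnkprob \<mu> p (\<lambda>y. emeasure (P y) (cyl K B)) x 0 (l1 @ [(a, A')])"
    using K by (intro nn_integral_lcyl l1 emeasure_P_measurable) auto
  moreover have "emeasure (P y) (cyl K B) = nnkprob \<mu> p (\<lambda>_. 1) y a ?l2" for y
    using nnkprob_shift[of "\<lambda>_. 1" y a 0 l2] emeasure_lcyl[OF l2, of y] cyl_lcyl[OF K(1), of B] by (simp add: l2_def)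
  ultimately show ?thesis using emeasure_lcyl[OF l12, of x] nnkprob_append[of "\<lambda>_. 1" x 0 l1 a A' ?l2] by simp
qed

lemma measurable_P_at [measurable]: "F \<in> sets path_space \<Longrightarrow> (\<lambda>\<omega>. emeasure (P (\<omega> a)) F) \<in> borel_measurable path_space"
  by (rule measurable_compose[OF measurable_path_coord emeasure_P_measurable])

lemma emeasure_stop_shift:
  assumes [measurable]: "E \<in> sets path_space" "F \<in> sets path_space" and "0 < a"
  shows "emeasure (P x) {\<omega>\<in>cpaths. stop_path a \<omega> \<in> E \<and> shift_path a \<omega> \<in> F} =
    (\<integral>\<^sup>+\<omega>. indicator E (stop_path a \<omega>) * indicator F (shift_path a \<omega>) \<partial>P x)"
proof -
  have a0: "0 \<le> a" using assms by simp
  note [measurable] = measurable_stop_path[OF a0] measurable_shift_path[OF a0]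
  have m: "{\<omega>\<in>space path_space. stop_path a \<omega> \<in> E \<and> shift_path a \<omega> \<in> F} \<in> sets path_space" by measurable
  then have "emeasure (P x) {\<omega>\<in>cpaths. stop_path a \<omega> \<in> E \<and> shift_path a \<omega> \<in> F} = 
     (\<integral>\<^sup>+\<omega>. indicator {\<omega>\<in>cpaths. stop_path a \<omega> \<in> E \<and> shift_path a \<omega> \<in> F} \<omega> \<partial>P x)"
    by (intro nn_integral_indicator[symmetric]) simp
  also have "\<dots> = (\<integral>\<^sup>+\<omega>. indicator E (stop_path a \<omega>) * indicator F (shift_path a \<omega>) \<partial>P x)"
    by (intro nn_integral_cong) (auto split: split_indicator)
  finally show ?thesis .
qed

lemma emeasure_distr_density:
  assumes "f \<in> borel_measurable M" "g \<in> M \<rightarrow>\<^sub>M N" "F \<in> sets N"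
  shows "emeasure (distr (density M f) N g) F = (\<integral>\<^sup>+\<omega>. f \<omega> * indicator F (g \<omega>) \<partial>M)"
proof -
  have "emeasure (distr (density M f) N g) F = (\<integral>\<^sup>+y. indicator F y \<partial>distr (density M f) N g)"
    using assms by simp
  also have "\<dots> = (\<integral>\<^sup>+\<omega>. indicator F (g \<omega>) \<partial>density M f)"
    using assms by (intro nn_integral_distr) auto
  also have "\<dots> = (\<integral>\<^sup>+\<omega>. f \<omega> * indicator F (g \<omega>) \<partial>M)"
    using assms by (intro nn_integral_density) auto
  finally show ?thesis .
qed

lemma finite_distr_density:
  assumes "f \<in> borel_measurable (P x)" "g \<in> P x \<rightarrow>\<^sub>M N" "\<And>\<omega>. f \<omega> \<le> 1"
  shows "finite_measure (distr (density (P x) f) N g)"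
proof (rule finite_measureI)
  have "emeasure (distr (density (P x) f) N g) (space N) = (\<integral>\<^sup>+\<omega>. f \<omega> * indicator (space N) (g \<omega>) \<partial>P x)"
    by (rule emeasure_distr_density[OF assms(1,2)]) simp
  also have "\<dots> \<le> (\<integral>\<^sup>+\<omega>. 1 \<partial>P x)"
    by (intro nn_integral_mono) (use assms(3) in \<open>auto split: split_indicator\<close>)
  finally show "emeasure (distr (density (P x) f) N g) (space (distr (density (P x) f) N g)) \<noteq> \<infinity>"
    using P.emeasure_space_1 by (auto simp: top_unique)
qed

text \<open>Two rounds of \<open>path_measure_eqI\<close>. With \<open>F\<close> a cylinder, both
  sides are finite measures in \<open>E\<close> that agree on cylinders by
  \<open>markov_cyl\<close>; this gives all \<open>E\<close>. With such an \<open>E\<close> fixed,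
  both sides are finite measures in \<open>F\<close> that agree on cylinders by the first
  round.\<close>

lemma markov_nn_integral_sets:
  assumes E: "E \<in> sets path_space" and F: "F \<in> sets path_space" and a: "0 < a"
  shows "(\<integral>\<^sup>+\<omega>. indicator E (stop_path a \<omega>) * indicator F (shift_path a \<omega>) \<partial>P x) =
    (\<integral>\<^sup>+\<omega>. indicator E (stop_path a \<omega>) * emeasure (P (\<omega> a)) F \<partial>P x)"
proof -
  have a0: "0 \<le> a" using a by simp
  have st [measurable]: "stop_path a \<in> P x \<rightarrow>\<^sub>M path_space" "shift_path a \<in> P x \<rightarrow>\<^sub>M path_space"
    using measurable_stop_path[OF a0] measurable_shift_path[OF a0] by simp_all
  have *: "(\<integral>\<^sup>+\<omega>. indicator E (stop_path a \<omega>) * indicator F (shift_path a \<omega>) \<partial>P x) =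
    (\<integral>\<^sup>+\<omega>. indicator E (stop_path a \<omega>) * emeasure (P (\<omega> a)) F \<partial>P x)"
    if E: "E \<in> sets path_space" and F: "F = cyl K B" and K: "finite K" "K \<subseteq> {0<..}" "\<And>t. B t \<in> sets borel" for E F K B
  proof -
    have Fs [measurable]: "F \<in> sets path_space" using K F by simp
    let ?M = "distr (density (P x) (\<lambda>\<omega>. indicator F (shift_path a \<omega>))) path_space (stop_path a)"
    let ?N = "distr (density (P x) (\<lambda>\<omega>. emeasure (P (\<omega> a)) F)) path_space (stop_path a)"
    have mP: "(\<lambda>\<omega>. emeasure (P (\<omega> a)) F) \<in> borel_measurable (P x)" using Fs by simp
    have mF: "(\<lambda>\<omega>. indicator F (shift_path a \<omega>) :: ennreal) \<in> borel_measurable (P x)" by measurable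
    have M: "emeasure ?M G = (\<integral>\<^sup>+\<omega>. indicator G (stop_path a \<omega>) * indicator F (shift_path a \<omega>) \<partial>P x)"
      if "G \<in> sets path_space" for G
      by (subst emeasure_distr_density[OF mF st(1) that]) (simp add: mult.commute)
    have N: "emeasure ?N G = (\<integral>\<^sup>+\<omega>. indicator G (stop_path a \<omega>) * emeasure (P (\<omega> a)) F \<partial>P x)"
      if "G \<in> sets path_space" for G
      by (subst emeasure_distr_density[OF mP st(1) that]) (simp add: mult.commute)
    have "?M = ?N"
    proof (rule path_measure_eqI)
      show "finite_measure ?M" by (rule finite_distr_density[OF mF st(1)]) (simp add: indicator_def)
      fix J :: "real set" and A :: "real \<Rightarrow> 'a set"
      assume J: "finite J" "J \<subseteq> {0<..}" "\<And>t. A t \<in> sets borel"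
      have cs: "cyl J A \<in> sets path_space" using J by simp
      show "emeasure ?M (cyl J A) = emeasure ?N (cyl J A)"
        unfolding M[OF cs] N[OF cs] using markov_cyl[OF J K a, of x] emeasure_stop_shift[OF cs Fs a, of x] F by simp
    qed simp_all
    then show ?thesis using M[OF E] N[OF E] by simp
  qed
  note [measurable] = E
  let ?M = "distr (density (P x) (\<lambda>\<omega>. indicator E (stop_path a \<omega>))) path_space (shift_path a)"
  let ?D = "density (P x) (\<lambda>\<omega>. indicator E (stop_path a \<omega>))"
  \<comment> \<open>As a function of \<open>F\<close> the right-hand side is a mixture of the laws
    \<open>P (\<omega> a)\<close>, hence again a measure.\<close>
  let ?N = "?D \<bind> (\<lambda>\<omega>. P (\<omega> a))"
  have mE: "(\<lambda>\<omega>. indicator E (stop_path a \<omega>) :: ennreal) \<in> borel_measurable (P x)" by measurable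
  have ker: "(\<lambda>\<omega>. P (\<omega> a)) \<in> ?D \<rightarrow>\<^sub>M subprob_algebra path_space"
    using measurable_compose[OF measurable_path_coord P_measurable_subprob] by simp
  have ne: "space ?D \<noteq> {}" using P.not_empty by simp
  have M: "emeasure ?M G = (\<integral>\<^sup>+\<omega>. indicator E (stop_path a \<omega>) * indicator G (shift_path a \<omega>) \<partial>P x)"
    if "G \<in> sets path_space" for G
    by (rule emeasure_distr_density[OF mE st(2) that])
  have N: "emeasure ?N G = (\<integral>\<^sup>+\<omega>. indicator E (stop_path a \<omega>) * emeasure (P (\<omega> a)) G \<partial>P x)"
    if G: "G \<in> sets path_space" for G
  proof -
    have "(\<lambda>\<omega>. emeasure (P (\<omega> a)) G) \<in> borel_measurable (P x)" using G by simp
    then show ?thesis unfolding emeasure_bind[OF ne ker G] by (intro nn_integral_density mE)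
  qed
  have "?M = ?N"
  proof (rule path_measure_eqI)
    show "finite_measure ?M" by (rule finite_distr_density[OF mE st(2)]) (simp add: indicator_def)
    show "sets ?N = sets path_space" by (rule sets_bind[OF sets_P ne])
    fix J :: "real set" and A :: "real \<Rightarrow> 'a set"
    assume J: "finite J" "J \<subseteq> {0<..}" "\<And>t. A t \<in> sets borel"
    have cs: "cyl J A \<in> sets path_space" using J by simp
    show "emeasure ?M (cyl J A) = emeasure ?N (cyl J A)"
      unfolding M[OF cs] N[OF cs] by (rule *[OF E refl J])
  qed simp
  then show ?thesis using M[OF F] N[OF F] by simp
qed

lemma markov_sets:
  assumes "E \<in> sets path_space" "F \<in> sets path_space" "0 < a"
  shows "emeasure (P x) {\<omega>\<in>cpaths. stop_path a \<omega> \<in> E \<and> shift_path a \<omega> \<in> F} =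
    (\<integral>\<^sup>+\<omega>. indicator E (stop_path a \<omega>) * emeasure (P (\<omega> a)) F \<partial>P x)"
  using emeasure_stop_shift[OF assms] markov_nn_integral_sets[OF assms] by simp

lemma nn_integral_coord:
  assumes "0 < a" "f \<in> borel_measurable borel"
  shows "(\<integral>\<^sup>+\<omega>. f (\<omega> a) \<partial>P x) = (\<integral>\<^sup>+y. ennreal (p a x y) * f y \<partial>\<mu>)"
proof -
  have "adm 0 ([] @ [(a, UNIV)])" using assms by (simp add: adm_Cons)
  from nn_integral_lcyl[OF assms(2) this, of x]
  have "(\<integral>\<^sup>+\<omega>. indicator (lcyl [(a, UNIV)]) \<omega> * f (\<omega> a) \<partial>P x) = (\<integral>\<^sup>+y. ennreal (p a x y) * f y \<partial>\<mu>)" by simp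
  moreover have "(\<integral>\<^sup>+\<omega>. indicator (lcyl [(a, UNIV)]) \<omega> * f (\<omega> a) \<partial>P x) = (\<integral>\<^sup>+\<omega>. f (\<omega> a) \<partial>P x)"
    by (intro nn_integral_cong) (simp add: lcyl_def)
  ultimately show ?thesis by simp
qed

lemma markov_shift:
  assumes "F \<in> sets path_space" "0 < a"
  shows "emeasure (P x) {\<omega>\<in>cpaths. shift_path a \<omega> \<in> F} = (\<integral>\<^sup>+y. ennreal (p a x y) * emeasure (P y) F \<partial>\<mu>)"
proof -
  have "{\<omega>\<in>cpaths. shift_path a \<omega> \<in> F} = {\<omega>\<in>cpaths. stop_path a \<omega> \<in> cpaths \<and> shift_path a \<omega> \<in> F}"
    using stop_path_cpaths[of a] assms(2) by auto
  then have "emeasure (P x) {\<omega>\<in>cpaths. shift_path a \<omega> \<in> F} =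
      (\<integral>\<^sup>+\<omega>. indicator cpaths (stop_path a \<omega>) * emeasure (P (\<omega> a)) F \<partial>P x)"
    using markov_sets[OF _ assms, of cpaths x] sets.top[of path_space] by simp
  also have "\<dots> = (\<integral>\<^sup>+\<omega>. emeasure (P (\<omega> a)) F \<partial>P x)"
    using assms(2) by (intro nn_integral_cong) (simp add: stop_path_cpaths)
  finally show ?thesis using nn_integral_coord[OF assms(2) emeasure_P_measurable[OF assms(1)], of x] by simp
qed

end

section \<open>Hitting events\<close>

definition hits :: "'a::topological_space set \<Rightarrow> real \<Rightarrow> real \<Rightarrow> (real \<Rightarrow> 'a) set" where
  "hits A a b = {\<omega>\<in>cpaths. \<exists>s\<in>{a..b}. \<omega> s \<in> A}"

lemma hits_mono: "A \<subseteq> B \<Longrightarrow> a' \<le> a \<Longrightarrow> b \<le> b' \<Longrightarrow> hits A a b \<subseteq> hits B a' b'"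
  unfolding hits_def by fastforce

lemma hits_Un: "a \<le> b \<Longrightarrow> b \<le> c \<Longrightarrow> hits A a c = hits A a b \<union> hits A b c"
  unfolding hits_def by fastforce

lemma hits_unit_cover: "0 \<le> s \<Longrightarrow> hits A 0 s \<subseteq> (\<Union>i\<le>nat \<lfloor>s\<rfloor>. hits A (real i) (real i + 1))"
proof
  fix \<omega> assume "0 \<le> s" "\<omega> \<in> hits A 0 s"
  then obtain r where r: "0 \<le> r" "r \<le> s" "\<omega> r \<in> A" "\<omega> \<in> cpaths" by (auto simp: hits_def)
  have "real (nat \<lfloor>r\<rfloor>) \<le> r" "r \<le> real (nat \<lfloor>r\<rfloor>) + 1" using r(1) by linarith+
  then have "\<omega> \<in> hits A (real (nat \<lfloor>r\<rfloor>)) (real (nat \<lfloor>r\<rfloor>) + 1)" using r by (auto simp: hits_def)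
  moreover have "nat \<lfloor>r\<rfloor> \<le> nat \<lfloor>s\<rfloor>" using r by (intro nat_mono floor_mono)
  ultimately show "\<omega> \<in> (\<Union>i\<le>nat \<lfloor>s\<rfloor>. hits A (real i) (real i + 1))" by blast
qed

text \<open>A continuous path that meets an open set stays in it for a while, and a fine dyadic grid
  has a point in that time interval. The index 0 is left out so that grid times are positive even
  for \<open>a = 0\<close>, as the Markov property demands.\<close>

lemma hits_dyadic:
  fixes A :: "'a::metric_space set"
  assumes "open A" "a \<le> b"
  shows "hits A a b = {\<omega>\<in>cpaths. \<exists>n. \<exists>k\<in>{1..2^n}. \<omega> (a + real k * ((b - a) / 2^n)) \<in> A}"
proof (intro equalityI subsetI)
  fix \<omega> assume "\<omega> \<in> hits A a b"
  then obtain s where w: "\<omega> \<in> cpaths" and s: "a \<le> s" "s \<le> b" "\<omega> s \<in> A" by (auto simp: hits_def)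
  have "open (\<omega> -` A)" using cpaths_cont[OF w, of UNIV] assms(1) by (simp add: continuous_on_open_vimage)
  then obtain e where e: "e > 0" "\<And>r. \<bar>r - s\<bar> < e \<Longrightarrow> \<omega> r \<in> A"
    using s(3) by (auto simp: open_dist dist_real_def)
  obtain n where n: "(b - a) / e < 2 ^ n" using real_arch_pow[of 2 "(b - a) / e"] by auto
  then have h: "(b - a) / 2^n < e" using e(1) by (simp add: field_simps)
  show "\<omega> \<in> {\<omega>\<in>cpaths. \<exists>n. \<exists>k\<in>{1..2^n}. \<omega> (a + real k * ((b - a) / 2^n)) \<in> A}"
  proof (cases "a = b")
    case True
    then have "\<exists>k\<in>{1..(2::nat)^0}. \<omega> (a + real k * ((b - a) / 2^0)) \<in> A" using s by simp
    then show ?thesis using w by blast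
  next
    case False
    define d where "d = (b - a) / 2^n"
    have d: "d > 0" using False assms(2) by (simp add: d_def)
    define k where "k = nat \<lceil>(s - a) / d\<rceil>"
    have "(s - a) / d \<le> 2 ^ n" using s d False assms(2) by (simp add: d_def field_simps)
    then have "\<lceil>(s - a) / d\<rceil> \<le> 2 ^ n" by (simp add: ceiling_le_iff)
    then have k2: "k \<le> 2 ^ n" unfolding k_def by (simp add: nat_le_iff)
    have k0: "real k = of_int \<lceil>(s - a) / d\<rceil>" unfolding k_def using s d by (simp add: ceiling_le_iff) 
    have "(s - a) / d \<le> real k" "real k < (s - a) / d + 1" unfolding k0 by linarith+
    then have k1: "s - a \<le> real k * d" "real k * d < s - a + d" using d by (simp_all add: field_simps)
    \<comment> \<open>The value \<open>k = 0\<close> occurs only for \<open>s = a\<close>; then the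
      first grid point is still within \<open>e\<close> of \<open>s\<close>.\<close>
    have "\<omega> (a + real (max 1 k) * d) \<in> A"
      using k1 h d s e(2)[of "a + real (max 1 k) * d"] by (cases "k = 0") (auto simp: d_def[symmetric] max_def abs_less_iff)
    then show ?thesis using w k2 unfolding d_def by (auto intro!: exI[of _ n] bexI[of _ "max 1 k"])
  qed
next
  fix \<omega> assume "\<omega> \<in> {\<omega>\<in>cpaths. \<exists>n. \<exists>k\<in>{1..2^n}. \<omega> (a + real k * ((b - a) / 2^n)) \<in> A}"
  then obtain n k where w: "\<omega> \<in> cpaths" and k: "1 \<le> k" "k \<le> (2::nat)^n" "\<omega> (a + real k * ((b - a) / 2^n)) \<in> A" by auto
  have "real k \<le> 2 ^ n" using k(2) by (metis of_nat_le_iff of_nat_numeral of_nat_power)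
  then have "real k * (b - a) \<le> 2^n * (b - a)" using assms(2) by (intro mult_right_mono) auto
  then have "real k * ((b - a) / 2^n) \<le> b - a" by (simp add: field_simps)
  then have "a + real k * ((b - a) / 2^n) \<in> {a..b}" using assms(2) by simp
  then show "\<omega> \<in> hits A a b" using w k(3) unfolding hits_def by blast
qed

text \<open>Joint measurability in the path and the index is what Tonelli needs to exchange
  expectation with integration over the centre \<open>y\<close> of a ball.\<close>

definition mfam :: "('a::topological_space \<Rightarrow> (real \<Rightarrow> 'a) set) \<Rightarrow> bool" where
  "mfam A \<longleftrightarrow> (\<forall>y. A y \<subseteq> cpaths) \<and> {z\<in>space (path_space \<Otimes>\<^sub>M borel). fst z \<in> A (snd z)} \<in> sets (path_space \<Otimes>\<^sub>M borel)"

lemma mfamI: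
  assumes "\<And>y. A y \<subseteq> cpaths" "Measurable.pred (path_space \<Otimes>\<^sub>M borel) (\<lambda>z. fst z \<in> A (snd z))"
  shows "mfam A"
  unfolding mfam_def using assms by (auto simp: pred_def)

lemma mfam_pred: "mfam A \<Longrightarrow> Measurable.pred (path_space \<Otimes>\<^sub>M borel) (\<lambda>z. fst z \<in> A (snd z))"
  unfolding mfam_def by (auto simp: pred_def)

lemma mfam_Int: "mfam A \<Longrightarrow> mfam B \<Longrightarrow> mfam (\<lambda>y. A y \<inter> B y)"
proof -
  assume m: "mfam A" "mfam B"
  note [measurable] = m[THEN mfam_pred]
  show ?thesis by (rule mfamI) (use m in \<open>auto simp: mfam_def Int_def\<close>)
qed

lemma mfam_Diff: "mfam A \<Longrightarrow> mfam B \<Longrightarrow> mfam (\<lambda>y. A y - B y)"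
proof -
  assume m: "mfam A" "mfam B"
  note [measurable] = m[THEN mfam_pred]
  show ?thesis by (rule mfamI) (use m in \<open>auto simp: mfam_def set_diff_eq\<close>)
qed

lemma mfam_const: "A \<in> sets path_space \<Longrightarrow> mfam (\<lambda>y. A)"
proof -
  assume A [measurable]: "A \<in> sets path_space"
  show ?thesis by (rule mfamI) (use sets.sets_into_space[OF A] in auto)
qed

lemma mfam_sets: assumes "mfam A" shows "A y \<in> sets (path_space :: (real \<Rightarrow> 'a::topological_space) measure)"
proof -
  have "(\<lambda>\<omega>. (\<omega>, y)) \<in> path_space \<rightarrow>\<^sub>M path_space \<Otimes>\<^sub>M borel" by simp
  from measurable_compose[OF this mfam_pred[OF assms]]
  have "{\<omega>\<in>space path_space. \<omega> \<in> A y} \<in> sets path_space" unfolding pred_def by simp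
  moreover have "{\<omega>\<in>space path_space. \<omega> \<in> A y} = A y" using assms by (auto simp: mfam_def)
  ultimately show ?thesis by simp
qed

lemma mfam_coord_ball: "mfam (\<lambda>y::'a::euclidean_space. {\<omega>\<in>cpaths. \<omega> t \<in> ball y r})"
proof (rule mfamI)
  have "Measurable.pred (path_space \<Otimes>\<^sub>M borel) (\<lambda>z::(real \<Rightarrow> 'a) \<times> 'a. dist (snd z) (fst z t) < r)"
    by measurable
  then show "Measurable.pred (path_space \<Otimes>\<^sub>M borel) (\<lambda>z::(real \<Rightarrow> 'a) \<times> 'a. fst z \<in> {\<omega>\<in>cpaths. \<omega> t \<in> ball (snd z) r})"
    by (rule measurable_cong[THEN iffD1, rotated]) (auto simp: space_pair_measure)
qed auto

lemma mfam_hits_ball: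
  assumes "a \<le> b" shows "mfam (\<lambda>y::'a::euclidean_space. hits (ball y r) a b)"
proof (rule mfamI)
  have "Measurable.pred (path_space \<Otimes>\<^sub>M borel)
    (\<lambda>z::(real \<Rightarrow> 'a) \<times> 'a. \<exists>n. \<exists>k\<in>{1..(2::nat)^n}. dist (snd z) (fst z (a + real k * ((b - a) / 2^n))) < r)"
    by measurable
  then show "Measurable.pred (path_space \<Otimes>\<^sub>M borel) (\<lambda>z::(real \<Rightarrow> 'a) \<times> 'a. fst z \<in> hits (ball (snd z) r) a b)"
    by (rule measurable_cong[THEN iffD1, rotated]) (auto simp: space_pair_measure hits_dyadic[OF open_ball assms])
qed (auto simp: hits_def)

lemma hits_sets: "open (A::'a::euclidean_space set) \<Longrightarrow> a \<le> b \<Longrightarrow> hits A a b \<in> sets path_space"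
proof -
  assume A: "open A" "a \<le> b"
  then have [measurable]: "A \<in> sets borel" by simp
  have "{\<omega>\<in>space path_space. \<exists>n. \<exists>k\<in>{1..(2::nat)^n}. \<omega> (a + real k * ((b - a) / 2^n)) \<in> A} \<in> sets path_space"
    by measurable
  then show ?thesis by (simp add: hits_dyadic[OF A])
qed

lemma coord_sets: "A \<in> sets borel \<Longrightarrow> {\<omega>\<in>cpaths. \<omega> t \<in> A} \<in> sets path_space"
  using measurable_sets[OF measurable_path_coord, of A t] by (simp add: vimage_def Int_def conj_commute)

text \<open>Membership in the natural filtration at time \<open>a\<close>, expressed through stopped
  paths: such an event does not change if the path is frozen at \<open>a\<close>.\<close>

definition adapted :: "real \<Rightarrow> (real \<Rightarrow> 'a::topological_space) set \<Rightarrow> bool" where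
  "adapted a E \<longleftrightarrow> E \<in> sets path_space \<and> (\<forall>\<omega>\<in>cpaths. stop_path a \<omega> \<in> E \<longleftrightarrow> \<omega> \<in> E)"

lemma adapted_Int: "adapted a E \<Longrightarrow> adapted a F \<Longrightarrow> adapted a (E \<inter> F)"
  unfolding adapted_def by auto

lemma adapted_Diff: "adapted a E \<Longrightarrow> adapted a F \<Longrightarrow> adapted a (E - F)"
  unfolding adapted_def by auto

lemma adapted_cpaths: "0 \<le> a \<Longrightarrow> adapted a cpaths"
  unfolding adapted_def using sets.top[of path_space] by (auto simp: stop_path_cpaths)

lemma adapted_coord: "A \<in> sets borel \<Longrightarrow> s \<le> a \<Longrightarrow> 0 \<le> a \<Longrightarrow> adapted a {\<omega>\<in>cpaths. \<omega> s \<in> A}"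
  unfolding adapted_def using coord_sets[of A s] by (auto simp: stop_path_cpaths stop_path_def)

lemma adapted_hits: 
  assumes "open (A::'a::euclidean_space set)" "b \<le> c" "c \<le> a" "0 \<le> a" shows "adapted a (hits A b c)"
proof -
  have "stop_path a \<omega> \<in> hits A b c \<longleftrightarrow> \<omega> \<in> hits A b c" if "\<omega> \<in> cpaths" for \<omega>
    using that assms(3) stop_path_cpaths[OF assms(4) that] unfolding hits_def by (auto simp: stop_path_def min_def)
  then show ?thesis using hits_sets[OF assms(1,2)] unfolding adapted_def by blast
qed

lemma shift_hits:
  assumes "\<omega> \<in> cpaths" "0 \<le> a" "0 \<le> b"
  shows "shift_path a \<omega> \<in> hits A b c \<longleftrightarrow> \<omega> \<in> hits A (a + b) (a + c)"
proof -
  have "(\<exists>s\<in>{b..c}. \<omega> (a + max s 0) \<in> A) \<longleftrightarrow> (\<exists>s\<in>{a + b..a + c}. \<omega> s \<in> A)"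
  proof
    assume "\<exists>s\<in>{b..c}. \<omega> (a + max s 0) \<in> A"
    then obtain s where "s \<in> {b..c}" "\<omega> (a + max s 0) \<in> A" by blast
    then show "\<exists>s\<in>{a + b..a + c}. \<omega> s \<in> A" using assms(3) by (intro bexI[of _ "a + s"]) (auto simp: max_absorb1)
  next
    assume "\<exists>s\<in>{a + b..a + c}. \<omega> s \<in> A"
    then obtain s where "s \<in> {a + b..a + c}" "\<omega> s \<in> A" by blast
    then show "\<exists>s\<in>{b..c}. \<omega> (a + max s 0) \<in> A" using assms(3) by (intro bexI[of _ "s - a"]) (auto simp: max_absorb1)
  qed
  then show ?thesis using assms shift_path_cpaths[OF assms(2,1)] unfolding hits_def by (simp add: shift_path_def)
qed

section \<open>Markov bounds and Tonelli's theorem for families of path events\<close>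

context kernel_process
begin

lemma markov_adapted:
  assumes E: "adapted a E" and F: "F \<in> sets path_space" and a: "0 < a"
  shows "emeasure (P x) (E \<inter> {\<omega>\<in>cpaths. shift_path a \<omega> \<in> F}) = (\<integral>\<^sup>+\<omega>. indicator E \<omega> * emeasure (P (\<omega> a)) F \<partial>P x)"
proof -
  have Es: "E \<in> sets path_space" and iff: "\<And>\<omega>. \<omega> \<in> cpaths \<Longrightarrow> stop_path a \<omega> \<in> E \<longleftrightarrow> \<omega> \<in> E"
    using E unfolding adapted_def by auto
  have "E \<subseteq> cpaths" using sets.sets_into_space[OF Es] by simp
  then have "E \<inter> {\<omega>\<in>cpaths. shift_path a \<omega> \<in> F} = {\<omega>\<in>cpaths. stop_path a \<omega> \<in> E \<and> shift_path a \<omega> \<in> F}"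
    using iff by auto
  moreover have "(\<integral>\<^sup>+\<omega>. indicator E (stop_path a \<omega>) * emeasure (P (\<omega> a)) F \<partial>P x) = (\<integral>\<^sup>+\<omega>. indicator E \<omega> * emeasure (P (\<omega> a)) F \<partial>P x)"
    using iff by (intro nn_integral_cong) (simp add: indicator_def)
  ultimately show ?thesis using markov_sets[OF Es F a, of x] by simp
qed

text \<open>The form in which the Markov property enters upper estimates: \<open>E\<close> locates
  the path in \<open>B\<close> at time \<open>a\<close>, and \<open>c\<close> bounds the future
  event uniformly over starts in \<open>B\<close>.\<close>

lemma markov_le:
  assumes E: "adapted a E" and F: "F \<in> sets path_space" and a: "0 < a"
    and EB: "\<And>\<omega>. \<omega> \<in> E \<Longrightarrow> \<omega> a \<in> B" and le: "\<And>w. w \<in> B \<Longrightarrow> emeasure (P w) F \<le> c"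
  shows "emeasure (P x) (E \<inter> {\<omega>\<in>cpaths. shift_path a \<omega> \<in> F}) \<le> c * emeasure (P x) E"
proof -
  have "(\<integral>\<^sup>+\<omega>. indicator E \<omega> * emeasure (P (\<omega> a)) F \<partial>P x) \<le> (\<integral>\<^sup>+\<omega>. c * indicator E \<omega> \<partial>P x)"
    using EB le by (intro nn_integral_mono) (auto simp: indicator_def)
  also have "\<dots> = c * emeasure (P x) E" using E by (simp add: adapted_def nn_integral_cmult_indicator)
  finally show ?thesis unfolding markov_adapted[OF E F a] .
qed

lemma markov_ge:
  assumes E: "adapted a E" and F: "F \<in> sets path_space" and a: "0 < a"
    and EB: "\<And>\<omega>. \<omega> \<in> E \<Longrightarrow> \<omega> a \<in> B" and ge: "\<And>w. w \<in> B \<Longrightarrow> c \<le> emeasure (P w) F"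
  shows "c * emeasure (P x) E \<le> emeasure (P x) (E \<inter> {\<omega>\<in>cpaths. shift_path a \<omega> \<in> F})"
proof -
  have "c * emeasure (P x) E = (\<integral>\<^sup>+\<omega>. c * indicator E \<omega> \<partial>P x)" using E by (simp add: adapted_def nn_integral_cmult_indicator)
  also have "\<dots> \<le> (\<integral>\<^sup>+\<omega>. indicator E \<omega> * emeasure (P (\<omega> a)) F \<partial>P x)"
    using EB ge by (intro nn_integral_mono) (auto simp: indicator_def)
  finally show ?thesis unfolding markov_adapted[OF E F a] .
qed

lemma mfam_emeasure_measurable:
  assumes "mfam A" shows "(\<lambda>z. emeasure (P (fst z)) (A (snd z))) \<in> borel_measurable (borel \<Otimes>\<^sub>M borel)"
proof (rule emeasure_measurable_subprob_algebra2[where N=path_space])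
  show "(\<lambda>z. P (fst z)) \<in> borel \<Otimes>\<^sub>M borel \<rightarrow>\<^sub>M subprob_algebra path_space" by measurable
  have "(\<lambda>z. (snd z, snd (fst z))) \<in> ((borel :: 'a measure) \<Otimes>\<^sub>M (borel :: 'a measure)) \<Otimes>\<^sub>M path_space \<rightarrow>\<^sub>M path_space \<Otimes>\<^sub>M borel" by measurable
  from measurable_compose[OF this mfam_pred[OF assms]]
  have "{z \<in> space (((borel :: 'a measure) \<Otimes>\<^sub>M (borel :: 'a measure)) \<Otimes>\<^sub>M path_space). snd z \<in> A (snd (fst z))} \<in> sets (((borel :: 'a measure) \<Otimes>\<^sub>M (borel :: 'a measure)) \<Otimes>\<^sub>M path_space)"
    unfolding pred_def by simp
  moreover have "{z \<in> space (((borel :: 'a measure) \<Otimes>\<^sub>M (borel :: 'a measure)) \<Otimes>\<^sub>M path_space). snd z \<in> A (snd (fst z))} = (SIGMA z:space ((borel :: 'a measure) \<Otimes>\<^sub>M (borel :: 'a measure)). A (snd z))"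
    using assms by (auto simp: space_pair_measure mfam_def)
  ultimately show "(SIGMA z:space ((borel :: 'a measure) \<Otimes>\<^sub>M (borel :: 'a measure)). A (snd z)) \<in> sets (((borel :: 'a measure) \<Otimes>\<^sub>M (borel :: 'a measure)) \<Otimes>\<^sub>M path_space)" by (simp only:)
qed

lemma mfam_emeasure_measurable2 [measurable (raw)]:
  assumes "mfam A" "f \<in> borel_measurable M" "g \<in> borel_measurable M"
  shows "(\<lambda>x. emeasure (P (f x)) (A (g x))) \<in> borel_measurable M"
  using measurable_compose[OF measurable_Pair[OF assms(2,3)] mfam_emeasure_measurable[OF assms(1)]] by simp

text \<open>For \<open>A y = hits (ball y r) 0 t\<close> the right-hand side is the expected volume
  of the sausage. Averaging over centres is used throughout to turn probabilities into
  volumes.\<close>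

lemma nn_integral_mfam_swap:
  assumes "mfam A" "sigma_finite_measure N" "sets N = sets borel"
  shows "(\<integral>\<^sup>+y. emeasure (P x) (A y) \<partial>N) = (\<integral>\<^sup>+\<omega>. emeasure N {y. \<omega> \<in> A y} \<partial>P x)"
proof -
  interpret N: sigma_finite_measure N by fact
  interpret NP: pair_sigma_finite "P x" N by standard
  have sp: "space N = UNIV" using sets_eq_imp_space_eq[OF assms(3)] by simp
  have [measurable_cong]: "sets N = sets borel" by fact
  have m: "Measurable.pred (P x \<Otimes>\<^sub>M N) (\<lambda>z. fst z \<in> A (snd z))"
    using mfam_pred[OF assms(1)] measurable_cong_sets[OF sets_pair_measure_cong[OF sets_P assms(3)] refl] by simp
  have f: "(\<lambda>z. indicator (A (snd z)) (fst z) :: ennreal) \<in> borel_measurable (P x \<Otimes>\<^sub>M N)"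
  proof -
    have "(\<lambda>z. indicator (A (snd z)) (fst z) :: ennreal) = (\<lambda>z. if fst z \<in> A (snd z) then 1 else 0)"
      by (auto simp: indicator_def)
    then show ?thesis using m by simp
  qed
  have "(\<integral>\<^sup>+y. emeasure (P x) (A y) \<partial>N) = (\<integral>\<^sup>+y. (\<integral>\<^sup>+\<omega>. indicator (A y) \<omega> \<partial>P x) \<partial>N)"
    using mfam_sets[OF assms(1)] by simp
  also have "\<dots> = (\<integral>\<^sup>+\<omega>. (\<integral>\<^sup>+y. indicator (A y) \<omega> \<partial>N) \<partial>P x)"
    using f by (intro NP.Fubini') (simp add: case_prod_beta')
  also have "\<dots> = (\<integral>\<^sup>+\<omega>. emeasure N {y. \<omega> \<in> A y} \<partial>P x)"
  proof (intro nn_integral_cong)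
    fix \<omega> assume w: "\<omega> \<in> space (P x)"
    have "{y\<in>space N. \<omega> \<in> A y} \<in> sets N"
      using measurable_compose[OF measurable_Pair1'[OF w] m] by (simp add: pred_def)
    then have "{y. \<omega> \<in> A y} \<in> sets N" using sp by simp
    moreover have "(\<integral>\<^sup>+y. indicator (A y) \<omega> \<partial>N) = (\<integral>\<^sup>+y. indicator {y. \<omega> \<in> A y} y \<partial>N)"
      by (intro nn_integral_cong) (simp add: indicator_def)
    ultimately show "(\<integral>\<^sup>+y. indicator (A y) \<omega> \<partial>N) = emeasure N {y. \<omega> \<in> A y}" by simp
  qed
  finally show ?thesis .
qed

lemma emeasure_coord:
  assumes "0 < t" "A \<in> sets borel"
  shows "emeasure (P x) {\<omega>\<in>cpaths. \<omega> t \<in> A} = (\<integral>\<^sup>+z. ennreal (p t x z) * indicator A z \<partial>\<mu>)"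
proof -
  have "emeasure (P x) {\<omega>\<in>cpaths. \<omega> t \<in> A} = (\<integral>\<^sup>+\<omega>. indicator {\<omega>\<in>cpaths. \<omega> t \<in> A} \<omega> \<partial>P x)"
    using coord_sets[OF assms(2)] by simp
  also have "\<dots> = (\<integral>\<^sup>+\<omega>. indicator A (\<omega> t) \<partial>P x)"
    by (intro nn_integral_cong) (simp add: indicator_def)
  also have "\<dots> = (\<integral>\<^sup>+z. ennreal (p t x z) * indicator A z \<partial>\<mu>)"
    using assms by (intro nn_integral_coord) auto
  finally show ?thesis .
qed

section \<open>First hits along a time grid\<close>

text \<open>A discrete substitute for the hitting time: the event is decided at the deterministic
  time \<open>\<tau> k\<close>, so the Markov property at fixed times suffices. Indices start at 1,
  matching \<open>hits_dyadic\<close>.\<close>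

definition first_hit :: "(nat \<Rightarrow> real) \<Rightarrow> 'a set \<Rightarrow> nat \<Rightarrow> (real \<Rightarrow> 'a) set" where
  "first_hit \<tau> B k = {\<omega>\<in>cpaths. \<omega> (\<tau> k) \<in> B \<and> (\<forall>j\<in>{1..<k}. \<omega> (\<tau> j) \<notin> B)}"

lemma adapted_first_hit:
  assumes "B \<in> sets borel" "0 \<le> \<tau> k" "\<And>j. j < k \<Longrightarrow> \<tau> j \<le> \<tau> k"
  shows "adapted (\<tau> k) (first_hit \<tau> B k)"
proof -
  have [measurable]: "B \<in> sets borel" by fact
  have "{\<omega>\<in>space path_space. \<omega> (\<tau> k) \<in> B \<and> (\<forall>j\<in>{1..<k}. \<omega> (\<tau> j) \<notin> B)} \<in> sets path_space" by measurable
  then have "first_hit \<tau> B k \<in> sets path_space" by (simp only: first_hit_def space_path_space)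
  moreover have "stop_path (\<tau> k) \<omega> \<in> first_hit \<tau> B k \<longleftrightarrow> \<omega> \<in> first_hit \<tau> B k" if "\<omega> \<in> cpaths" for \<omega>
  proof -
    have eq: "stop_path (\<tau> k) \<omega> (\<tau> j) = \<omega> (\<tau> j)" if "j \<le> k" for j
      using assms(3)[of j] that by (cases "j = k") (simp_all add: stop_path_def min_absorb1)
    then have "(\<forall>j\<in>{1..<k}. stop_path (\<tau> k) \<omega> (\<tau> j) \<notin> B) \<longleftrightarrow> (\<forall>j\<in>{1..<k}. \<omega> (\<tau> j) \<notin> B)"
      by (intro ball_cong) auto
    then show ?thesis using eq[of k] that stop_path_cpaths[OF assms(2) that] unfolding first_hit_def by simp
  qed
  ultimately show ?thesis unfolding adapted_def by blast
qed

lemma first_hit_disjoint: "disjoint_family_on (first_hit \<tau> B) {1..N}"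
proof -
  have "first_hit \<tau> B m \<inter> first_hit \<tau> B n = {}" if "1 \<le> m" "m < n" for m n
    using that unfolding first_hit_def by fastforce
  then show ?thesis unfolding disjoint_family_on_def by (metis Int_commute atLeastAtMost_iff linorder_neqE_nat)
qed

lemma first_hit_Union: "(\<Union>k\<in>{1..N}. first_hit \<tau> B k) = {\<omega>\<in>cpaths. \<exists>k\<in>{1..N}. \<omega> (\<tau> k) \<in> B}"
proof (intro equalityI subsetI)
  fix \<omega> assume "\<omega> \<in> {\<omega>\<in>cpaths. \<exists>k\<in>{1..N}. \<omega> (\<tau> k) \<in> B}"
  then have w: "\<omega> \<in> cpaths" and ex: "\<exists>k. k \<in> {1..N} \<and> \<omega> (\<tau> k) \<in> B" by auto
  define k where "k = (LEAST k. k \<in> {1..N} \<and> \<omega> (\<tau> k) \<in> B)"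
  have k: "k \<in> {1..N} \<and> \<omega> (\<tau> k) \<in> B" unfolding k_def by (rule LeastI_ex[OF ex])
  have "\<omega> (\<tau> j) \<notin> B" if "j \<in> {1..<k}" for j
    using not_less_Least[of j "\<lambda>k. k \<in> {1..N} \<and> \<omega> (\<tau> k) \<in> B"] that k unfolding k_def[symmetric] by auto
  then show "\<omega> \<in> (\<Union>k\<in>{1..N}. first_hit \<tau> B k)" using k w unfolding first_hit_def by auto
qed (auto simp: first_hit_def)

lemma sum_first_hit:
  assumes "B \<in> sets borel" "\<And>k. k \<in> {1..N} \<Longrightarrow> 0 \<le> \<tau> k" "\<And>j k. j < k \<Longrightarrow> \<tau> j \<le> \<tau> k" 
  shows "(\<Sum>k\<in>{1..N}. emeasure (P x) (first_hit \<tau> B k)) = emeasure (P x) {\<omega>\<in>cpaths. \<exists>k\<in>{1..N}. \<omega> (\<tau> k) \<in> B}"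
proof -
  have "first_hit \<tau> B ` {1..N} \<subseteq> sets (P x)"
    using adapted_first_hit[OF assms(1,2,3)] unfolding adapted_def by auto
  then show ?thesis
    using sum_emeasure[of "first_hit \<tau> B" "{1..N}" "P x"] first_hit_disjoint first_hit_Union by simp
qed

lemma emeasure_hits_SUP:
  assumes "open A" "a \<le> b"
  shows "emeasure (P x) (hits A a b) = (SUP n. emeasure (P x) {\<omega>\<in>cpaths. \<exists>k\<in>{1..(2::nat)^n}. \<omega> (a + real k * ((b - a) / 2^n)) \<in> A})"
proof -
  have [measurable]: "A \<in> sets borel" using assms by simp
  let ?S = "\<lambda>n. {\<omega>\<in>cpaths. \<exists>k\<in>{1..(2::nat)^n}. \<omega> (a + real k * ((b - a) / 2^n)) \<in> A}"
  have m: "?S n \<in> sets (P x)" for n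
  proof -
    have "{\<omega>\<in>space path_space. \<exists>k\<in>{1..(2::nat)^n}. \<omega> (a + real k * ((b - a) / 2^n)) \<in> A} \<in> sets path_space" by measurable
    then show ?thesis by simp
  qed
  have "incseq ?S"
  proof (rule incseq_SucI, intro subsetI)
    fix n \<omega> assume "\<omega> \<in> ?S n"
    then obtain k where k: "\<omega> \<in> cpaths" "k \<in> {1..(2::nat)^n}" "\<omega> (a + real k * ((b - a) / 2^n)) \<in> A" by auto
    \<comment> \<open>Grid point \<open>k\<close> of level \<open>n\<close> is grid point
      \<open>2 * k\<close> of the next level, so the grids are nested.\<close>
    have "real (2 * k) * ((b - a) / 2 ^ Suc n) = real k * ((b - a) / 2^n)" by simp
    then show "\<omega> \<in> ?S (Suc n)" using k by (auto intro!: bexI[of _ "2 * k"])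
  qed
  moreover have "hits A a b = (\<Union>n. ?S n)" unfolding hits_dyadic[OF assms] by auto
  ultimately show ?thesis using SUP_emeasure_incseq[of ?S "P x"] m by (simp add: image_subset_iff)
qed

text \<open>Decompose at the first hit of \<open>A\<close> along dyadic grids, and let the grids become dense.\<close>
lemma hits_le_coord:
  assumes A: "open A" and C: "C \<in> sets borel" and ab: "0 \<le> a" "a \<le> b" "b \<le> T"
    and ge: "\<And>s w. s \<in> {a..b} \<Longrightarrow> w \<in> A \<Longrightarrow> c \<le> emeasure (P w) {\<omega>\<in>cpaths. \<omega> (T - s) \<in> C}"
    and "a < b"
  shows "c * emeasure (P x) (hits A a b) \<le> emeasure (P x) {\<omega>\<in>cpaths. \<omega> T \<in> C}"
proof -
  have Ab: "A \<in> sets borel" using A by simp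
  have "c * emeasure (P x) {\<omega>\<in>cpaths. \<exists>k\<in>{1..(2::nat)^n}. \<omega> (a + real k * ((b - a) / 2^n)) \<in> A}
    \<le> emeasure (P x) {\<omega>\<in>cpaths. \<omega> T \<in> C}" for n
  proof -
    define \<tau> where "\<tau> k = a + real k * ((b - a) / 2^n)" for k :: nat
    have mono: "\<tau> j \<le> \<tau> k" if "j < k" for j k using that ab unfolding \<tau>_def by (intro add_left_mono mult_right_mono) auto
    have pos: "\<tau> k > 0" if "k \<in> {1..}" for k
      using that ab(1) \<open>a < b\<close> unfolding \<tau>_def by (intro add_nonneg_pos) auto
    have last: "\<tau> (2^n) = b" unfolding \<tau>_def by simp
    have ub: "\<tau> k \<le> b" if "k \<in> {1..2^n}" for k using that mono[of k "2^n"] last by (cases "k = 2^n") auto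
    have lb: "a \<le> \<tau> k" for k unfolding \<tau>_def using ab by simp
    have Cm: "{\<omega>\<in>cpaths. \<omega> t \<in> C} \<in> sets path_space" for t by (rule coord_sets[OF C])
    have ad: "adapted (\<tau> k) (first_hit \<tau> A k)" if "k \<in> {1..2^n}" for k
      using pos[of k] that mono by (intro adapted_first_hit[OF Ab]) auto
    \<comment> \<open>Markov property at the grid time; the time left is \<open>T - \<tau> k\<close>
      with \<open>\<tau> k\<close> in \<open>{a..b}\<close>, which is what the hypothesis on
      \<open>c\<close> covers.\<close>
    have step: "c * emeasure (P x) (first_hit \<tau> A k) \<le> emeasure (P x) (first_hit \<tau> A k \<inter> {\<omega>\<in>cpaths. \<omega> T \<in> C})"
      if k: "k \<in> {1..2^n}" for k
    proof -
      have "c * emeasure (P x) (first_hit \<tau> A k) \<le>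
        emeasure (P x) (first_hit \<tau> A k \<inter> {\<omega>\<in>cpaths. shift_path (\<tau> k) \<omega> \<in> {\<omega>\<in>cpaths. \<omega> (T - \<tau> k) \<in> C}})"
        using ub[OF k] lb[of k] ab pos[of k] k
        by (intro markov_ge[OF ad[OF k] Cm, where B=A]) (auto simp: first_hit_def intro!: ge)
      also have "\<dots> \<le> emeasure (P x) (first_hit \<tau> A k \<inter> {\<omega>\<in>cpaths. \<omega> T \<in> C})"
      proof (rule emeasure_mono)
        show "first_hit \<tau> A k \<inter> {\<omega>\<in>cpaths. shift_path (\<tau> k) \<omega> \<in> {\<omega>\<in>cpaths. \<omega> (T - \<tau> k) \<in> C}} \<subseteq> first_hit \<tau> A k \<inter> {\<omega>\<in>cpaths. \<omega> T \<in> C}"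
          using ub[OF k] ab by (auto simp: shift_path_def max_absorb1)
        show "first_hit \<tau> A k \<inter> {\<omega>\<in>cpaths. \<omega> T \<in> C} \<in> sets (P x)"
          using Cm[of T] ad[OF k] unfolding adapted_def by auto
      qed
      finally show ?thesis .
    qed
    have "c * emeasure (P x) {\<omega>\<in>cpaths. \<exists>k\<in>{1..(2::nat)^n}. \<omega> (\<tau> k) \<in> A} = (\<Sum>k\<in>{1..2^n}. c * emeasure (P x) (first_hit \<tau> A k))"
      unfolding sum_distrib_left[symmetric] using pos mono by (subst sum_first_hit[OF Ab]) (auto simp: less_imp_le)
    also have "\<dots> \<le> (\<Sum>k\<in>{1..2^n}. emeasure (P x) (first_hit \<tau> A k \<inter> {\<omega>\<in>cpaths. \<omega> T \<in> C}))"
      by (rule sum_mono[OF step])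
    also have "\<dots> = emeasure (P x) (\<Union>k\<in>{1..2^n}. first_hit \<tau> A k \<inter> {\<omega>\<in>cpaths. \<omega> T \<in> C})"
    proof (rule sum_emeasure)
      show "(\<lambda>k. first_hit \<tau> A k \<inter> {\<omega>\<in>cpaths. \<omega> T \<in> C}) ` {1..2^n} \<subseteq> sets (P x)"
        using ad Cm[of T] unfolding adapted_def by auto
      show "disjoint_family_on (\<lambda>k. first_hit \<tau> A k \<inter> {\<omega>\<in>cpaths. \<omega> T \<in> C}) {1..2^n}"
        using first_hit_disjoint[of \<tau> A "2^n"] unfolding disjoint_family_on_def by blast
    qed simp
    also have "\<dots> \<le> emeasure (P x) {\<omega>\<in>cpaths. \<omega> T \<in> C}"
      using Cm[of T] by (intro emeasure_mono) auto
    finally show ?thesis unfolding \<tau>_def .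
  qed
  then show ?thesis unfolding emeasure_hits_SUP[OF A ab(2)] SUP_mult_left_ennreal by (intro SUP_least)
qed

end

section \<open>Processes with Gaussian kernel bounds\<close>

text \<open>Telescoping, since \<open>1 / (v + 1) ^ 3\<close> is at most the decrement of the
  inverse square from \<open>v\<close> to \<open>v + 1\<close>. That in turn is
  \<open>(v + 2) * v\<^sup>2 \<le> (v + 1) ^ 3\<close> after writing
  \<open>v + 2 = 1 + (v + 1)\<close>.\<close>

lemma sum_inverse_cubes_le:
  assumes "u \<ge> (1::real)"
  shows "(\<Sum>k<n. 1 / (u + real k + 1) ^ 3) \<le> 1 / u\<^sup>2 - 1 / (u + real n)\<^sup>2"
proof (induction n)
  case (Suc n)
  define v where "v = u + real n"
  have v: "v \<ge> 1" using assms by (simp add: v_def)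
  have "1 / (v + 1) ^ 3 \<le> 1 / v\<^sup>2 - 1 / (v + 1)\<^sup>2"
  proof -
    have "(v + 1) ^ 3 = (v + 2) * v\<^sup>2 + (v\<^sup>2 + 3 * v + 1)" by (simp add: algebra_simps power2_eq_square power3_eq_cube)
    moreover have "0 \<le> v\<^sup>2 + 3 * v + 1" using v by simp
    ultimately have "(v + 2) * v\<^sup>2 \<le> (v + 1) ^ 3" by linarith
    then have le: "(v + 2) / (v + 1) ^ 3 \<le> 1 / v\<^sup>2" using v by (simp add: pos_divide_le_eq pos_le_divide_eq)
    have "v + 2 = 1 + (v + 1)" by simp
    then have "(v + 2) / (v + 1) ^ 3 = 1 / (v + 1) ^ 3 + (v + 1) / (v + 1) ^ 3"
      by (simp only: add_divide_distrib)
    moreover have "(v + 1) / (v + 1) ^ 3 = 1 / (v + 1)\<^sup>2" using v by (simp add: power2_eq_square power3_eq_cube)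
    ultimately show ?thesis using le by (simp only: le_diff_eq)
  qed
  moreover have "1 / (u + real (Suc n))\<^sup>2 = 1 / (v + 1)\<^sup>2" by (simp add: v_def add.commute add.left_commute)
  ultimately show ?case using Suc.IH unfolding sum.lessThan_Suc v_def[symmetric] by linarith
qed simp

text \<open>The fixed times come from one comparison: a visit during \<open>[a, a + 1]\<close> is
  followed by the position at time \<open>a + 2\<close>. The remaining time lies in
  \<open>{1..2}\<close>, where \<open>p_lower\<close> is required, and for \<open>a = 0\<close> the
  position is governed by \<open>p 2\<close>, where \<open>p_gauss\<close> is required. The cube in
  \<open>p_decay\<close> is where the dimension enters.\<close>

locale gaussian_process = kernel_process +
  assumes p_sym: "0 < t \<Longrightarrow> p t x y = p t y x"
    and p_decay: "\<exists>C>0. \<forall>t\<ge>1. \<forall>x y. p t x y \<le> C / t ^ 3"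
    and p_gauss: "\<exists>C>0. \<exists>c>0. \<forall>x y. p 2 x y \<le> C * exp (- c * (dist x y)\<^sup>2)"
    and p_lower: "\<exists>\<kappa>>0. \<forall>t\<in>{1..2}. \<forall>x y. dist x y < r \<longrightarrow> \<kappa> \<le> p t x y"
    and mu_ball: "\<exists>K>0. \<forall>y. emeasure \<mu> (ball y r) \<le> ennreal K"
    and mu_ball_lower: "\<exists>\<kappa>>0. \<forall>y. ennreal \<kappa> \<le> emeasure \<mu> (ball y 1)"
    and mu_gauss: "0 < c \<Longrightarrow> \<exists>K>0. \<forall>x. (\<integral>\<^sup>+y. ennreal (exp (- c * (dist x y)\<^sup>2)) \<partial>\<mu>) \<le> ennreal K"
begin

section \<open>Estimates for single, repeated and double visits\<close>

sublocale mm: pair_sigma_finite \<mu> \<mu> by standard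

lemma mfam_sets_P: "mfam A \<Longrightarrow> A y \<in> sets (P x)"
  by (simp add: mfam_sets)

lemma hits_sets_P: "open A \<Longrightarrow> a \<le> b \<Longrightarrow> hits A a b \<in> sets (P x)"
  by (simp add: hits_sets)

lemma nn_integral_p_left: "0 < t \<Longrightarrow> (\<integral>\<^sup>+x. ennreal (p t x y) \<partial>\<mu>) = 1"
  using p_nn_integral[of t y] p_sym[of t y] by simp

text \<open>Invariance of \<mu>: symmetry of the kernel turns integration over the starting point
  into its total mass.\<close>

lemma nn_integral_p_swap:
  assumes "0 < t" and [measurable]: "g \<in> borel_measurable borel"
  shows "(\<integral>\<^sup>+x. (\<integral>\<^sup>+z. ennreal (p t x z) * g z \<partial>\<mu>) \<partial>\<mu>) = (\<integral>\<^sup>+z. g z \<partial>\<mu>)"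
proof -
  note [measurable] = p_measurable2[OF assms(1)] p_measurable1[OF assms(1)]
  have m: "(\<lambda>x. p t x z) \<in> borel_measurable borel" for z by measurable
  have m2: "(\<lambda>(x, z). ennreal (p t x z) * g z) \<in> borel_measurable (\<mu> \<Otimes>\<^sub>M \<mu>)" by measurable
  have "(\<integral>\<^sup>+x. (\<integral>\<^sup>+z. ennreal (p t x z) * g z \<partial>\<mu>) \<partial>\<mu>) = (\<integral>\<^sup>+z. (\<integral>\<^sup>+x. ennreal (p t x z) * g z \<partial>\<mu>) \<partial>\<mu>)"
    using mm.Fubini'[OF m2] by simp
  also have "\<dots> = (\<integral>\<^sup>+z. g z \<partial>\<mu>)"
    using m by (simp add: nn_integral_multc nn_integral_p_left[OF assms(1)])
  finally show ?thesis .
qed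

text \<open>After a visit to \<open>ball y r\<close> during \<open>[a, a + 1]\<close> a time between
  1 and 2 is left until \<open>a + 2\<close>, and the kernel is bounded below there on distances
  less than \<open>r + 1\<close>. So \<open>ball y 1\<close> is occupied at time
  \<open>a + 2\<close> with a probability bounded from below. All hitting estimates thereby reduce
  to one-time distributions.\<close>

lemma hits_le_ball:
  "\<exists>C>0. \<forall>a\<ge>0. \<forall>x y. emeasure (P x) (hits (ball y r) a (a + 1)) \<le> ennreal C * emeasure (P x) {\<omega>\<in>cpaths. \<omega> (a + 2) \<in> ball y 1}"
proof -
  obtain \<kappa>1 where k1: "\<kappa>1 > 0" "\<And>t x y. t \<in> {1..2} \<Longrightarrow> dist x y < r + 1 \<Longrightarrow> \<kappa>1 \<le> p t x y"
    using p_lower[of "r + 1"] by blast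
  obtain \<kappa>2 where k2: "\<kappa>2 > 0" "\<And>y. ennreal \<kappa>2 \<le> emeasure \<mu> (ball y 1)" using mu_ball_lower by blast
  define c where "c = \<kappa>1 * \<kappa>2"
  have c: "c > 0" using k1 k2 by (simp add: c_def)
  have ge: "ennreal c \<le> emeasure (P w) {\<omega>\<in>cpaths. \<omega> t \<in> ball y 1}" if t: "t \<in> {1..2}" and w: "w \<in> ball y r" for t w y
  proof -
    have "ennreal c \<le> ennreal \<kappa>1 * emeasure \<mu> (ball y 1)"
      unfolding c_def using k1(1) k2 by (simp add: ennreal_mult' mult_left_mono)
    also have "\<dots> = (\<integral>\<^sup>+z. ennreal \<kappa>1 * indicator (ball y 1) z \<partial>\<mu>)" by (simp add: nn_integral_cmult_indicator)
    also have "\<dots> \<le> (\<integral>\<^sup>+z. ennreal (p t w z) * indicator (ball y 1) z \<partial>\<mu>)"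
    proof (intro nn_integral_mono)
      fix z
      have "dist w z < r + 1" if "z \<in> ball y 1" using dist_triangle[of w z y] w that by (simp add: dist_commute)
      then show "ennreal \<kappa>1 * indicator (ball y 1) z \<le> ennreal (p t w z) * indicator (ball y 1) z"
        using k1(2)[OF t, of w z] by (auto split: split_indicator intro!: ennreal_leI)
    qed
    also have "\<dots> = emeasure (P w) {\<omega>\<in>cpaths. \<omega> t \<in> ball y 1}" using t by (intro emeasure_coord[symmetric]) auto
    finally show ?thesis .
  qed
  show ?thesis
  proof (intro exI[of _ "1 / c"] conjI allI impI)
    fix a :: real and x y :: 'a assume a: "0 \<le> a"
    have "ennreal c * emeasure (P x) (hits (ball y r) a (a + 1)) \<le> emeasure (P x) {\<omega>\<in>cpaths. \<omega> (a + 2) \<in> ball y 1}"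
      using a by (intro hits_le_coord ge) auto
    then have "ennreal (1 / c) * (ennreal c * emeasure (P x) (hits (ball y r) a (a + 1))) \<le> ennreal (1 / c) * emeasure (P x) {\<omega>\<in>cpaths. \<omega> (a + 2) \<in> ball y 1}"
      by (rule mult_left_mono) simp
    moreover have "ennreal (1 / c) * (ennreal c * z) = z" for z
      unfolding mult.assoc[symmetric] using c by (simp add: ennreal_mult'[symmetric])
    ultimately show "emeasure (P x) (hits (ball y r) a (a + 1)) \<le> ennreal (1 / c) * emeasure (P x) {\<omega>\<in>cpaths. \<omega> (a + 2) \<in> ball y 1}"
      by simp
  qed (use c in simp)
qed

lemma hits_decay: "\<exists>C>0. \<forall>a\<ge>0. \<forall>x y. emeasure (P x) (hits (ball y r) a (a + 1)) \<le> ennreal (C / (a + 2) ^ 3)"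
proof -
  obtain C where C: "C > 0" "\<And>a x y. a \<ge> 0 \<Longrightarrow> emeasure (P x) (hits (ball y r) a (a + 1)) \<le> ennreal C * emeasure (P x) {\<omega>\<in>cpaths. \<omega> (a + 2) \<in> ball y 1}"
    using hits_le_ball[of r] by blast
  obtain D where D: "D > 0" "\<And>t x y. t \<ge> 1 \<Longrightarrow> p t x y \<le> D / t ^ 3" using p_decay by blast
  obtain K where K: "K > 0" "\<And>y. emeasure \<mu> (ball y 1) \<le> ennreal K" using mu_ball[of 1] by blast
  show ?thesis
  proof (intro exI[of _ "C * (D * K)"] conjI allI impI)
    fix a :: real and x y :: 'a assume a: "0 \<le> a"
    have "emeasure (P x) {\<omega>\<in>cpaths. \<omega> (a + 2) \<in> ball y 1} = (\<integral>\<^sup>+z. ennreal (p (a + 2) x z) * indicator (ball y 1) z \<partial>\<mu>)"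
      using a by (intro emeasure_coord) auto
    also have "\<dots> \<le> (\<integral>\<^sup>+z. ennreal (D / (a + 2) ^ 3) * indicator (ball y 1) z \<partial>\<mu>)"
      using a D(2) by (intro nn_integral_mono mult_right_mono ennreal_leI) auto
    also have "\<dots> = ennreal (D / (a + 2) ^ 3) * emeasure \<mu> (ball y 1)" by (simp add: nn_integral_cmult_indicator)
    also have "\<dots> \<le> ennreal (D / (a + 2) ^ 3) * ennreal K" by (intro mult_left_mono K) simp
    finally have "ennreal C * emeasure (P x) {\<omega>\<in>cpaths. \<omega> (a + 2) \<in> ball y 1} \<le> ennreal C * (ennreal (D / (a + 2) ^ 3) * ennreal K)"
      by (rule mult_left_mono) simp
    also have "\<dots> = ennreal (C * (D * K) / (a + 2) ^ 3)"
      using C(1) D(1) K(1) a by (simp add: ennreal_mult'[symmetric] mult_ac)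
    finally show "emeasure (P x) (hits (ball y r) a (a + 1)) \<le> ennreal (C * (D * K) / (a + 2) ^ 3)"
      using C(2)[OF a, of x y] by (rule order_trans[rotated])
  qed (use C D K in simp)
qed

lemma nn_integral_coord_ball_le:
  assumes K: "\<And>y. emeasure \<mu> (ball y r) \<le> K"
  shows "(\<integral>\<^sup>+y. emeasure (P x) {\<omega>\<in>cpaths. \<omega> t \<in> ball y r} \<partial>\<mu>) \<le> K"
proof -
  have "(\<integral>\<^sup>+y. emeasure (P x) {\<omega>\<in>cpaths. \<omega> t \<in> ball y r} \<partial>\<mu>) = (\<integral>\<^sup>+\<omega>. emeasure \<mu> {y. \<omega> \<in> {\<omega>\<in>cpaths. \<omega> t \<in> ball y r}} \<partial>P x)"
    by (intro nn_integral_mfam_swap mfam_coord_ball sigma_finite_mu sets_mu)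
  also have "\<dots> \<le> (\<integral>\<^sup>+\<omega>. K \<partial>P x)"
  proof (intro nn_integral_mono)
    fix \<omega> assume "\<omega> \<in> space (P x)"
    then have "{y. \<omega> \<in> {\<omega>\<in>cpaths. \<omega> t \<in> ball y r}} = ball (\<omega> t) r" by (auto simp: dist_commute)
    then show "emeasure \<mu> {y. \<omega> \<in> {\<omega>\<in>cpaths. \<omega> t \<in> ball y r}} \<le> K" using K by simp
  qed
  finally show ?thesis using P.emeasure_space_1 by simp
qed

lemma measurable_hits [measurable]:
  "a \<le> b \<Longrightarrow> f \<in> borel_measurable M \<Longrightarrow> g \<in> borel_measurable M \<Longrightarrow> (\<lambda>x. emeasure (P (f x)) (hits (ball (g x) r) a b)) \<in> borel_measurable M"
  by (rule mfam_emeasure_measurable2[OF mfam_hits_ball])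

lemma measurable_coord_ball:
  "f \<in> borel_measurable M \<Longrightarrow> g \<in> borel_measurable M \<Longrightarrow> (\<lambda>x. emeasure (P (f x)) {\<omega>\<in>cpaths. \<omega> t \<in> ball (g x) r}) \<in> borel_measurable M"
  by (rule mfam_emeasure_measurable2[OF mfam_coord_ball])

lemma hits_unit_volume: "\<exists>K>0. \<forall>a\<ge>0. \<forall>x. (\<integral>\<^sup>+y. emeasure (P x) (hits (ball y r) a (a + 1)) \<partial>\<mu>) \<le> ennreal K"
proof -
  obtain C where C: "C > 0" "\<And>a x y. a \<ge> 0 \<Longrightarrow> emeasure (P x) (hits (ball y r) a (a + 1)) \<le> ennreal C * emeasure (P x) {\<omega>\<in>cpaths. \<omega> (a + 2) \<in> ball y 1}"
    using hits_le_ball[of r] by blast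
  obtain K where K: "K > 0" "\<And>y. emeasure \<mu> (ball y 1) \<le> ennreal K" using mu_ball[of 1] by blast
  show ?thesis
  proof (intro exI[of _ "C * K"] conjI allI impI)
    fix a :: real and x :: 'a assume a: "0 \<le> a"
    have "(\<integral>\<^sup>+y. emeasure (P x) (hits (ball y r) a (a + 1)) \<partial>\<mu>) \<le> (\<integral>\<^sup>+y. ennreal C * emeasure (P x) {\<omega>\<in>cpaths. \<omega> (a + 2) \<in> ball y 1} \<partial>\<mu>)"
      by (intro nn_integral_mono C(2) a)
    also have "\<dots> = ennreal C * (\<integral>\<^sup>+y. emeasure (P x) {\<omega>\<in>cpaths. \<omega> (a + 2) \<in> ball y 1} \<partial>\<mu>)"
      using measurable_coord_ball[of "\<lambda>_. x" \<mu> "\<lambda>y. y" "a + 2" 1] by (intro nn_integral_cmult) simp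
    also have "\<dots> \<le> ennreal C * ennreal K" by (intro mult_left_mono nn_integral_coord_ball_le K(2)) simp
    finally show "(\<integral>\<^sup>+y. emeasure (P x) (hits (ball y r) a (a + 1)) \<partial>\<mu>) \<le> ennreal (C * K)"
      using C(1) K(1) by (simp add: ennreal_mult')
  qed (use C K in simp)
qed

text \<open>Here the centre is fixed and the starting point varies; invariance of \<mu> replaces the
  averaging over centres in \<open>hits_unit_volume\<close>.\<close>

lemma hits_unit_start: "\<exists>K>0. \<forall>a\<ge>0. \<forall>y. (\<integral>\<^sup>+x. emeasure (P x) (hits (ball y r) a (a + 1)) \<partial>\<mu>) \<le> ennreal K"
proof -
  obtain C where C: "C > 0" "\<And>a x y. a \<ge> 0 \<Longrightarrow> emeasure (P x) (hits (ball y r) a (a + 1)) \<le> ennreal C * emeasure (P x) {\<omega>\<in>cpaths. \<omega> (a + 2) \<in> ball y 1}"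
    using hits_le_ball[of r] by blast
  obtain K where K: "K > 0" "\<And>y. emeasure \<mu> (ball y 1) \<le> ennreal K" using mu_ball[of 1] by blast
  show ?thesis
  proof (intro exI[of _ "C * K"] conjI allI impI)
    fix a :: real and y :: 'a assume a: "0 \<le> a"
    have "(\<integral>\<^sup>+x. emeasure (P x) (hits (ball y r) a (a + 1)) \<partial>\<mu>) \<le> (\<integral>\<^sup>+x. ennreal C * emeasure (P x) {\<omega>\<in>cpaths. \<omega> (a + 2) \<in> ball y 1} \<partial>\<mu>)"
      by (intro nn_integral_mono C(2) a)
    also have "\<dots> = ennreal C * (\<integral>\<^sup>+x. emeasure (P x) {\<omega>\<in>cpaths. \<omega> (a + 2) \<in> ball y 1} \<partial>\<mu>)"
      using measurable_coord_ball[of "\<lambda>x. x" \<mu> "\<lambda>_. y" "a + 2" 1] by (intro nn_integral_cmult) simp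
    also have "(\<integral>\<^sup>+x. emeasure (P x) {\<omega>\<in>cpaths. \<omega> (a + 2) \<in> ball y 1} \<partial>\<mu>) = (\<integral>\<^sup>+x. (\<integral>\<^sup>+z. ennreal (p (a + 2) x z) * indicator (ball y 1) z \<partial>\<mu>) \<partial>\<mu>)"
      using a by (intro nn_integral_cong emeasure_coord) auto
    also have "\<dots> = emeasure \<mu> (ball y 1)" using a by (subst nn_integral_p_swap) (auto intro!: borel_measurable_indicator)
    also have "ennreal C * emeasure \<mu> (ball y 1) \<le> ennreal C * ennreal K" by (intro mult_left_mono K(2)) simp
    finally show "(\<integral>\<^sup>+x. emeasure (P x) (hits (ball y r) a (a + 1)) \<partial>\<mu>) \<le> ennreal (C * K)"
      using C(1) K(1) by (simp add: ennreal_mult')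
  qed (use C K in simp)
qed

text \<open>Points of \<open>ball y 1\<close> are as far from \<open>x\<close> as \<open>y\<close>
  up to 1, and \<open>(d + 1)\<^sup>2 \<le> 2 * d\<^sup>2 + 2\<close>; this halves the rate of the
  Gaussian and costs the factor \<open>exp c\<close>.\<close>

lemma hits_gauss: "\<exists>C>0. \<exists>c>0. \<forall>x y. emeasure (P x) (hits (ball y r) 0 1) \<le> ennreal (C * exp (- c * (dist x y)\<^sup>2))"
proof -
  obtain C where C: "C > 0" "\<And>a x y. a \<ge> 0 \<Longrightarrow> emeasure (P x) (hits (ball y r) a (a + 1)) \<le> ennreal C * emeasure (P x) {\<omega>\<in>cpaths. \<omega> (a + 2) \<in> ball y 1}"
    using hits_le_ball[of r] by blast
  obtain D c where D: "D > 0" "c > 0" "\<And>x y. p 2 x y \<le> D * exp (- c * (dist x y)\<^sup>2)" using p_gauss by blast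
  obtain K where K: "K > 0" "\<And>y. emeasure \<mu> (ball y 1) \<le> ennreal K" using mu_ball[of 1] by blast
  have "emeasure (P x) (hits (ball y r) 0 1) \<le> ennreal (C * (D * exp c * K) * exp (- (c / 2) * (dist x y)\<^sup>2))" for x y
  proof -
    let ?g = "D * exp c * exp (- (c / 2) * (dist x y)\<^sup>2)"
    have "emeasure (P x) {\<omega>\<in>cpaths. \<omega> 2 \<in> ball y 1} = (\<integral>\<^sup>+z. ennreal (p 2 x z) * indicator (ball y 1) z \<partial>\<mu>)"
      by (intro emeasure_coord) auto
    also have "\<dots> \<le> (\<integral>\<^sup>+z. ennreal ?g * indicator (ball y 1) z \<partial>\<mu>)"
    proof (intro nn_integral_mono)
      fix z
      have "p 2 x z \<le> ?g" if "z \<in> ball y 1"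
      proof -
        have "dist x y \<le> dist x z + 1" using dist_triangle[of x y z] that by (simp add: dist_commute)
        then have "(dist x y)\<^sup>2 \<le> (dist x z + 1)\<^sup>2" by (intro power_mono) auto
        also have "\<dots> \<le> 2 * (dist x z)\<^sup>2 + 2" using zero_le_power2[of "dist x z - 1"] by (simp add: power2_eq_square algebra_simps)
        finally have "- c * (dist x z)\<^sup>2 \<le> c + - (c / 2) * (dist x y)\<^sup>2" using D(2) mult_left_mono[of "(dist x y)\<^sup>2" "2 * (dist x z)\<^sup>2 + 2" "c / 2"]
          by (simp add: algebra_simps)
        then have "exp (- c * (dist x z)\<^sup>2) \<le> exp c * exp (- (c / 2) * (dist x y)\<^sup>2)" by (simp add: exp_add[symmetric])
        then have "D * exp (- c * (dist x z)\<^sup>2) \<le> D * (exp c * exp (- (c / 2) * (dist x y)\<^sup>2))"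
          using D(1) by (intro mult_left_mono) auto
        then show ?thesis using D(3)[of x z] unfolding mult.assoc by (rule order_trans[rotated])
      qed
      then show "ennreal (p 2 x z) * indicator (ball y 1) z \<le> ennreal ?g * indicator (ball y 1) z"
        by (auto split: split_indicator intro!: ennreal_leI)
    qed
    also have "\<dots> = ennreal ?g * emeasure \<mu> (ball y 1)" by (simp add: nn_integral_cmult_indicator)
    also have "\<dots> \<le> ennreal ?g * ennreal K" by (intro mult_left_mono K) simp
    finally have "ennreal C * emeasure (P x) {\<omega>\<in>cpaths. \<omega> 2 \<in> ball y 1} \<le> ennreal C * (ennreal ?g * ennreal K)"
      by (rule mult_left_mono) simp
    also have "\<dots> = ennreal (C * (D * exp c * K) * exp (- (c / 2) * (dist x y)\<^sup>2))"
      using C(1) D(1) K(1) by (simp add: ennreal_mult'[symmetric] mult_ac)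
    finally show "emeasure (P x) (hits (ball y r) 0 1) \<le> ennreal (C * (D * exp c * K) * exp (- (c / 2) * (dist x y)\<^sup>2))"
      using C(2)[of 0 x y] by simp
  qed
  moreover have "0 < C * (D * exp c * K)" "0 < c / 2" using C D K by simp_all
  ultimately show ?thesis by blast
qed

lemma hits_volume_finite: "0 \<le> t \<Longrightarrow> (\<integral>\<^sup>+y. emeasure (P x) (hits (ball y r) 0 t) \<partial>\<mu>) < \<infinity>"
proof -
  assume t: "0 \<le> t"
  obtain K where K: "\<And>a x. a \<ge> 0 \<Longrightarrow> (\<integral>\<^sup>+y. emeasure (P x) (hits (ball y r) a (a + 1)) \<partial>\<mu>) \<le> ennreal K"
    using hits_unit_volume[of r] by blast
  have "(\<integral>\<^sup>+y. emeasure (P x) (hits (ball y r) 0 t) \<partial>\<mu>) \<le> (\<integral>\<^sup>+y. (\<Sum>i\<le>nat \<lfloor>t\<rfloor>. emeasure (P x) (hits (ball y r) (real i) (real i + 1))) \<partial>\<mu>)"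
  proof (intro nn_integral_mono)
    fix y
    have "emeasure (P x) (hits (ball y r) 0 t) \<le> emeasure (P x) (\<Union>i\<le>nat \<lfloor>t\<rfloor>. hits (ball y r) (real i) (real i + 1))"
      by (intro emeasure_mono hits_unit_cover t sets.finite_UN) (auto intro: hits_sets)
    also have "\<dots> \<le> (\<Sum>i\<le>nat \<lfloor>t\<rfloor>. emeasure (P x) (hits (ball y r) (real i) (real i + 1)))"
      by (intro emeasure_subadditive_finite) (auto intro: hits_sets)
    finally show "emeasure (P x) (hits (ball y r) 0 t) \<le> (\<Sum>i\<le>nat \<lfloor>t\<rfloor>. emeasure (P x) (hits (ball y r) (real i) (real i + 1)))" .
  qed
  also have "\<dots> = (\<Sum>i\<le>nat \<lfloor>t\<rfloor>. (\<integral>\<^sup>+y. emeasure (P x) (hits (ball y r) (real i) (real i + 1)) \<partial>\<mu>))"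
    by (intro nn_integral_sum) simp
  also have "\<dots> \<le> (\<Sum>i\<le>nat \<lfloor>t\<rfloor>. ennreal K)" by (intro sum_mono K) simp
  also have "\<dots> < \<infinity>" by (simp add: ennreal_mult_less_top of_nat_less_top)
  finally show ?thesis .
qed

text \<open>Cut \<open>[0, s]\<close> into unit intervals. The volume visited in the i-th one is
  bounded on average, and by the Markov property at its end a point of it is visited again near
  \<open>t\<close> with probability of order \<open>(t - i)\<close> to the power -3. Summing the
  cubes leaves the inverse square of the gap.\<close>

lemma revisit_volume:
  "\<exists>C>0. \<forall>s\<ge>0. \<forall>t\<ge>s + 1. \<forall>x. (\<integral>\<^sup>+y. emeasure (P x) (hits (ball y r) 0 s \<inter> hits (ball y r) t (t + 1)) \<partial>\<mu>) \<le> ennreal (C / (t - s)\<^sup>2)"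
proof -
  obtain C where C: "C > 0" "\<And>a x y. a \<ge> 0 \<Longrightarrow> emeasure (P x) (hits (ball y r) a (a + 1)) \<le> ennreal (C / (a + 2) ^ 3)"
    using hits_decay[of r] by blast
  obtain K where K: "K > 0" "\<And>a x. a \<ge> 0 \<Longrightarrow> (\<integral>\<^sup>+y. emeasure (P x) (hits (ball y r) a (a + 1)) \<partial>\<mu>) \<le> ennreal K"
    using hits_unit_volume[of r] by blast
  show ?thesis
  proof (intro exI[of _ "C * K"] conjI allI impI)
    fix s t :: real and x assume s: "0 \<le> s" and t: "s + 1 \<le> t"
    define m where "m = nat \<lfloor>s\<rfloor>"
    let ?H = "\<lambda>y i. hits (ball y r) (real i) (real i + 1)"
    let ?T = "\<lambda>y. hits (ball y r) t (t + 1)"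
    have ms: "real m \<le> s" unfolding m_def using s by simp
    \<comment> \<open>The denominator is that of \<open>hits_decay\<close> for the remaining time
      \<open>t - (i + 1)\<close>, to which it adds 2.\<close>
    have one: "emeasure (P x) (?H y i \<inter> ?T y) \<le> ennreal (C / (t - real i + 1) ^ 3) * emeasure (P x) (?H y i)" if i: "i \<le> m" for y i
    proof -
      have i1: "real i + 1 \<le> t" using i ms t by linarith
      have eqs: "real i + 1 + (t - (real i + 1)) = t" "real i + 1 + (t - (real i + 1) + 1) = t + 1" by auto
      have "?H y i \<inter> ?T y = ?H y i \<inter> {\<omega>\<in>cpaths. shift_path (real i + 1) \<omega> \<in> hits (ball y r) (t - (real i + 1)) (t - (real i + 1) + 1)}"
        using shift_hits[of _ "real i + 1" "t - (real i + 1)" "ball y r" "t - (real i + 1) + 1", unfolded eqs] i1 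
        by (auto simp del: add_diff_eq diff_add_eq simp: hits_def[of _ t])
      moreover have "emeasure (P w) (hits (ball y r) (t - (real i + 1)) (t - (real i + 1) + 1)) \<le> ennreal (C / (t - real i + 1) ^ 3)" for w
        using C(2)[of "t - (real i + 1)" w y] i1 by (simp add: algebra_simps)
      ultimately show ?thesis
        using i1 by (auto intro!: markov_le[where B=UNIV] adapted_hits hits_sets)
    qed
    have "(\<integral>\<^sup>+y. emeasure (P x) (hits (ball y r) 0 s \<inter> ?T y) \<partial>\<mu>) \<le> (\<integral>\<^sup>+y. (\<Sum>i\<le>m. ennreal (C / (t - real i + 1) ^ 3) * emeasure (P x) (?H y i)) \<partial>\<mu>)"
    proof (intro nn_integral_mono)
      fix y
      have "emeasure (P x) (hits (ball y r) 0 s \<inter> ?T y) \<le> emeasure (P x) (\<Union>i\<le>m. ?H y i \<inter> ?T y)"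
        unfolding m_def using hits_unit_cover[OF s, of "ball y r"]
        by (intro emeasure_mono sets.finite_UN) (auto intro!: hits_sets sets.Int)
      also have "\<dots> \<le> (\<Sum>i\<le>m. emeasure (P x) (?H y i \<inter> ?T y))"
        by (intro emeasure_subadditive_finite) (auto intro!: hits_sets sets.Int)
      also have "\<dots> \<le> (\<Sum>i\<le>m. ennreal (C / (t - real i + 1) ^ 3) * emeasure (P x) (?H y i))"
        by (intro sum_mono one) simp
      finally show "emeasure (P x) (hits (ball y r) 0 s \<inter> ?T y) \<le> (\<Sum>i\<le>m. ennreal (C / (t - real i + 1) ^ 3) * emeasure (P x) (?H y i))" .
    qed
    also have "\<dots> = (\<Sum>i\<le>m. ennreal (C / (t - real i + 1) ^ 3) * (\<integral>\<^sup>+y. emeasure (P x) (?H y i) \<partial>\<mu>))"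
      by (subst nn_integral_sum) (auto simp: nn_integral_cmult)
    also have "\<dots> \<le> (\<Sum>i\<le>m. ennreal (C / (t - real i + 1) ^ 3) * ennreal K)"
      by (intro sum_mono mult_left_mono K(2)) auto
    also have "\<dots> = ennreal (\<Sum>i\<le>m. C / (t - real i + 1) ^ 3 * K)"
    proof -
      have "ennreal (C / (t - real i + 1) ^ 3) * ennreal K = ennreal (C / (t - real i + 1) ^ 3 * K)" for i
        using K(1) by (intro ennreal_mult''[symmetric]) simp
      then have "(\<Sum>i\<le>m. ennreal (C / (t - real i + 1) ^ 3) * ennreal K) = (\<Sum>i\<le>m. ennreal (C / (t - real i + 1) ^ 3 * K))"
        by (intro sum.cong) auto
      also have "\<dots> = ennreal (\<Sum>i\<le>m. C / (t - real i + 1) ^ 3 * K)"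
        using ms t C(1) K(1) by (intro sum_ennreal mult_nonneg_nonneg divide_nonneg_nonneg zero_le_power) auto
      finally show ?thesis .
    qed
    also have "\<dots> \<le> ennreal (C * K / (t - s)\<^sup>2)"
    proof (intro ennreal_leI)
      have "(\<Sum>i\<le>m. C / (t - real i + 1) ^ 3 * K) = C * K * (\<Sum>i<Suc m. 1 / (t - real i + 1) ^ 3)"
        by (simp add: sum_distrib_left lessThan_Suc_atMost mult_ac)
      \<comment> \<open>Since \<open>m \<le> s\<close>, the number \<open>t - i\<close> is at least
        \<open>(t - s) + (m - i)\<close>; reversing the order of summation gives the sum estimated
        in \<open>sum_inverse_cubes_le\<close>.\<close>
      also have "(\<Sum>i<Suc m. 1 / (t - real i + 1) ^ 3) \<le> (\<Sum>i<Suc m. 1 / ((t - s) + real (Suc m - Suc i) + 1) ^ 3)"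
        using ms t by (intro sum_mono divide_left_mono power_mono mult_pos_pos zero_less_power) (auto simp: of_nat_diff)
      also have "\<dots> = (\<Sum>i<Suc m. 1 / ((t - s) + real i + 1) ^ 3)"
        by (rule sum.nat_diff_reindex)
      also have "\<dots> \<le> 1 / (t - s)\<^sup>2"
        using sum_inverse_cubes_le[of "t - s" "Suc m"] t zero_le_power2[of "t - s + real (Suc m)"]
        by (smt (verit) divide_nonneg_nonneg)
      finally show "(\<Sum>i\<le>m. C / (t - real i + 1) ^ 3 * K) \<le> C * K / (t - s)\<^sup>2" using C(1) K(1) by simp
    qed
    finally show "(\<integral>\<^sup>+y. emeasure (P x) (hits (ball y r) 0 s \<inter> ?T y) \<partial>\<mu>) \<le> ennreal (C * K / (t - s)\<^sup>2)" .
  qed (use C K in simp)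
qed

text \<open>Whatever happened before \<open>a\<close>, the restarted path visits volume at most
  \<open>K\<close> on average, so the two contributions multiply.\<close>

lemma markov_volume_le:
  assumes E: "adapted a E" and F: "mfam F" and a: "0 < a"
    and K: "\<And>w. (\<integral>\<^sup>+y. emeasure (P w) (F y) \<partial>\<mu>) \<le> K"
  shows "(\<integral>\<^sup>+y. emeasure (P x) (E \<inter> {\<omega>\<in>cpaths. shift_path a \<omega> \<in> F y}) \<partial>\<mu>) \<le> K * emeasure (P x) E"
proof -
  have Es [measurable]: "E \<in> sets path_space" using E by (simp add: adapted_def)
  interpret PM: pair_sigma_finite "P x" \<mu> by standard
  have m: "(\<lambda>(\<omega>, y). indicator E \<omega> * emeasure (P (\<omega> a)) (F y)) \<in> borel_measurable (P x \<Otimes>\<^sub>M \<mu>)"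
    using mfam_emeasure_measurable2[OF F, of "\<lambda>z. fst z a" "P x \<Otimes>\<^sub>M \<mu>" snd] by measurable
  have "(\<integral>\<^sup>+y. emeasure (P x) (E \<inter> {\<omega>\<in>cpaths. shift_path a \<omega> \<in> F y}) \<partial>\<mu>) = (\<integral>\<^sup>+y. (\<integral>\<^sup>+\<omega>. indicator E \<omega> * emeasure (P (\<omega> a)) (F y) \<partial>P x) \<partial>\<mu>)"
    using markov_adapted[OF E mfam_sets[OF F] a] by simp
  also have "\<dots> = (\<integral>\<^sup>+\<omega>. (\<integral>\<^sup>+y. indicator E \<omega> * emeasure (P (\<omega> a)) (F y) \<partial>\<mu>) \<partial>P x)"
    using PM.Fubini'[OF m] by simp
  also have "\<dots> = (\<integral>\<^sup>+\<omega>. indicator E \<omega> * (\<integral>\<^sup>+y. emeasure (P (\<omega> a)) (F y) \<partial>\<mu>) \<partial>P x)"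
    by (intro nn_integral_cong nn_integral_cmult mfam_emeasure_measurable2[OF F]) auto
  also have "\<dots> \<le> (\<integral>\<^sup>+\<omega>. K * indicator E \<omega> \<partial>P x)"
    using K by (intro nn_integral_mono) (auto split: split_indicator)
  also have "\<dots> = K * emeasure (P x) E" by (simp add: nn_integral_cmult_indicator)
  finally show ?thesis .
qed

text \<open>Finiteness needs decay in both \<open>w\<close> and \<open>y\<close>. The two visits
  each give a Gaussian bound, one in the distance from \<open>w\<close> to \<open>y\<close> and one
  in that from \<open>w\<close> to \<open>v\<close>. The better of the two is at most the product of
  both with half the rate, which is integrable in both variables. The radius \<open>max r R\<close>
  lets one constant serve both.\<close>

lemma double_visit_unit: "(\<integral>\<^sup>+w. (\<integral>\<^sup>+y. emeasure (P w) (hits (ball y r) 0 1 \<inter> hits (ball v R) 0 1) \<partial>\<mu>) \<partial>\<mu>) < \<infinity>"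
proof -
  obtain C c where C: "C > 0" "c > 0" "\<And>x y. emeasure (P x) (hits (ball y (max r R)) 0 1) \<le> ennreal (C * exp (- c * (dist x y)\<^sup>2))"
    using hits_gauss[of "max r R"] by blast
  obtain K where K: "K > 0" "\<And>x. (\<integral>\<^sup>+y. ennreal (exp (- (c / 2) * (dist x y)\<^sup>2)) \<partial>\<mu>) \<le> ennreal K"
    using mu_gauss[of "c / 2"] C(2) by auto
  let ?g = "\<lambda>x y. ennreal (exp (- (c / 2) * (dist x y)\<^sup>2))"
  have le: "emeasure (P w) (hits (ball y r) 0 1 \<inter> hits (ball v R) 0 1) \<le> ennreal C * ?g v w * ?g w y" for w y
  proof -
    define X where "X = emeasure (P w) (hits (ball y r) 0 1 \<inter> hits (ball v R) 0 1)"
    have "hits (ball y r) 0 1 \<subseteq> hits (ball y (max r R)) 0 1" "hits (ball v R) 0 1 \<subseteq> hits (ball v (max r R)) 0 1"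
      by (intro hits_mono subset_ball; simp)+
    then have "X \<le> emeasure (P w) (hits (ball y (max r R)) 0 1)" "X \<le> emeasure (P w) (hits (ball v (max r R)) 0 1)"
      unfolding X_def by (auto intro!: emeasure_mono hits_sets)
    then have X: "X \<le> ennreal (C * exp (- c * (dist w y)\<^sup>2))" "X \<le> ennreal (C * exp (- c * (dist w v)\<^sup>2))"
      using C(3)[of w y] C(3)[of w v] by (auto intro: order_trans)
    have "X \<le> ennreal (C * (exp (- (c / 2) * (dist w v)\<^sup>2) * exp (- (c / 2) * (dist w y)\<^sup>2)))"
    proof (cases "(dist w y)\<^sup>2 \<le> (dist w v)\<^sup>2")
      case True
      then have "exp (- c * (dist w v)\<^sup>2) \<le> exp (- (c / 2) * (dist w v)\<^sup>2) * exp (- (c / 2) * (dist w y)\<^sup>2)"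
        unfolding exp_add[symmetric] exp_le_cancel_iff using mult_left_mono[OF True, of c] C(2) by linarith
      then show ?thesis using C(1) by (intro order_trans[OF X(2)] ennreal_leI mult_left_mono) auto
    next
      case False
      then have "exp (- c * (dist w y)\<^sup>2) \<le> exp (- (c / 2) * (dist w v)\<^sup>2) * exp (- (c / 2) * (dist w y)\<^sup>2)"
        unfolding exp_add[symmetric] exp_le_cancel_iff using mult_left_mono[of "(dist w v)\<^sup>2" "(dist w y)\<^sup>2" c] C(2) by linarith
      then show ?thesis using C(1) by (intro order_trans[OF X(1)] ennreal_leI mult_left_mono) auto
    qed
    also have "\<dots> = ennreal C * ?g v w * ?g w y" using C(1) by (simp add: ennreal_mult' dist_commute mult.assoc)
    finally show ?thesis unfolding X_def .
  qed
  have gm: "?g x \<in> borel_measurable borel" for x :: 'a by measurable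
  have "(\<integral>\<^sup>+w. (\<integral>\<^sup>+y. emeasure (P w) (hits (ball y r) 0 1 \<inter> hits (ball v R) 0 1) \<partial>\<mu>) \<partial>\<mu>)
    \<le> (\<integral>\<^sup>+w. (\<integral>\<^sup>+y. ennreal C * ?g v w * ?g w y \<partial>\<mu>) \<partial>\<mu>)"
    by (intro nn_integral_mono le)
  also have "\<dots> = (\<integral>\<^sup>+w. ennreal C * ?g v w * (\<integral>\<^sup>+y. ?g w y \<partial>\<mu>) \<partial>\<mu>)"
    using gm by (intro nn_integral_cong nn_integral_cmult) simp
  also have "\<dots> \<le> (\<integral>\<^sup>+w. (ennreal C * ennreal K) * ?g v w \<partial>\<mu>)"
  proof (intro nn_integral_mono)
    fix w
    have "ennreal C * ?g v w * (\<integral>\<^sup>+y. ?g w y \<partial>\<mu>) \<le> ennreal C * ?g v w * ennreal K" by (intro mult_left_mono K) simp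
    then show "ennreal C * ?g v w * (\<integral>\<^sup>+y. ?g w y \<partial>\<mu>) \<le> (ennreal C * ennreal K) * ?g v w" by (simp add: mult_ac)
  qed
  also have "\<dots> = (ennreal C * ennreal K) * (\<integral>\<^sup>+w. ?g v w \<partial>\<mu>)"
    using gm by (intro nn_integral_cmult) simp
  also have "\<dots> \<le> (ennreal C * ennreal K) * ennreal K" by (intro mult_left_mono K) simp
  also have "\<dots> < \<infinity>" by (simp add: ennreal_mult_less_top)
  finally show ?thesis .
qed

text \<open>Only linear growth in \<open>u\<close>, although the starting points range over a space
  of infinite measure: each unit interval in which \<open>ball v R\<close> can be met contributes a
  bounded amount.\<close>

lemma double_visit_volume:
  "\<exists>C>0. \<forall>u\<ge>1. (\<integral>\<^sup>+z. (\<integral>\<^sup>+y. emeasure (P z) (hits (ball y r) (real u) (real u + 1) \<inter> hits (ball v R) 0 (real u + 1)) \<partial>\<mu>) \<partial>\<mu>) \<le> ennreal (C * real u)"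
proof -
  obtain K where K: "K > 0" "\<And>a x. a \<ge> 0 \<Longrightarrow> (\<integral>\<^sup>+y. emeasure (P x) (hits (ball y r) a (a + 1)) \<partial>\<mu>) \<le> ennreal K"
    using hits_unit_volume[of r] by blast
  obtain K' where K': "K' > 0" "\<And>a y. a \<ge> 0 \<Longrightarrow> (\<integral>\<^sup>+x. emeasure (P x) (hits (ball y R) a (a + 1)) \<partial>\<mu>) \<le> ennreal K'"
    using hits_unit_start[of R] by blast
  define F where "F y = hits (ball y r) 0 1" for y :: 'a
  define G where "G y = F y \<inter> hits (ball v R) 0 1" for y :: 'a
  define J where "J = enn2real (\<integral>\<^sup>+w. (\<integral>\<^sup>+y. emeasure (P w) (G y) \<partial>\<mu>) \<partial>\<mu>)"
  have J: "(\<integral>\<^sup>+w. (\<integral>\<^sup>+y. emeasure (P w) (G y) \<partial>\<mu>) \<partial>\<mu>) = ennreal J" "J \<ge> 0"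
    using double_visit_unit[of r v R] unfolding J_def G_def F_def by simp_all
  have F: "mfam F" unfolding F_def by (rule mfam_hits_ball) simp
  have G: "mfam G" unfolding G_def by (intro mfam_Int F mfam_const hits_sets) auto
  show ?thesis
  proof (intro exI[of _ "K * K' + J"] conjI allI impI)
    show "K * K' + J > 0" using K K' J by (simp add: add_pos_nonneg)
    fix u :: nat assume u: "1 \<le> u"
    let ?B = "\<lambda>j. hits (ball v R) (real j) (real j + 1)"
    let ?S = "\<lambda>y. {\<omega>\<in>cpaths. shift_path (real u) \<omega> \<in> F y}"
    have HS: "hits (ball y r) (real u) (real u + 1) = ?S y" for y
      unfolding F_def using shift_hits[of _ "real u" 0 "ball y r" 1] by (auto simp: hits_def[of _ "real u"])
    have ms: "mfam ?S" unfolding HS[symmetric] by (rule mfam_hits_ball) simp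
    have cov: "hits (ball v R) 0 (real u + 1) \<subseteq> (\<Union>j\<le>u. ?B j)"
    proof
      fix \<omega> assume "\<omega> \<in> hits (ball v R) 0 (real u + 1)"
      then obtain s where s: "0 \<le> s" "s \<le> real u + 1" "\<omega> s \<in> ball v R" "\<omega> \<in> cpaths" by (auto simp: hits_def)
      \<comment> \<open>The minimum takes care of the right end point \<open>s = u + 1\<close>,
        whose floor would be \<open>u + 1\<close>.\<close>
      define j where "j = min u (nat \<lfloor>s\<rfloor>)"
      have "real j \<le> s \<and> s \<le> real j + 1" using s(1,2) unfolding j_def min_def by auto linarith+
      then have "\<omega> \<in> ?B j" using s by (auto simp: hits_def)
      then show "\<omega> \<in> (\<Union>j\<le>u. ?B j)" by (auto simp: j_def)
    qed
    have Bs: "?B j \<in> sets path_space" for j by (rule hits_sets) auto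
    have mfj: "mfam (\<lambda>y. ?B j \<inter> ?S y)" for j by (intro mfam_Int ms mfam_const Bs)
    have mj: "(\<lambda>x. emeasure (P (f x)) (?B j \<inter> ?S (g x))) \<in> borel_measurable M"
      if "f \<in> borel_measurable M" "g \<in> borel_measurable M" for j f g and M :: "'b measure"
      by (rule mfam_emeasure_measurable2[OF mfj that])
    \<comment> \<open>The visit to \<open>ball v R\<close> is over by time \<open>u\<close>. The
      restart at \<open>u\<close> gives the factor \<open>K\<close>, and the integral over starting
      points of the probability of that visit gives \<open>K'\<close>.\<close>
    have j1: "(\<integral>\<^sup>+z. (\<integral>\<^sup>+y. emeasure (P z) (?B j \<inter> ?S y) \<partial>\<mu>) \<partial>\<mu>) \<le> ennreal (K * K')" if j: "j < u" for j
    proof -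
      have "(\<integral>\<^sup>+z. (\<integral>\<^sup>+y. emeasure (P z) (?B j \<inter> ?S y) \<partial>\<mu>) \<partial>\<mu>) \<le> (\<integral>\<^sup>+z. ennreal K * emeasure (P z) (?B j) \<partial>\<mu>)"
        using j K(2)[of 0] unfolding F_def
        by (intro nn_integral_mono markov_volume_le adapted_hits mfam_hits_ball) auto
      also have "\<dots> = ennreal K * (\<integral>\<^sup>+z. emeasure (P z) (?B j) \<partial>\<mu>)"
        using Bs by (intro nn_integral_cmult) simp
      also have "\<dots> \<le> ennreal K * ennreal K'" by (intro mult_left_mono K') auto
      finally show ?thesis using K K' by (simp add: ennreal_mult')
    qed
    \<comment> \<open>Both visits fall into the same unit interval and cannot be separated by a
      restart; invariance of \<mu> moves the interval back to \<open>[0, 1]\<close>.\<close>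
    have j2: "(\<integral>\<^sup>+z. (\<integral>\<^sup>+y. emeasure (P z) (?B u \<inter> ?S y) \<partial>\<mu>) \<partial>\<mu>) \<le> ennreal J"
    proof -
      have u0: "0 < real u" using u by simp
      note [measurable] = p_measurable2[OF u0] p_measurable1[OF u0]
      have gm: "(\<lambda>w. \<integral>\<^sup>+y. emeasure (P w) (G y) \<partial>\<mu>) \<in> borel_measurable borel"
      proof -
        have "(\<lambda>(w, y). emeasure (P w) (G y)) \<in> borel_measurable (borel \<Otimes>\<^sub>M \<mu>)"
          using mfam_emeasure_measurable2[OF G, of fst "borel \<Otimes>\<^sub>M \<mu>" snd] by (simp add: case_prod_beta')
        then show ?thesis by (rule mu.borel_measurable_nn_integral)
      qed
      have eq: "?B u \<inter> ?S y = {\<omega>\<in>cpaths. shift_path (real u) \<omega> \<in> G y}" for y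
        unfolding G_def using shift_hits[of _ "real u" 0 "ball v R" 1] by (auto simp: hits_def[of _ "real u"])
      have m2: "(\<lambda>(y, w). ennreal (p (real u) z w) * emeasure (P w) (G y)) \<in> borel_measurable (\<mu> \<Otimes>\<^sub>M \<mu>)" for z
        using mfam_emeasure_measurable2[OF G, of snd "\<mu> \<Otimes>\<^sub>M \<mu>" fst] by measurable
      have "(\<integral>\<^sup>+y. emeasure (P z) (?B u \<inter> ?S y) \<partial>\<mu>) = (\<integral>\<^sup>+w. ennreal (p (real u) z w) * (\<integral>\<^sup>+y. emeasure (P w) (G y) \<partial>\<mu>) \<partial>\<mu>)" for z
      proof -
        have "(\<integral>\<^sup>+y. emeasure (P z) (?B u \<inter> ?S y) \<partial>\<mu>) = (\<integral>\<^sup>+y. (\<integral>\<^sup>+w. ennreal (p (real u) z w) * emeasure (P w) (G y) \<partial>\<mu>) \<partial>\<mu>)"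
          unfolding eq using markov_shift[OF mfam_sets[OF G] u0] by simp
        also have "\<dots> = (\<integral>\<^sup>+w. (\<integral>\<^sup>+y. ennreal (p (real u) z w) * emeasure (P w) (G y) \<partial>\<mu>) \<partial>\<mu>)"
          using mm.Fubini'[OF m2] by simp
        also have "\<dots> = (\<integral>\<^sup>+w. ennreal (p (real u) z w) * (\<integral>\<^sup>+y. emeasure (P w) (G y) \<partial>\<mu>) \<partial>\<mu>)"
          by (intro nn_integral_cong nn_integral_cmult mfam_emeasure_measurable2[OF G]) auto
        finally show ?thesis .
      qed
      then have "(\<integral>\<^sup>+z. (\<integral>\<^sup>+y. emeasure (P z) (?B u \<inter> ?S y) \<partial>\<mu>) \<partial>\<mu>) = (\<integral>\<^sup>+w. (\<integral>\<^sup>+y. emeasure (P w) (G y) \<partial>\<mu>) \<partial>\<mu>)"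
        using nn_integral_p_swap[OF u0 gm] by simp
      then show ?thesis using J by simp
    qed
    have "(\<integral>\<^sup>+z. (\<integral>\<^sup>+y. emeasure (P z) (?S y \<inter> hits (ball v R) 0 (real u + 1)) \<partial>\<mu>) \<partial>\<mu>)
      \<le> (\<integral>\<^sup>+z. (\<integral>\<^sup>+y. (\<Sum>j\<le>u. emeasure (P z) (?B j \<inter> ?S y)) \<partial>\<mu>) \<partial>\<mu>)"
    proof (intro nn_integral_mono)
      fix z y
      have "emeasure (P z) (?S y \<inter> hits (ball v R) 0 (real u + 1)) \<le> emeasure (P z) (\<Union>j\<le>u. ?B j \<inter> ?S y)"
        using cov mfam_sets[OF mfj] by (intro emeasure_mono sets.finite_UN) auto
      also have "\<dots> \<le> (\<Sum>j\<le>u. emeasure (P z) (?B j \<inter> ?S y))"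
        using mfam_sets[OF mfj] by (intro emeasure_subadditive_finite) auto
      finally show "emeasure (P z) (?S y \<inter> hits (ball v R) 0 (real u + 1)) \<le> (\<Sum>j\<le>u. emeasure (P z) (?B j \<inter> ?S y))" .
    qed
    also have "\<dots> = (\<Sum>j\<le>u. \<integral>\<^sup>+z. (\<integral>\<^sup>+y. emeasure (P z) (?B j \<inter> ?S y) \<partial>\<mu>) \<partial>\<mu>)"
    proof -
      have "(\<integral>\<^sup>+y. (\<Sum>j\<le>u. emeasure (P z) (?B j \<inter> ?S y)) \<partial>\<mu>) = (\<Sum>j\<le>u. \<integral>\<^sup>+y. emeasure (P z) (?B j \<inter> ?S y) \<partial>\<mu>)" for z
        by (intro nn_integral_sum mfam_emeasure_measurable2[OF mfj]) auto
      moreover have "(\<lambda>z. \<integral>\<^sup>+y. emeasure (P z) (?B j \<inter> ?S y) \<partial>\<mu>) \<in> borel_measurable \<mu>" for j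
      proof -
        have "(\<lambda>(w, y). emeasure (P w) (?B j \<inter> ?S y)) \<in> borel_measurable (\<mu> \<Otimes>\<^sub>M \<mu>)"
          using mfam_emeasure_measurable2[OF mfj, of fst "\<mu> \<Otimes>\<^sub>M \<mu>" snd] by (simp add: case_prod_beta')
        then show ?thesis by (rule mu.borel_measurable_nn_integral)
      qed
      ultimately show ?thesis by (simp add: nn_integral_sum)
    qed
    also have "\<dots> = (\<Sum>j<u. \<integral>\<^sup>+z. (\<integral>\<^sup>+y. emeasure (P z) (?B j \<inter> ?S y) \<partial>\<mu>) \<partial>\<mu>) + (\<integral>\<^sup>+z. (\<integral>\<^sup>+y. emeasure (P z) (?B u \<inter> ?S y) \<partial>\<mu>) \<partial>\<mu>)"
      by (simp add: lessThan_Suc_atMost[symmetric])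
    also have "\<dots> \<le> (\<Sum>j<u. ennreal (K * K')) + ennreal J"
      by (intro add_mono sum_mono j1 j2) auto
    also have "\<dots> = ennreal (real u * (K * K') + J)"
      using K K' J by (simp add: ennreal_of_nat_eq_real_of_nat ennreal_mult' ennreal_plus)
    also have "\<dots> \<le> ennreal ((K * K' + J) * real u)"
      using u J by (intro ennreal_leI) (simp add: algebra_simps mult_le_cancel_left1)
    finally show "(\<integral>\<^sup>+z. (\<integral>\<^sup>+y. emeasure (P z) (hits (ball y r) (real u) (real u + 1) \<inter> hits (ball v R) 0 (real u + 1)) \<partial>\<mu>) \<partial>\<mu>) \<le> ennreal ((K * K' + J) * real u)"
      unfolding HS .
  qed
qed

end

(* As a measurability rule it unifies with every application of a variable to an argument. *)
declare measurable_path_coord [measurable del]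

section \<open>Kernel and volume hypotheses from ball volumes and FHK(2)\<close>

lemma power_div_fact_le_exp: "0 \<le> (x::real) \<Longrightarrow> x ^ n / fact n \<le> exp x"
proof -
  assume x: "0 \<le> x"
  have "(\<Sum>k\<in>{n}. x ^ k /\<^sub>R fact k) \<le> (\<Sum>k. x ^ k /\<^sub>R fact k)"
    using x by (intro sum_le_suminf summable_exp_generic) auto
  then show ?thesis by (simp add: exp_def divide_inverse mult.commute)
qed

text \<open>Polynomial growth of ball volumes loses against the Gaussian: the n-th shell contributes
  at most \<open>f n\<close>, which is dominated by a geometric series.\<close>

lemma nn_integral_gauss_le:
  fixes \<mu> :: "'a::euclidean_space measure"
  assumes [measurable_cong]: "sets \<mu> = sets borel" and C: "0 < C" "\<And>R y. 0 < R \<Longrightarrow> emeasure \<mu> (ball y R) \<le> ennreal (C * R ^ d)" and c: "0 < c"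
  shows "\<exists>K>0. \<forall>x. (\<integral>\<^sup>+y. ennreal (exp (- c * (dist x y)\<^sup>2)) \<partial>\<mu>) \<le> ennreal K"
proof -
  define f where "f n = exp (- c * (real n)\<^sup>2) * (C * (real n + 1) ^ d)" for n :: nat
  \<comment> \<open>From \<open>(c / 2 * (n + 1)) ^ d / fact d \<le> exp (c / 2 * (n + 1))\<close>:
    the polynomial uses up half of the rate \<open>c\<close>, and \<open>exp (c / 2)\<close>
    accounts for the shift from \<open>n\<close> to \<open>n + 1\<close>.\<close>
  define M where "M = C * (fact d * (2 / c) ^ d * exp (c / 2))"
  have M: "M > 0" unfolding M_def using C c by simp
  have f0: "0 \<le> f n" for n unfolding f_def using C by simp
  have fle: "f n \<le> M * exp (- c / 2) ^ n" for n
  proof -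
    have "(c / 2 * (real n + 1)) ^ d / fact d \<le> exp (c / 2 * (real n + 1))" using c by (intro power_div_fact_le_exp) simp
    then have "(c / 2) ^ d * (real n + 1) ^ d \<le> fact d * exp (c / 2 * (real n + 1))"
      by (simp add: divide_le_eq mult.commute flip: power_mult_distrib)
    then have "(2 / c) ^ d * ((c / 2) ^ d * (real n + 1) ^ d) \<le> (2 / c) ^ d * (fact d * exp (c / 2 * (real n + 1)))"
      using c by (intro mult_left_mono) auto
    moreover have "(2 / c) ^ d * ((c / 2) ^ d * (real n + 1) ^ d) = (real n + 1) ^ d"
    proof -
      have "(2 / c) ^ d * (c / 2) ^ d = 1" using c by (simp flip: power_mult_distrib)
      then show ?thesis by (simp only: mult.assoc[symmetric] mult_1_left)
    qed
    ultimately have 1: "(real n + 1) ^ d \<le> (2 / c) ^ d * (fact d * exp (c / 2 * (real n + 1)))" by simp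
    have "real n \<le> (real n)\<^sup>2" by (cases n) (auto simp: power2_eq_square)
    then have 2: "exp (- c * (real n)\<^sup>2) \<le> exp (- c * real n)" using c by simp
    have "f n \<le> exp (- c * real n) * (C * ((2 / c) ^ d * (fact d * exp (c / 2 * (real n + 1)))))"
      unfolding f_def using 1 2 C by (intro mult_mono) auto
    also have "\<dots> = M * (exp (- c * real n) * exp (c / 2 * real n))"
      unfolding M_def by (simp add: ring_distribs exp_add)
    also have "exp (- c * real n) * exp (c / 2 * real n) = exp (- c / 2) ^ n"
      unfolding exp_add[symmetric] exp_of_nat_mult[symmetric] by (simp add: algebra_simps)
    finally show ?thesis .
  qed
  have sm: "summable f"
  proof (rule summable_comparison_test'[where N=0])
    show "summable (\<lambda>n. M * exp (- c / 2) ^ n)" using c by (intro summable_mult summable_geometric) simp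
  qed (use f0 fle in simp)
  have "(\<integral>\<^sup>+y. ennreal (exp (- c * (dist x y)\<^sup>2)) \<partial>\<mu>) \<le> ennreal (suminf f + 1)" for x
  proof -
    have "(\<integral>\<^sup>+y. ennreal (exp (- c * (dist x y)\<^sup>2)) \<partial>\<mu>) \<le> (\<integral>\<^sup>+y. (\<Sum>n. ennreal (exp (- c * (real n)\<^sup>2)) * indicator (ball x (real n + 1)) y) \<partial>\<mu>)"
    proof (intro nn_integral_mono)
      fix y
      define n where "n = nat \<lfloor>dist x y\<rfloor>"
      have n: "real n \<le> dist x y" "dist x y < real n + 1" unfolding n_def by (simp_all add: of_nat_nat) 
      then have "(real n)\<^sup>2 \<le> (dist x y)\<^sup>2" by (intro power_mono) auto
      then have "ennreal (exp (- c * (dist x y)\<^sup>2)) \<le> ennreal (exp (- c * (real n)\<^sup>2)) * indicator (ball x (real n + 1)) y"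
        using n c by (auto intro!: ennreal_leI)
      also have "\<dots> = (\<Sum>k\<in>{n}. ennreal (exp (- c * (real k)\<^sup>2)) * indicator (ball x (real k + 1)) y)" by (simp only: sum.insert finite.emptyI empty_iff not_False_eq_True sum.empty add_0_right)
      also have "\<dots> \<le> (\<Sum>n. ennreal (exp (- c * (real n)\<^sup>2)) * indicator (ball x (real n + 1)) y)"
        by (intro sum_le_suminf) auto
      finally show "ennreal (exp (- c * (dist x y)\<^sup>2)) \<le> (\<Sum>n. ennreal (exp (- c * (real n)\<^sup>2)) * indicator (ball x (real n + 1)) y)" .
    qed
    also have "\<dots> = (\<Sum>n. \<integral>\<^sup>+y. ennreal (exp (- c * (real n)\<^sup>2)) * indicator (ball x (real n + 1)) y \<partial>\<mu>)"
      using assms(1) by (intro nn_integral_suminf borel_measurable_times_ennreal borel_measurable_indicator) auto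
    also have "\<dots> = (\<Sum>n. ennreal (exp (- c * (real n)\<^sup>2)) * emeasure \<mu> (ball x (real n + 1)))"
      using assms(1) by (simp add: nn_integral_cmult_indicator)
    also have "\<dots> \<le> (\<Sum>n. ennreal (f n))"
    proof (intro suminf_le)
      fix n
      have "ennreal (exp (- c * (real n)\<^sup>2)) * emeasure \<mu> (ball x (real n + 1)) \<le> ennreal (exp (- c * (real n)\<^sup>2)) * ennreal (C * (real n + 1) ^ d)"
        by (intro mult_left_mono C) auto
      then show "ennreal (exp (- c * (real n)\<^sup>2)) * emeasure \<mu> (ball x (real n + 1)) \<le> ennreal (f n)"
        unfolding f_def using C(1) by (simp add: ennreal_mult')
    qed auto
    also have "\<dots> = ennreal (suminf f)" using f0 sm by (intro suminf_ennreal2) auto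
    also have "\<dots> \<le> ennreal (suminf f + 1)" by (intro ennreal_leI) simp
    finally show ?thesis .
  qed
  moreover have "suminf f + 1 > 0" using suminf_nonneg[OF sm f0] by simp
  ultimately show ?thesis by blast
qed

text \<open>FHK(2) has ball volumes in the denominators, so the lower volume bound (radii at least
  1) yields the upper kernel bounds and the upper volume bound yields
  \<open>p_lower\<close>.\<close>

lemma gaussian_processI:
  fixes \<mu> :: "'a::euclidean_space measure"
  assumes kp: "kernel_process \<mu> p P" and sym: "\<And>t x y. 0 < t \<Longrightarrow> p t x y = p t y x"
    and "FHK2 \<mu> p" and dim: "DIM('a) \<ge> 6"
    and up: "\<And>R y. 0 < R \<Longrightarrow> emeasure \<mu> (ball y R) \<le> ennreal (C * R ^ DIM('a))" and C: "0 < C"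
    and lo: "\<And>R y. 1 \<le> R \<Longrightarrow> ennreal (c * R ^ DIM('a)) \<le> emeasure \<mu> (ball y R)" and c: "0 < c"
  shows "gaussian_process \<mu> p P"
proof -
  interpret kernel_process \<mu> p P by fact
  obtain c5 c6 c7 c8 where fhk: "c5 > 0 \<and> c6 > 0 \<and> c7 > 0 \<and> c8 > 0 \<and>
     (\<forall>t>0. \<forall>x y.
        c5 * exp (- c6 * (dist x y)\<^sup>2 / t) / measure \<mu> (ball x (sqrt t)) \<le> p t x y \<and>
        p t x y \<le> c7 * exp (- c8 * (dist x y)\<^sup>2 / t) / measure \<mu> (ball x (sqrt t)))"
    using \<open>FHK2 \<mu> p\<close> unfolding FHK2_def by (elim exE) (rule that)
  then have pos: "c5 > 0" "c6 > 0" "c7 > 0" "c8 > 0" by simp_all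
  have plo: "c5 * exp (- c6 * (dist x y)\<^sup>2 / t) / measure \<mu> (ball x (sqrt t)) \<le> p t x y"
    and pup: "p t x y \<le> c7 * exp (- c8 * (dist x y)\<^sup>2 / t) / measure \<mu> (ball x (sqrt t))" if "0 < t" for t x y
    using fhk that by simp_all
  have fin: "emeasure \<mu> (ball x R) = ennreal (measure \<mu> (ball x R))" if "R > 0" for x R
    using up[OF that, of x] by (intro emeasure_eq_ennreal_measure) (auto simp: top_unique)
  have mup: "measure \<mu> (ball x R) \<le> C * R ^ DIM('a)" if "R > 0" for x R
    using up[OF that, of x] fin[OF that, of x] C that by (simp add: ennreal_le_iff)
  have mlo: "c * R ^ DIM('a) \<le> measure \<mu> (ball x R)" if "R \<ge> 1" for x R
    using lo[OF that, of x] fin[of R x] that by (simp add: ennreal_le_iff)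
  have mpos: "0 < measure \<mu> (ball x R)" if "R \<ge> 1" for x R
  proof -
    have "0 < c * R ^ DIM('a)" using c that by simp
    then show ?thesis using mlo[OF that, of x] by linarith
  qed
  show ?thesis
  proof (unfold_locales)
    show "0 < t \<Longrightarrow> p t x y = p t y x" for t x y by (rule sym)
    show "\<exists>C>0. \<forall>t\<ge>1. \<forall>x y. p t x y \<le> C / t ^ 3"
    proof (intro exI[of _ "c7 / c"] conjI allI impI)
      fix t :: real and x y :: 'a assume t: "1 \<le> t"
      have st: "1 \<le> sqrt t" using t by simp
      \<comment> \<open>The place where dimension at least 6 produces the cube.\<close>
      have "t ^ 3 = sqrt t ^ 6" using t power_mult[of "sqrt t" 2 3] by simp
      also have "\<dots> \<le> sqrt t ^ DIM('a)" using st dim by (intro power_increasing)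
      finally have "c * t ^ 3 \<le> measure \<mu> (ball x (sqrt t))" using mlo[OF st, of x] c mult_left_mono[of "t^3" "sqrt t ^ DIM('a)" c] by linarith
      moreover have "exp (- c8 * (dist x y)\<^sup>2 / t) \<le> 1" using pos t by simp
      ultimately have "c7 * exp (- c8 * (dist x y)\<^sup>2 / t) / measure \<mu> (ball x (sqrt t)) \<le> c7 * 1 / (c * t ^ 3)"
        using pos c t by (intro frac_le mult_left_mono) auto
      then show "p t x y \<le> c7 / c / t ^ 3" using pup[of t x y] t by simp
    qed (use pos c in simp)
    show "\<exists>C>0. \<exists>c>0. \<forall>x y. p 2 x y \<le> C * exp (- c * (dist x y)\<^sup>2)"
    proof -
      have "p 2 x y \<le> c7 / c * exp (- (c8 / 2) * (dist x y)\<^sup>2)" for x y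
      proof -
        have "c \<le> c * sqrt 2 ^ DIM('a)" using c one_le_power[of "sqrt 2" "DIM('a)"] by simp
        then have "c \<le> measure \<mu> (ball x (sqrt 2))" using mlo[of "sqrt 2" x] by simp
        then have "c7 * exp (- c8 * (dist x y)\<^sup>2 / 2) / measure \<mu> (ball x (sqrt 2)) \<le> c7 * exp (- c8 * (dist x y)\<^sup>2 / 2) / c"
          using pos c by (intro divide_left_mono) (auto simp: mpos)
        then show ?thesis using pup[of 2 x y] by simp
      qed
      moreover have "c7 / c > 0" "c8 / 2 > 0" using pos c by auto
      ultimately show ?thesis by blast
    qed
    show "\<exists>\<kappa>>0. \<forall>t\<in>{1..2}. \<forall>x y. dist x y < r \<longrightarrow> \<kappa> \<le> p t x y" for r
    proof (intro exI[of _ "c5 * exp (- c6 * r\<^sup>2) / (C * sqrt 2 ^ DIM('a))"] conjI ballI allI impI)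
      fix t :: real and x y :: 'a assume t: "t \<in> {1..2}" and d: "dist x y < r"
      have "(dist x y)\<^sup>2 \<le> r\<^sup>2" using d by (intro power_mono) auto
      moreover have "(dist x y)\<^sup>2 / t \<le> (dist x y)\<^sup>2 / 1" using t by (intro divide_left_mono) auto
      ultimately have "(dist x y)\<^sup>2 / t \<le> r\<^sup>2" by simp
      then have e: "exp (- c6 * r\<^sup>2) \<le> exp (- c6 * (dist x y)\<^sup>2 / t)" using pos mult_left_mono[of "(dist x y)\<^sup>2 / t" "r\<^sup>2" c6] by simp
      have "measure \<mu> (ball x (sqrt t)) \<le> C * sqrt t ^ DIM('a)" using t by (intro mup) auto
      also have "\<dots> \<le> C * sqrt 2 ^ DIM('a)" using t C by (intro mult_left_mono power_mono) auto
      finally have "c5 * exp (- c6 * r\<^sup>2) / (C * sqrt 2 ^ DIM('a)) \<le> c5 * exp (- c6 * (dist x y)\<^sup>2 / t) / measure \<mu> (ball x (sqrt t))"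
        using e pos t by (intro frac_le mult_left_mono mpos) auto
      then show "c5 * exp (- c6 * r\<^sup>2) / (C * sqrt 2 ^ DIM('a)) \<le> p t x y" using plo[of t x y] t by auto
    qed (use pos C in simp)
    show "\<exists>K>0. \<forall>y. emeasure \<mu> (ball y r) \<le> ennreal K" for r
    proof (cases "r > 0")
      case True
      then show ?thesis using up C by (intro exI[of _ "C * r ^ DIM('a)"]) auto
    next
      case False
      then have "emeasure \<mu> (ball y r) \<le> ennreal 1" for y :: 'a by (subst ball_empty) auto
      then show ?thesis by (intro exI[of _ 1] conjI allI) simp_all
    qed
    show "\<exists>\<kappa>>0. \<forall>y. ennreal \<kappa> \<le> emeasure \<mu> (ball y 1)" using lo[of 1] c by auto
    show "0 < a \<Longrightarrow> \<exists>K>0. \<forall>x. (\<integral>\<^sup>+y. ennreal (exp (- a * (dist x y)\<^sup>2)) \<partial>\<mu>) \<le> ennreal K" for a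
      by (rule nn_integral_gauss_le[OF sets_mu C up])
  qed
qed

section \<open>Newly visited volume\<close>

definition newly :: "real \<Rightarrow> real \<Rightarrow> real \<Rightarrow> 'a::metric_space \<Rightarrow> (real \<Rightarrow> 'a) set" where
  "newly r a b y = hits (ball y r) 0 b - hits (ball y r) 0 a"

lemma mfam_newly: "0 \<le> a \<Longrightarrow> a \<le> b \<Longrightarrow> mfam (newly r a b :: 'a::euclidean_space \<Rightarrow> _)"
  unfolding newly_def by (intro mfam_Diff mfam_hits_ball) auto

lemma shift_newly:
  assumes "0 \<le> s" "0 \<le> a"
  shows "{\<omega>\<in>cpaths. shift_path s \<omega> \<in> newly r a b y} = hits (ball y r) s (s + b) - hits (ball y r) s (s + a)"
  unfolding newly_def using shift_hits[of _ s 0 "ball y r" a] shift_hits[of _ s 0 "ball y r" b] assms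
  by (auto simp: hits_def[of _ s])

context gaussian_process
begin

text \<open>The expected volume of the sausage after Tonelli, see
  \<open>expected_sausage_vol\<close>. It is finite for \<open>t \<ge> 0\<close> by
  \<open>hits_volume_finite\<close>, so \<open>enn2real\<close> loses nothing there.\<close>

definition vol :: "real \<Rightarrow> 'a \<Rightarrow> real \<Rightarrow> real" where
  "vol r x t = enn2real (\<integral>\<^sup>+y. emeasure (P x) (hits (ball y r) 0 t) \<partial>\<mu>)"

lemma ennreal_vol: "0 \<le> t \<Longrightarrow> (\<integral>\<^sup>+y. emeasure (P x) (hits (ball y r) 0 t) \<partial>\<mu>) = ennreal (vol r x t)"
  using hits_volume_finite[of t x r] unfolding vol_def by simp

lemma vol_nonneg: "0 \<le> vol r x t" unfolding vol_def by simp

lemma vol_newly: "0 \<le> a \<Longrightarrow> a \<le> b \<Longrightarrow> (\<integral>\<^sup>+y. emeasure (P x) (newly r a b y) \<partial>\<mu>) = ennreal (vol r x b - vol r x a) \<and> vol r x a \<le> vol r x b"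
proof -
  assume ab: "0 \<le> a" "a \<le> b"
  have sub: "hits (ball y r) 0 a \<subseteq> hits (ball y r) 0 b" for y using ab by (intro hits_mono) auto
  have "emeasure (P x) (hits (ball y r) 0 b) = emeasure (P x) (hits (ball y r) 0 a) + emeasure (P x) (newly r a b y)" for y
  proof -
    have "hits (ball y r) 0 b = hits (ball y r) 0 a \<union> newly r a b y" using sub[of y] unfolding newly_def by auto
    moreover have "emeasure (P x) (hits (ball y r) 0 a \<union> newly r a b y) = emeasure (P x) (hits (ball y r) 0 a) + emeasure (P x) (newly r a b y)"
      using ab mfam_sets[OF mfam_newly[OF ab]] by (intro plus_emeasure[symmetric] hits_sets_P) (auto simp: newly_def)
    ultimately show ?thesis by simp
  qed
  then have "(\<integral>\<^sup>+y. emeasure (P x) (hits (ball y r) 0 b) \<partial>\<mu>) = (\<integral>\<^sup>+y. emeasure (P x) (hits (ball y r) 0 a) \<partial>\<mu>) + (\<integral>\<^sup>+y. emeasure (P x) (newly r a b y) \<partial>\<mu>)"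
    using mfam_emeasure_measurable2[OF mfam_newly[OF ab, of r], of "\<lambda>_. x" \<mu> "\<lambda>y. y"] ab by (simp add: nn_integral_add)
  then have eq: "ennreal (vol r x b) = ennreal (vol r x a) + (\<integral>\<^sup>+y. emeasure (P x) (newly r a b y) \<partial>\<mu>)"
    using ennreal_vol[of b x r] ennreal_vol[of a x r] ab by simp
  then have fin: "(\<integral>\<^sup>+y. emeasure (P x) (newly r a b y) \<partial>\<mu>) \<noteq> \<top>" by (metis ennreal_add_eq_top ennreal_neq_top)
  then obtain i where i: "(\<integral>\<^sup>+y. emeasure (P x) (newly r a b y) \<partial>\<mu>) = ennreal i" "i \<ge> 0"
    by (metis enn2real_nonneg ennreal_enn2real less_top)
  then have "vol r x b = vol r x a + i" using eq vol_nonneg by (simp flip: ennreal_plus)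
  then show ?thesis using i by simp
qed

lemma newly_shift:
  assumes "0 < s" "0 \<le> u" "0 \<le> h"
  shows "(\<integral>\<^sup>+y. emeasure (P x) (hits (ball y r) s (s + (u + h)) - hits (ball y r) s (s + u)) \<partial>\<mu>) =
    (\<integral>\<^sup>+z. ennreal (p s x z) * (\<integral>\<^sup>+y. emeasure (P z) (newly r u (u + h) y) \<partial>\<mu>) \<partial>\<mu>)"
proof -
  have m: "mfam (newly r u (u + h) :: 'a \<Rightarrow> _)" using assms by (intro mfam_newly) auto
  note [measurable] = p_measurable2[OF assms(1)] p_measurable1[OF assms(1)]
  have m2: "(\<lambda>(y, z). ennreal (p s x z) * emeasure (P z) (newly r u (u + h) y)) \<in> borel_measurable (\<mu> \<Otimes>\<^sub>M \<mu>)"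
    using mfam_emeasure_measurable2[OF m, of snd "\<mu> \<Otimes>\<^sub>M \<mu>" fst] by measurable
  have "(\<integral>\<^sup>+y. emeasure (P x) (hits (ball y r) s (s + (u + h)) - hits (ball y r) s (s + u)) \<partial>\<mu>) =
    (\<integral>\<^sup>+y. (\<integral>\<^sup>+z. ennreal (p s x z) * emeasure (P z) (newly r u (u + h) y) \<partial>\<mu>) \<partial>\<mu>)"
    using markov_shift[OF mfam_sets[OF m] assms(1)] assms by (simp add: shift_newly)
  also have "\<dots> = (\<integral>\<^sup>+z. (\<integral>\<^sup>+y. ennreal (p s x z) * emeasure (P z) (newly r u (u + h) y) \<partial>\<mu>) \<partial>\<mu>)"
    using mm.Fubini'[OF m2] by simp
  also have "\<dots> = (\<integral>\<^sup>+z. ennreal (p s x z) * (\<integral>\<^sup>+y. emeasure (P z) (newly r u (u + h) y) \<partial>\<mu>) \<partial>\<mu>)"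
    by (intro nn_integral_cong nn_integral_cmult mfam_emeasure_measurable2[OF m]) auto
  finally show ?thesis .
qed

text \<open>\<open>I\<close> counts points new for the whole path, \<open>J\<close> points new for
  the path restarted at \<open>s\<close>. Forgetting the past only adds points, and those added were
  visited before \<open>s\<close> and again after \<open>s + u\<close>, which
  \<open>revisit_volume\<close> bounds.\<close>

lemma newly_compare:
  "\<exists>C>0. \<forall>s>0. \<forall>u\<ge>1. \<forall>h\<in>{0..1}. \<forall>x. let I = \<integral>\<^sup>+y. emeasure (P x) (newly r (s + u) (s + u + h) y) \<partial>\<mu>;
     J = \<integral>\<^sup>+z. ennreal (p s x z) * (\<integral>\<^sup>+y. emeasure (P z) (newly r u (u + h) y) \<partial>\<mu>) \<partial>\<mu>
     in I \<le> J \<and> J \<le> I + ennreal (C / u\<^sup>2)"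
proof -
  obtain C where C: "C > 0" "\<And>s t x. s \<ge> 0 \<Longrightarrow> t \<ge> s + 1 \<Longrightarrow> (\<integral>\<^sup>+y. emeasure (P x) (hits (ball y r) 0 s \<inter> hits (ball y r) t (t + 1)) \<partial>\<mu>) \<le> ennreal (C / (t - s)\<^sup>2)"
    using revisit_volume[of r] by blast
  show ?thesis unfolding Let_def
  proof (intro exI[of _ C] conjI allI impI ballI)
    show "C > 0" by fact
    fix s u h :: real and x :: 'a assume s: "0 < s" and u: "1 \<le> u" and h: "h \<in> {0..1}"
    let ?N = "newly r (s + u) (s + u + h) :: 'a \<Rightarrow> _"
    let ?S = "\<lambda>y::'a. hits (ball y r) s (s + (u + h)) - hits (ball y r) s (s + u)"
    let ?R = "\<lambda>y::'a. hits (ball y r) 0 s \<inter> hits (ball y r) (s + u) (s + u + 1)"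
    have mN: "mfam (?N :: 'a \<Rightarrow> _)" using s u h by (intro mfam_newly) auto
    have mS: "mfam (?S :: 'a \<Rightarrow> _)" using s u h by (intro mfam_Diff mfam_hits_ball) auto
    have mR: "mfam (?R :: 'a \<Rightarrow> _)" using s u h by (intro mfam_Int mfam_hits_ball) auto
    have e: "hits (ball y r) 0 (s + u) = hits (ball y r) 0 s \<union> hits (ball y r) s (s + u)"
      "hits (ball y r) 0 (s + u + h) = hits (ball y r) 0 s \<union> hits (ball y r) s (s + u + h)"
      "hits (ball y r) s (s + u + h) = hits (ball y r) s (s + u) \<union> hits (ball y r) (s + u) (s + u + h)" 
      "hits (ball y r) (s + u) (s + u + h) \<subseteq> hits (ball y r) (s + u) (s + u + 1)" for y :: 'a
      using s u h hits_Un[of 0 s "s + u" "ball y r"] hits_Un[of 0 s "s + u + h" "ball y r"] hits_Un[of s "s + u" "s + u + h" "ball y r"]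
        hits_mono[of "ball y r" "ball y r" "s + u" "s + u" "s + u + h" "s + u + 1"] by auto
    have "?N y \<subseteq> ?S y" "?S y \<subseteq> ?N y \<union> ?R y" for y
      unfolding newly_def add.assoc[symmetric] using e[of y] by blast+
    then have le: "emeasure (P x) (?N y) \<le> emeasure (P x) (?S y)" "emeasure (P x) (?S y) \<le> emeasure (P x) (?N y) + emeasure (P x) (?R y)" for y
      using mfam_sets_P[OF mN] mfam_sets_P[OF mS] mfam_sets_P[OF mR]
      by (auto intro!: emeasure_mono order_trans[OF emeasure_mono emeasure_subadditive])
    have eq: "(\<integral>\<^sup>+y. emeasure (P x) (?S y) \<partial>\<mu>) = (\<integral>\<^sup>+z. ennreal (p s x z) * (\<integral>\<^sup>+y. emeasure (P z) (newly r u (u + h) y) \<partial>\<mu>) \<partial>\<mu>)"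
      using s u h by (intro newly_shift) auto
    show "(\<integral>\<^sup>+y. emeasure (P x) (?N y) \<partial>\<mu>) \<le> (\<integral>\<^sup>+z. ennreal (p s x z) * (\<integral>\<^sup>+y. emeasure (P z) (newly r u (u + h) y) \<partial>\<mu>) \<partial>\<mu>)"
      unfolding eq[symmetric] by (intro nn_integral_mono le)
    have "(\<integral>\<^sup>+y. emeasure (P x) (?S y) \<partial>\<mu>) \<le> (\<integral>\<^sup>+y. emeasure (P x) (?N y) + emeasure (P x) (?R y) \<partial>\<mu>)"
      by (intro nn_integral_mono le)
    also have "\<dots> = (\<integral>\<^sup>+y. emeasure (P x) (?N y) \<partial>\<mu>) + (\<integral>\<^sup>+y. emeasure (P x) (?R y) \<partial>\<mu>)"
      using mfam_emeasure_measurable2[OF mN, of "\<lambda>_. x" \<mu> "\<lambda>y. y"] mfam_emeasure_measurable2[OF mR, of "\<lambda>_. x" \<mu> "\<lambda>y. y"]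
      by (intro nn_integral_add) auto
    also have "\<dots> \<le> (\<integral>\<^sup>+y. emeasure (P x) (?N y) \<partial>\<mu>) + ennreal (C / u\<^sup>2)"
      using C(2)[of s "s + u" x] s u by (intro add_left_mono) simp
    finally show "(\<integral>\<^sup>+z. ennreal (p s x z) * (\<integral>\<^sup>+y. emeasure (P z) (newly r u (u + h) y) \<partial>\<mu>) \<partial>\<mu>) \<le> (\<integral>\<^sup>+y. emeasure (P x) (?N y) \<partial>\<mu>) + ennreal (C / u\<^sup>2)"
      unfolding eq .
  qed
qed

end

section \<open>Brownian motion\<close>

lemma nn_integral_lborel_translate:
  fixes v :: "'a::euclidean_space"
  assumes "f \<in> borel_measurable borel"
  shows "(\<integral>\<^sup>+y. f (y + v) \<partial>lborel) = (\<integral>\<^sup>+y. f y \<partial>lborel)"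
proof -
  have "(\<integral>\<^sup>+y. f y \<partial>lborel) = (\<integral>\<^sup>+y. f y \<partial>distr lborel borel ((+) v))" by (simp add: lborel_distr_plus)
  also have "\<dots> = (\<integral>\<^sup>+y. f (v + y) \<partial>lborel)" using assms by (intro nn_integral_distr) auto
  finally show ?thesis by (simp add: add.commute)
qed

lemma gauss_kernel_measurable [measurable]:
  "f \<in> borel_measurable M \<Longrightarrow> g \<in> borel_measurable M \<Longrightarrow> h \<in> borel_measurable M \<Longrightarrow> (\<lambda>z. gauss_kernel (f z) (g z) (h z)) \<in> borel_measurable M"
  unfolding gauss_kernel_def
  by (intro borel_measurable_times powr_real_measurable borel_measurable_const measurable_compose[OF _ borel_measurable_exp]
      borel_measurable_divide borel_measurable_uminus borel_measurable_power borel_measurable_dist)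

text \<open>The ball of radius \<open>sqrt t\<close> has volume proportional to
  \<open>t powr (d/2)\<close>, so both bounds hold with equality and the same constants
  \<open>c\<close> and 1/2.\<close>

lemma gauss_kernel_FHK2: "FHK2 lborel (gauss_kernel :: real \<Rightarrow> 'a::euclidean_space \<Rightarrow> 'a \<Rightarrow> real)"
proof -
  define U where "U = unit_ball_vol (real DIM('a))"
  have U: "U > 0" by (simp add: U_def)
  define c where "c = (2 * pi) powr (- real DIM('a) / 2) * U"
  have c: "c > 0" using U by (simp add: c_def)
  have "gauss_kernel t x y = c * exp (- (1/2) * (dist x y)\<^sup>2 / t) / measure lborel (ball x (sqrt t))" if t: "t > 0" for t and x y :: 'a
  proof -
    have 1: "measure lborel (ball x (sqrt t)) = U * sqrt t ^ DIM('a)" using t by (simp add: content_ball U_def)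
    have "sqrt t ^ DIM('a) = t powr (real DIM('a) / 2)"
      using t by (simp add: powr_half_sqrt[symmetric] powr_realpow[symmetric] powr_powr)
    moreover have "(2 * pi * t) powr (- real DIM('a) / 2) = (2 * pi) powr (- real DIM('a) / 2) * t powr (- real DIM('a) / 2)"
      using t by (simp add: powr_mult)
    moreover have "t powr (- real DIM('a) / 2) = 1 / t powr (real DIM('a) / 2)" using powr_minus_divide[of t "real DIM('a) / 2"] by simp
    ultimately show ?thesis unfolding gauss_kernel_def 1 c_def using U by simp
  qed
  then show ?thesis unfolding FHK2_def using c by (intro exI[of _ c] exI[of _ "1/2"]) auto
qed

locale brownian =
  fixes W :: "'a::euclidean_space \<Rightarrow> (real \<Rightarrow> 'a) measure"
  assumes markov_W: "markov_process lborel gauss_kernel W" and dim: "DIM('a) \<ge> 6"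
begin

sublocale gaussian_process lborel gauss_kernel W
proof (rule gaussian_processI)
  show "kernel_process lborel gauss_kernel W"
  proof
    show "case_prod (gauss_kernel t) \<in> borel_measurable (borel \<Otimes>\<^sub>M (borel :: 'a measure))" for t by measurable
  qed (auto simp: markov_W gauss_kernel_def sigma_finite_lborel)
  show "gauss_kernel t x y = gauss_kernel t y x" for t and x y :: 'a by (simp add: gauss_kernel_def dist_commute)
  show "FHK2 lborel (gauss_kernel :: real \<Rightarrow> 'a \<Rightarrow> 'a \<Rightarrow> real)" by (rule gauss_kernel_FHK2)
  show "emeasure lborel (ball y R) \<le> ennreal (unit_ball_vol (real DIM('a)) * R ^ DIM('a))" if "0 < R" for R and y :: 'a
    using that by (simp add: emeasure_ball)
  show "ennreal (unit_ball_vol (real DIM('a)) * R ^ DIM('a)) \<le> emeasure lborel (ball y R)" if "1 \<le> R" for R and y :: 'a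
    using that by (simp add: emeasure_ball)
qed (use dim in auto)

lemma nnkprob_translate:
  fixes x v :: 'a
  assumes "adm s ts" "f \<in> borel_measurable borel"
  shows "nnkprob lborel gauss_kernel f (x + v) s ts =
    nnkprob lborel gauss_kernel (\<lambda>y. f (y + v)) x s (map (\<lambda>(t, A). (t, (\<lambda>y. y + v) -` A)) ts)"
  using assms
proof (induction ts arbitrary: s x)
  case (Cons u ts)
  obtain t A where u: "u = (t, A)" by force
  have A [measurable]: "A \<in> sets borel" and t: "t - s > 0" "adm t ts" using Cons u by (auto simp: adm_Cons)
  note [measurable] = nnkprob_measurable[OF t(2) Cons.prems(2)]
  have "nnkprob lborel gauss_kernel f (x + v) s (u # ts) =
    (\<integral>\<^sup>+y. indicator A (y + v) * ennreal (gauss_kernel (t - s) (x + v) (y + v)) * nnkprob lborel gauss_kernel f (y + v) t ts \<partial>lborel)"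
    unfolding u by (simp, rule nn_integral_lborel_translate[symmetric]) measurable
  moreover have "gauss_kernel (t - s) (x + v) (y + v) = gauss_kernel (t - s) x y" for y by (simp add: gauss_kernel_def)
  ultimately show ?case unfolding u using Cons.IH[OF t(2) Cons.prems(2)] by (simp add: indicator_vimage)
qed simp

text \<open>The kernel depends on differences only and Lebesgue measure is translation invariant, so
  the laws agree on cylinders.\<close>

lemma W_translate:
  assumes "E \<in> sets path_space"
  shows "emeasure (W (x + v)) E = emeasure (W x) {\<omega>\<in>cpaths. (\<lambda>t. \<omega> t + v) \<in> E}"
proof -
  have tc: "(\<lambda>t. \<omega> t + v) \<in> cpaths" if w: "\<omega> \<in> cpaths" for \<omega> :: "real \<Rightarrow> 'a"
  proof (rule cpathsI)
    show "continuous_on UNIV (\<lambda>t. \<omega> t + v)" using cpaths_cont[OF w, of UNIV] by (intro continuous_intros)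
    show "\<omega> t + v = \<omega> 0 + v" if "t \<le> 0" for t using cpaths_nonpos[OF w that] by simp
  qed
  have m: "(\<lambda>\<omega> t. \<omega> t + v) \<in> W x \<rightarrow>\<^sub>M path_space"
    unfolding measurable_P
  proof (rule measurable_path_spaceI)
    show "(\<lambda>\<omega>. \<omega> t + v) \<in> path_space \<rightarrow>\<^sub>M borel" for t
      using measurable_path_coord[of t] by measurable
  qed (auto simp: tc)
  have "W (x + v) = distr (W x) path_space (\<lambda>\<omega> t. \<omega> t + v)" (is "_ = ?D")
  proof (rule path_measure_eqI)
    fix J :: "real set" and A :: "real \<Rightarrow> 'a set"
    assume J: "finite J" "J \<subseteq> {0<..}" "\<And>t. A t \<in> sets borel"
    let ?ts = "map (\<lambda>t. (t, A t)) (sorted_list_of_set J)"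
    let ?us = "map (\<lambda>t. (t, (\<lambda>y. y + v) -` A t)) (sorted_list_of_set J)"
    have vA: "(\<lambda>y. y + v) -` A t \<in> sets borel" for t using measurable_sets[of "\<lambda>y. y + v" borel borel "A t"] J(3) by simp
    have a: "adm 0 ?ts" using J by (intro adm_sorted_list) auto
    have a': "adm 0 ?us" using J vA by (intro adm_sorted_list) auto
    have "emeasure ?D (cyl J A) = emeasure (W x) ((\<lambda>\<omega> t. \<omega> t + v) -` cyl J A \<inter> space (W x))"
      using J by (intro emeasure_distr m) simp
    also have "(\<lambda>\<omega> t. \<omega> t + v) -` cyl J A \<inter> space (W x) = cyl J (\<lambda>t. (\<lambda>y. y + v) -` A t)"
      by (auto simp: cyl_def tc)
    also have "emeasure (W x) \<dots> = nnkprob lborel gauss_kernel (\<lambda>_. 1) x 0 ?us"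
      unfolding cyl_lcyl[OF J(1)] by (rule emeasure_lcyl[OF a'])
    also have "\<dots> = nnkprob lborel gauss_kernel (\<lambda>_. 1) (x + v) 0 ?ts"
      using nnkprob_translate[OF a, of "\<lambda>_. 1" x v] by (simp add: comp_def)
    also have "\<dots> = emeasure (W (x + v)) (cyl J A)"
      unfolding cyl_lcyl[OF J(1)] by (rule emeasure_lcyl[OF a, symmetric])
    finally show "emeasure (W (x + v)) (cyl J A) = emeasure ?D (cyl J A)" by simp
  qed (auto intro: P.finite_measure_axioms)
  then have "emeasure (W (x + v)) E = emeasure (W x) ((\<lambda>\<omega> t. \<omega> t + v) -` E \<inter> space (W x))"
    using emeasure_distr[OF m assms] by simp
  moreover have "(\<lambda>\<omega> t. \<omega> t + v) -` E \<inter> space (W x) = {\<omega>\<in>cpaths. (\<lambda>t. \<omega> t + v) \<in> E}" by auto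
  ultimately show ?thesis by simp
qed

lemma W_newly_translate:
  assumes ab: "0 \<le> a" "a \<le> b"
  shows "(\<integral>\<^sup>+y. emeasure (W x) (newly r a b y) \<partial>lborel) = (\<integral>\<^sup>+y. emeasure (W 0) (newly r a b y) \<partial>lborel)"
proof -
  have m: "mfam (newly r a b :: 'a \<Rightarrow> _)" by (rule mfam_newly[OF ab])
  have "emeasure (W (0 + x)) (newly r a b (y + x)) = emeasure (W 0) (newly r a b y)" for y
  proof -
    have "emeasure (W (0 + x)) (newly r a b (y + x)) = emeasure (W 0) {\<omega>\<in>cpaths. (\<lambda>t. \<omega> t + x) \<in> newly r a b (y + x)}"
      by (rule W_translate[OF mfam_sets[OF m]])
    also have "{\<omega>\<in>cpaths. (\<lambda>t. \<omega> t + x) \<in> newly r a b (y + x)} = newly r a b y"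
    proof -
      have "(\<lambda>t. \<omega> t + x) \<in> cpaths" if w: "\<omega> \<in> cpaths" for \<omega> :: "real \<Rightarrow> 'a"
      proof (rule cpathsI)
        show "continuous_on UNIV (\<lambda>t. \<omega> t + x)" using cpaths_cont[OF w, of UNIV] by (intro continuous_intros)
        show "\<omega> t + x = \<omega> 0 + x" if "t \<le> 0" for t using cpaths_nonpos[OF w that] by simp
      qed
      then show ?thesis unfolding newly_def hits_def by (auto simp: dist_norm)
    qed
    finally show ?thesis .
  qed
  then have "(\<integral>\<^sup>+y. emeasure (W 0) (newly r a b y) \<partial>lborel) = (\<integral>\<^sup>+y. emeasure (W x) (newly r a b (y + x)) \<partial>lborel)" by simp
  also have "\<dots> = (\<integral>\<^sup>+y. emeasure (W x) (newly r a b y) \<partial>lborel)"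
    by (rule nn_integral_lborel_translate) (rule mfam_emeasure_measurable2[OF m], auto)
  finally show ?thesis by simp
qed

text \<open>For Brownian motion the increment over a step \<open>h\<close> decreases in time, and
  the total decrease beyond \<open>u\<close> is at most \<open>C / u\<^sup>2\<close>. Adding
  \<open>n\<close> consecutive increments makes the volume linear up to
  \<open>n * (C / u\<^sup>2)\<close>, which allows a single increment to be compared with the
  asymptotic rate.\<close>

lemma vol_increment:
  "\<exists>C>0. \<forall>u\<ge>1. \<forall>h\<in>{0..1}. \<forall>n. \<bar>vol r 0 (u + real n * h) - vol r 0 u - real n * (vol r 0 (u + h) - vol r 0 u)\<bar> \<le> real n * (C / u\<^sup>2)"
proof -
  obtain C where C: "C > 0" "\<And>s u h x. s > 0 \<Longrightarrow> u \<ge> 1 \<Longrightarrow> h \<in> {0..1} \<Longrightarrow> 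
     let I = \<integral>\<^sup>+y. emeasure (W x) (newly r (s + u) (s + u + h) y) \<partial>lborel;
     J = \<integral>\<^sup>+z. ennreal (gauss_kernel s x z) * (\<integral>\<^sup>+y. emeasure (W z) (newly r u (u + h) y) \<partial>lborel) \<partial>lborel
     in I \<le> J \<and> J \<le> I + ennreal (C / u\<^sup>2)"
    using newly_compare[of r] by blast
  define d where "d h a = vol r 0 (a + h) - vol r 0 a" for h a
  have d: "d h (s + u) \<le> d h u \<and> d h u \<le> d h (s + u) + C / u\<^sup>2" if s: "s \<ge> 0" and u: "u \<ge> 1" and h: "h \<in> {0..1}" for s u h
  proof (cases "s = 0")
    case False
    then have s: "s > 0" using s by simp
    \<comment> \<open>By translation invariance the inner integral does not depend on
      \<open>z\<close>, and the kernel has total mass 1.\<close>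
    have 1: "(\<integral>\<^sup>+z. ennreal (gauss_kernel s (0::'a) z) * (\<integral>\<^sup>+y. emeasure (W z) (newly r u (u + h) y) \<partial>lborel) \<partial>lborel) = ennreal (d h u)"
    proof -
      have "(\<integral>\<^sup>+z. ennreal (gauss_kernel s (0::'a) z) * (\<integral>\<^sup>+y. emeasure (W z) (newly r u (u + h) y) \<partial>lborel) \<partial>lborel) =
        (\<integral>\<^sup>+z. ennreal (gauss_kernel s (0::'a) z) * ennreal (d h u) \<partial>lborel)"
        using W_newly_translate[of u "u + h" _ r] vol_newly[of u "u + h" 0 r] u h by (simp add: d_def)
      also have "\<dots> = (\<integral>\<^sup>+z. ennreal (gauss_kernel s (0::'a) z) \<partial>lborel) * ennreal (d h u)"
        by (intro nn_integral_multc) measurable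
      finally show ?thesis using p_nn_integral[OF s, of 0] by simp
    qed
    have 2: "(\<integral>\<^sup>+y. emeasure (W 0) (newly r (s + u) (s + u + h) y) \<partial>lborel) = ennreal (d h (s + u))" and p: "0 \<le> d h (s + u)"
      using vol_newly[of "s + u" "s + u + h" 0 r] s u h by (auto simp: d_def)
    have p2: "0 \<le> d h u" using vol_newly[of u "u + h" 0 r] u h by (auto simp: d_def)
    have "ennreal (d h (s + u)) \<le> ennreal (d h u) \<and> ennreal (d h u) \<le> ennreal (d h (s + u)) + ennreal (C / u\<^sup>2)"
      using C(2)[OF s u h, of 0] unfolding Let_def 1 2 .
    then show ?thesis using p p2 C(1) by (simp add: ennreal_plus[symmetric] del: ennreal_plus)
  qed (use C in simp)
  have "\<bar>vol r 0 (u + real n * h) - vol r 0 u - real n * d h u\<bar> \<le> real n * (C / u\<^sup>2)" if u: "u \<ge> 1" and h: "h \<in> {0..1}" for u h n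
  proof (induction n)
    case (Suc n)
    have "\<bar>d h (real n * h + u) - d h u\<bar> \<le> C / u\<^sup>2" using d[of "real n * h" u h] u h by auto
    moreover have "vol r 0 (u + real (Suc n) * h) = vol r 0 (u + real n * h) + d h (real n * h + u)"
      unfolding d_def by (simp add: algebra_simps)
    moreover have "real (Suc n) * (C / u\<^sup>2) = real n * (C / u\<^sup>2) + C / u\<^sup>2" "real (Suc n) * d h u = real n * d h u + d h u"
      by (simp_all only: of_nat_Suc distrib_right mult_1_left add.commute)
    ultimately show ?case using Suc.IH by linarith
  qed simp
  then show ?thesis using C(1) unfolding d_def by blast
qed

end

section \<open>The Newtonian density\<close>

definition newton_density :: "nat \<Rightarrow> real \<Rightarrow> real \<Rightarrow> real" where
  "newton_density d s \<rho> = (2 * pi * s) powr (- real d / 2) * exp (- \<rho>\<^sup>2 / (2 * s))"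

text \<open>The Green function at distance \<open>\<rho>\<close>, restricted to times in
  \<open>A\<close>. For \<open>A = {0<..}\<close> it is the denominator in
  \<open>newton_cap_ball\<close>.\<close>

definition newton_potential :: "nat \<Rightarrow> real set \<Rightarrow> real \<Rightarrow> real" where
  "newton_potential d A \<rho> = (LBINT s:A. newton_density d s \<rho>)"

lemma newton_density_nonneg: "0 \<le> newton_density d s \<rho>"
  unfolding newton_density_def by simp

lemma newton_density_antimono: "0 < s \<Longrightarrow> 0 \<le> \<rho> \<Longrightarrow> \<rho> \<le> \<rho>' \<Longrightarrow> newton_density d s \<rho>' \<le> newton_density d s \<rho>"
  unfolding newton_density_def by (intro mult_left_mono) (auto intro!: divide_right_mono power_mono)

lemma gauss_kernel_newton: "gauss_kernel s x y = newton_density DIM('a) s (dist x (y::'a::euclidean_space))"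
  unfolding gauss_kernel_def newton_density_def ..

lemma newton_density_le_large:
  assumes "6 \<le> d" "1 \<le> s"
  shows "newton_density d s \<rho> \<le> 2 / (1 + s\<^sup>2)"
proof -
  have pi: "1 \<le> 2 * pi" using pi_gt3 by simp
  have ps: "s \<le> 2 * pi * s" using pi assms(2) by simp
  have "(2 * pi * s) powr (- real d / 2) \<le> (2 * pi * s) powr (- 3)"
    using assms order_trans[OF assms(2) ps] by (intro powr_mono) auto
  also have "\<dots> \<le> s powr (- 3)" using ps assms by (intro powr_mono2') auto
  also have "\<dots> = 1 / s ^ 3" using assms(2) powr_realpow[of s 3] by (simp add: powr_minus_divide)
  also have "\<dots> \<le> 1 / s\<^sup>2" using assms(2) by (intro divide_left_mono power_increasing) auto
  also have "\<dots> = 2 / (s\<^sup>2 + s\<^sup>2)" by simp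
  also have "\<dots> \<le> 2 / (1 + s\<^sup>2)" using assms(2) by (intro divide_left_mono add_mono) (auto simp: add_pos_pos)
  finally have a: "(2 * pi * s) powr (- real d / 2) \<le> 2 / (1 + s\<^sup>2)" .
  have "newton_density d s \<rho> \<le> (2 * pi * s) powr (- real d / 2) * 1"
    unfolding newton_density_def using assms by (intro mult_left_mono) auto
  then show ?thesis using a by simp
qed

text \<open>An integrable dominator that is uniform in all radii at least \<open>\<rho>\<close>. For
  small \<open>s\<close> the singularity is beaten by one term of the exponential series, \<open>exp
  (\<rho>\<^sup>2 / (2 * s)) \<ge> (\<rho>\<^sup>2 / (2 * s)) ^ d / fact d\<close>, which is the
  origin of \<open>M1\<close>. The majorant \<open>1 / (1 + s\<^sup>2)\<close> has an elementary
  integral.\<close>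

lemma newton_density_le:
  assumes "6 \<le> d" "0 < \<rho>"
  obtains M where "0 < M" "\<And>s \<rho>'. 0 < s \<Longrightarrow> \<rho> \<le> \<rho>' \<Longrightarrow> newton_density d s \<rho>' \<le> M / (1 + s\<^sup>2)"
proof -
  define M1 where "M1 = fact d * (2 / \<rho>\<^sup>2) ^ d"
  have M1: "M1 > 0" using assms by (simp add: M1_def)
  have "newton_density d s \<rho> \<le> (2 * M1 + 2) / (1 + s\<^sup>2)" if s: "0 < s" for s
  proof (cases "s \<ge> 1")
    case True
    have "newton_density d s \<rho> \<le> 2 / (1 + s\<^sup>2)" by (rule newton_density_le_large[OF assms(1) True])
    also have "\<dots> \<le> (2 * M1 + 2) / (1 + s\<^sup>2)" using M1 by (intro divide_right_mono) auto
    finally show ?thesis .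
  next
    case False
    have "s \<le> 2 * pi * s" using pi_gt3 s by simp
    then have "(2 * pi * s) powr (- real d / 2) \<le> s powr (- real d / 2)" using s by (intro powr_mono2') auto
    also have "\<dots> \<le> s powr (- real d)" using s False by (intro powr_mono') auto
    also have "\<dots> = (1 / s) ^ d" using s by (simp add: powr_minus_divide powr_realpow power_one_over)
    finally have 1: "(2 * pi * s) powr (- real d / 2) \<le> (1 / s) ^ d" .
    have "(\<rho>\<^sup>2 / (2 * s)) ^ d / fact d \<le> exp (\<rho>\<^sup>2 / (2 * s))" using s by (intro power_div_fact_le_exp) auto
    then have "(1 / s) ^ d / M1 \<le> exp (\<rho>\<^sup>2 / (2 * s))"
      unfolding M1_def by (simp add: power_divide power_mult_distrib mult.commute mult.left_commute)
    then have "(1 / s) ^ d \<le> exp (\<rho>\<^sup>2 / (2 * s)) * M1" using M1 by (simp only: pos_divide_le_eq)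
    then have "(1 / s) ^ d * exp (- \<rho>\<^sup>2 / (2 * s)) \<le> exp (\<rho>\<^sup>2 / (2 * s)) * M1 * exp (- \<rho>\<^sup>2 / (2 * s))"
      by (rule mult_right_mono) simp
    also have "\<dots> = (exp (\<rho>\<^sup>2 / (2 * s)) * exp (- \<rho>\<^sup>2 / (2 * s))) * M1" by (simp only: ac_simps)
    also have "\<dots> = M1" by (simp add: exp_add[symmetric])
    finally have 2: "(1 / s) ^ d * exp (- \<rho>\<^sup>2 / (2 * s)) \<le> M1" .
    have "newton_density d s \<rho> \<le> (1 / s) ^ d * exp (- \<rho>\<^sup>2 / (2 * s))"
      unfolding newton_density_def using 1 by (intro mult_right_mono) auto
    also have "\<dots> \<le> M1" by (rule 2)
    also have "\<dots> \<le> (2 * M1 + 2) / (1 + s\<^sup>2)"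
    proof -
      have "s\<^sup>2 \<le> 1" using s False by (simp add: power_le_one)
      then have "M1 * (1 + s\<^sup>2) \<le> M1 * 2" using M1 by (intro mult_left_mono) auto
      moreover have "0 < 1 + s\<^sup>2" by (simp add: add_pos_nonneg)
      ultimately show ?thesis by (simp add: pos_le_divide_eq)
    qed
    finally show ?thesis .
  qed
  then have "newton_density d s \<rho>' \<le> (2 * M1 + 2) / (1 + s\<^sup>2)" if "0 < s" "\<rho> \<le> \<rho>'" for s \<rho>'
    using newton_density_antimono[of s \<rho> \<rho>' d] that assms(2) by (meson less_imp_le order_trans)
  moreover have "0 < 2 * M1 + 2" using M1 by simp
  ultimately show ?thesis using that by blast
qed

lemma newton_density_measurable [measurable]: "(\<lambda>s. newton_density d s \<rho>) \<in> borel_measurable borel"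
  unfolding newton_density_def by measurable

lemma integrable_dominator: "integrable lborel (\<lambda>s. indicator {0<..} s * (M / (1 + s\<^sup>2)) :: real)"
proof -
  have "einterval 0 \<infinity> = {0<..}" unfolding zero_ereal_def by (rule einterval_eq_Ici)
  then have "integrable lborel (\<lambda>s. indicator {0<..} s * (1 / (1 + s\<^sup>2)) :: real)"
    using integrable_I0i_1_div_plus_square unfolding interval_lebesgue_integrable_def set_integrable_def by simp
  from integrable_mult_right[OF this, of M] show ?thesis by (simp add: algebra_simps)
qed

lemma newton_density_integrable:
  assumes "6 \<le> d" "0 < \<rho>" "A \<in> sets borel" "A \<subseteq> {0<..}"
  shows "integrable lborel (\<lambda>s. indicator A s * newton_density d s \<rho>)"
proof -
  obtain M where M: "0 < M" "\<And>s \<rho>'. 0 < s \<Longrightarrow> \<rho> \<le> \<rho>' \<Longrightarrow> newton_density d s \<rho>' \<le> M / (1 + s\<^sup>2)"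
    using newton_density_le[OF assms(1,2)] by blast
  have [measurable]: "A \<in> sets borel" by fact
  show ?thesis
  proof (rule Bochner_Integration.integrable_bound[OF integrable_dominator[of M]])
    show "AE s in lborel. norm (indicator A s * newton_density d s \<rho>) \<le> norm (indicator {0<..} s * (M / (1 + s\<^sup>2)))"
      using M(2)[of _ \<rho>] M(1) assms(4) newton_density_nonneg[of d _ \<rho>]
      by (intro AE_I2) (auto simp: indicator_def abs_mult dest!: subsetD)
  qed measurable
qed

lemma nn_integral_newton:
  assumes "6 \<le> d" "0 < \<rho>" "A \<in> sets borel" "A \<subseteq> {0<..}"
  shows "(\<integral>\<^sup>+s. indicator A s * ennreal (newton_density d s \<rho>) \<partial>lborel) = ennreal (newton_potential d A \<rho>)"
proof -
  have "(\<integral>\<^sup>+s. indicator A s * ennreal (newton_density d s \<rho>) \<partial>lborel) = (\<integral>\<^sup>+s. ennreal (indicator A s * newton_density d s \<rho>) \<partial>lborel)"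
    by (intro nn_integral_cong) (auto simp: indicator_def)
  also have "\<dots> = ennreal (newton_potential d A \<rho>)"
    unfolding newton_potential_def set_lebesgue_integral_def real_scaleR_def
    by (intro nn_integral_eq_integral newton_density_integrable assms) (auto simp: newton_density_nonneg)
  finally show ?thesis .
qed

lemma newton_potential_nonneg: "0 \<le> newton_potential d A \<rho>"
  unfolding newton_potential_def set_lebesgue_integral_def by (intro integral_nonneg_AE AE_I2) (auto simp: newton_density_nonneg)

text \<open>Dominated convergence with radius and time window varying together. Radii stay above
  \<open>\<rho> / 2\<close>, so one dominator works. It removes the auxiliary ball and the time
  truncation from the capacity bounds.\<close>

lemma newton_potential_tendsto:
  assumes d: "6 \<le> d" and \<rho>: "0 < \<rho>" and r: "\<rho> / 2 \<le> r" and lim: "(\<lambda>n. r' n) \<longlonglongrightarrow> r" and r': "\<And>n. \<rho> / 2 \<le> r' n"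
    and A: "\<And>n. A n \<in> sets borel" "\<And>n. A n \<subseteq> {0<..}" "\<And>s. 0 < s \<Longrightarrow> eventually (\<lambda>n. s \<in> A n) sequentially"
  shows "(\<lambda>n. newton_potential d (A n) (r' n)) \<longlonglongrightarrow> newton_potential d {0<..} r"
proof -
  obtain M where M: "0 < M" "\<And>s \<rho>'. 0 < s \<Longrightarrow> \<rho> / 2 \<le> \<rho>' \<Longrightarrow> newton_density d s \<rho>' \<le> M / (1 + s\<^sup>2)"
    using newton_density_le[OF d, of "\<rho> / 2"] \<rho> by auto
  have [measurable]: "A n \<in> sets borel" for n by fact
  have "(\<lambda>n. \<integral>s. indicator (A n) s * newton_density d s (r' n) \<partial>lborel) \<longlonglongrightarrow> (\<integral>s. indicator {0<..} s * newton_density d s r \<partial>lborel)"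
  proof (rule integral_dominated_convergence[where w="\<lambda>s. indicator {0<..} s * (M / (1 + s\<^sup>2))"])
    show "integrable lborel (\<lambda>s. indicator {0<..} s * (M / (1 + s\<^sup>2)) :: real)" by (rule integrable_dominator)
    show "AE s in lborel. (\<lambda>n. indicator (A n) s * newton_density d s (r' n)) \<longlonglongrightarrow> indicator {0<..} s * newton_density d s r"
    proof (intro AE_I2)
      fix s :: real
      show "(\<lambda>n. indicator (A n) s * newton_density d s (r' n)) \<longlonglongrightarrow> indicator {0<..} s * newton_density d s r"
      proof (cases "0 < s")
        case True
        have "(\<lambda>n. newton_density d s (r' n)) \<longlonglongrightarrow> newton_density d s r"
          unfolding newton_density_def using True by (intro tendsto_intros lim) auto
        then show ?thesis using True A(3)[OF True]
          by (auto elim!: Lim_transform_eventually eventually_mono)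
      next
        case False
        then have "s \<notin> A n" for n using A(2)[of n] by auto
        then show ?thesis using False by simp
      qed
    qed
    show "AE s in lborel. norm (indicator (A n) s * newton_density d s (r' n)) \<le> indicator {0<..} s * (M / (1 + s\<^sup>2))" for n
      using M(2)[of _ "r' n"] M(1) r'[of n] A(2)[of n] newton_density_nonneg[of d _ "r' n"]
      by (intro AE_I2) (auto simp: indicator_def abs_mult dest!: subsetD)
  qed measurable
  then show ?thesis unfolding newton_potential_def set_lebesgue_integral_def by simp
qed

section \<open>Occupation times\<close>

text \<open>Joint measurability of a continuous process: rounding time down to multiples of
  \<open>1 / (n + 1)\<close> leaves countably many values, and continuity gives the limit.\<close>

lemma path_eval_measurable:
  "(\<lambda>z. fst z (snd z)) \<in> (path_space :: (real \<Rightarrow> 'a::euclidean_space) measure) \<Otimes>\<^sub>M borel \<rightarrow>\<^sub>M borel"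
proof (rule borel_measurable_LIMSEQ_metric)
  fix n :: nat
  show "(\<lambda>z. fst z (of_int \<lfloor>real (Suc n) * snd z\<rfloor> / real (Suc n))) \<in> (path_space :: (real \<Rightarrow> 'a) measure) \<Otimes>\<^sub>M borel \<rightarrow>\<^sub>M borel"
  proof (rule measurable_compose_countable[where f="\<lambda>i z. fst z (of_int i / real (Suc n))" and g="\<lambda>z. \<lfloor>real (Suc n) * snd z\<rfloor>"])
    show "(\<lambda>z. fst z (of_int i / real (Suc n))) \<in> (path_space :: (real \<Rightarrow> 'a) measure) \<Otimes>\<^sub>M borel \<rightarrow>\<^sub>M borel" for i
      by (rule measurable_compose[OF measurable_fst measurable_path_coord])
    show "(\<lambda>z. \<lfloor>real (Suc n) * snd z\<rfloor>) \<in> (path_space :: (real \<Rightarrow> 'a) measure) \<Otimes>\<^sub>M borel \<rightarrow>\<^sub>M count_space UNIV" by measurable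
  qed
next
  fix z :: "(real \<Rightarrow> 'a) \<times> real" assume "z \<in> space (path_space \<Otimes>\<^sub>M borel)"
  then have w: "fst z \<in> cpaths" by (auto simp: space_pair_measure)
  have "(\<lambda>n. of_int \<lfloor>real (Suc n) * snd z\<rfloor> / real (Suc n)) \<longlonglongrightarrow> snd z"
  proof (rule tendsto_sandwich[of "\<lambda>n. snd z - 1 / real (Suc n)" _ _ "\<lambda>n. snd z"])
    have "(\<lambda>n. snd z - inverse (real (Suc n))) \<longlonglongrightarrow> snd z - 0" by (intro tendsto_intros LIMSEQ_inverse_real_of_nat)
    then show "(\<lambda>n. snd z - 1 / real (Suc n)) \<longlonglongrightarrow> snd z" by (simp add: inverse_eq_divide)
    show "\<forall>\<^sub>F n in sequentially. snd z - 1 / real (Suc n) \<le> of_int \<lfloor>real (Suc n) * snd z\<rfloor> / real (Suc n)"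
    proof (intro always_eventually allI)
      fix n
      have "snd z - 1 / real (Suc n) = (real (Suc n) * snd z - 1) / real (Suc n)" by (simp add: diff_divide_distrib)
      also have "\<dots> \<le> of_int \<lfloor>real (Suc n) * snd z\<rfloor> / real (Suc n)" by (intro divide_right_mono) linarith+
      finally show "snd z - 1 / real (Suc n) \<le> of_int \<lfloor>real (Suc n) * snd z\<rfloor> / real (Suc n)" .
    qed
    have "of_int \<lfloor>real (Suc n) * snd z\<rfloor> \<le> real (Suc n) * snd z" for n by linarith
    then show "\<forall>\<^sub>F n in sequentially. of_int \<lfloor>real (Suc n) * snd z\<rfloor> / real (Suc n) \<le> snd z"
      by (intro always_eventually allI) (simp add: pos_divide_le_eq mult.commute)
  qed simp
  then show "(\<lambda>n. fst z (of_int \<lfloor>real (Suc n) * snd z\<rfloor> / real (Suc n))) \<longlonglongrightarrow> fst z (snd z)"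
    using cpaths_cont[OF w, of UNIV] by (intro continuous_on_tendsto_compose[of UNIV "fst z"]) auto
qed

context kernel_process
begin

lemma measurable_occupation:
  assumes E: "mfam E"
  shows "(\<lambda>z. emeasure (P x) (E (snd z) \<inter> {\<omega>\<in>cpaths. \<omega> (fst z) \<in> ball (snd z) \<delta>})) \<in> borel_measurable (borel \<Otimes>\<^sub>M borel)"
proof (rule emeasure_measurable_subprob_algebra2[where N=path_space])
  let ?B = "(borel :: real measure) \<Otimes>\<^sub>M (borel :: 'a measure)"
  show "(\<lambda>z. P x) \<in> ?B \<rightarrow>\<^sub>M subprob_algebra path_space"
    using measurable_compose[OF measurable_const P_measurable_subprob, of x] by simp
  have 1: "Measurable.pred (?B \<Otimes>\<^sub>M path_space) (\<lambda>z. snd z \<in> E (snd (fst z)))"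
  proof -
    have "(\<lambda>z. (snd z, snd (fst z))) \<in> ?B \<Otimes>\<^sub>M path_space \<rightarrow>\<^sub>M (path_space :: (real \<Rightarrow> 'a) measure) \<Otimes>\<^sub>M borel" by measurable
    from measurable_compose[OF this mfam_pred[OF E]] show ?thesis by simp
  qed
  have e: "(\<lambda>z. snd z (fst (fst z))) \<in> ?B \<Otimes>\<^sub>M (path_space :: (real \<Rightarrow> 'a) measure) \<rightarrow>\<^sub>M borel"
  proof -
    have "(\<lambda>z. (snd z, fst (fst z))) \<in> ?B \<Otimes>\<^sub>M path_space \<rightarrow>\<^sub>M (path_space :: (real \<Rightarrow> 'a) measure) \<Otimes>\<^sub>M borel" by measurable
    from measurable_compose[OF this path_eval_measurable] show ?thesis by simp
  qed
  have 2: "Measurable.pred (?B \<Otimes>\<^sub>M path_space) (\<lambda>z. dist (snd (fst z)) (snd z (fst (fst z))) < \<delta>)"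
    using e by measurable
  have "{z \<in> space (?B \<Otimes>\<^sub>M path_space). snd z \<in> E (snd (fst z)) \<and> dist (snd (fst z)) (snd z (fst (fst z))) < \<delta>} \<in> sets (?B \<Otimes>\<^sub>M path_space)"
  proof -
    note [measurable] = 1 2
    show ?thesis by measurable
  qed
  moreover have "{z \<in> space (?B \<Otimes>\<^sub>M path_space). snd z \<in> E (snd (fst z)) \<and> dist (snd (fst z)) (snd z (fst (fst z))) < \<delta>} =
    (SIGMA z:space ?B. E (snd z) \<inter> {\<omega>\<in>cpaths. \<omega> (fst z) \<in> ball (snd z) \<delta>})"
    by (auto simp: space_pair_measure)
  ultimately show "(SIGMA z:space ?B. E (snd z) \<inter> {\<omega>\<in>cpaths. \<omega> (fst z) \<in> ball (snd z) \<delta>}) \<in> sets (?B \<Otimes>\<^sub>M path_space)" by (simp only:)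
qed

lemma measurable_occupation1:
  assumes "E \<in> sets path_space"
  shows "(\<lambda>s. emeasure (P x) (E \<inter> {\<omega>\<in>cpaths. \<omega> s \<in> ball y \<delta>})) \<in> borel_measurable borel"
proof -
  have "(\<lambda>s. (s, y)) \<in> borel \<rightarrow>\<^sub>M (borel :: real measure) \<Otimes>\<^sub>M (borel :: 'a measure)" by simp
  from measurable_compose[OF this measurable_occupation[OF mfam_const[OF assms]]] show ?thesis by simp
qed

lemma mfam_first_hit: "mfam (\<lambda>y. first_hit \<tau> (ball y r) k)"
proof (rule mfamI)
  note [measurable] = measurable_path_coord
  have "Measurable.pred (path_space \<Otimes>\<^sub>M borel) (\<lambda>z::(real \<Rightarrow> 'a) \<times> 'a. dist (snd z) (fst z (\<tau> k)) < r \<and> (\<forall>j\<in>{1..<k}. \<not> dist (snd z) (fst z (\<tau> j)) < r))"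
    by measurable
  then show "Measurable.pred (path_space \<Otimes>\<^sub>M borel) (\<lambda>z::(real \<Rightarrow> 'a) \<times> 'a. fst z \<in> first_hit \<tau> (ball (snd z) r) k)"
    by (rule measurable_cong[THEN iffD1, rotated]) (auto simp: space_pair_measure first_hit_def)
qed (auto simp: first_hit_def)

lemma shift_coord:
  assumes "0 \<le> a" "0 \<le> s" "E \<subseteq> cpaths"
  shows "E \<inter> {\<omega>\<in>cpaths. shift_path a \<omega> \<in> {\<omega>\<in>cpaths. \<omega> s \<in> A}} = E \<inter> {\<omega>\<in>cpaths. \<omega> (s + a) \<in> A}"
  using assms by (auto simp: shift_path_cpaths) (auto simp: shift_path_def max_absorb1 add.commute)

text \<open>The Markov property at \<open>a\<close> for each later instant, integrated over time
  after the substitution of \<open>s + a\<close> for \<open>s\<close>.\<close>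

lemma occupation_ge:
  assumes E: "adapted a E" and a: "0 < a" and EB: "\<And>\<omega>. \<omega> \<in> E \<Longrightarrow> \<omega> a \<in> B"
    and f [measurable]: "f \<in> borel_measurable borel"
    and ge: "\<And>s w. s \<in> {0<..K} \<Longrightarrow> w \<in> B \<Longrightarrow> f s \<le> emeasure (P w) {\<omega>\<in>cpaths. \<omega> s \<in> ball y \<delta>}"
  shows "(\<integral>\<^sup>+s. indicator {0<..K} s * f s \<partial>lborel) * emeasure (P x) E \<le> (\<integral>\<^sup>+s. indicator {a<..a + K} s * emeasure (P x) (E \<inter> {\<omega>\<in>cpaths. \<omega> s \<in> ball y \<delta>}) \<partial>lborel)"
proof -
  have Es: "E \<in> sets path_space" using E by (simp add: adapted_def)
  then have Ec: "E \<subseteq> cpaths" using sets.sets_into_space[OF Es] by simp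
  note [measurable] = measurable_occupation1[OF Es]
  have "(\<integral>\<^sup>+s. indicator {0<..K} s * f s \<partial>lborel) * emeasure (P x) E = (\<integral>\<^sup>+s. indicator {0<..K} s * f s * emeasure (P x) E \<partial>lborel)"
    by (intro nn_integral_multc[symmetric]) measurable
  also have "\<dots> \<le> (\<integral>\<^sup>+s. indicator {a<..a + K} (s + a) * emeasure (P x) (E \<inter> {\<omega>\<in>cpaths. \<omega> (s + a) \<in> ball y \<delta>}) \<partial>lborel)"
  proof (intro nn_integral_mono)
    fix s :: real
    show "indicator {0<..K} s * f s * emeasure (P x) E \<le> indicator {a<..a + K} (s + a) * emeasure (P x) (E \<inter> {\<omega>\<in>cpaths. \<omega> (s + a) \<in> ball y \<delta>})"
    proof (cases "s \<in> {0<..K}")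
      case True
      have "f s * emeasure (P x) E \<le> emeasure (P x) (E \<inter> {\<omega>\<in>cpaths. shift_path a \<omega> \<in> {\<omega>\<in>cpaths. \<omega> s \<in> ball y \<delta>}})"
        by (rule markov_ge[OF E _ a, where B=B]) (use EB ge[OF True] coord_sets[of "ball y \<delta>" s] in simp_all)
      also have "\<dots> = emeasure (P x) (E \<inter> {\<omega>\<in>cpaths. \<omega> (s + a) \<in> ball y \<delta>})"
        using True a Ec by (subst shift_coord) auto
      finally show ?thesis using True by simp
    qed simp
  qed
  also have "\<dots> = (\<integral>\<^sup>+s. indicator {a<..a + K} s * emeasure (P x) (E \<inter> {\<omega>\<in>cpaths. \<omega> s \<in> ball y \<delta>}) \<partial>lborel)"
    by (rule nn_integral_lborel_translate) measurable
  finally show ?thesis .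
qed

lemma occupation_le:
  assumes E: "adapted a E" and a: "0 < a" and EB: "\<And>\<omega>. \<omega> \<in> E \<Longrightarrow> \<omega> a \<in> B"
    and f [measurable]: "f \<in> borel_measurable borel"
    and le: "\<And>s w. 0 < s \<Longrightarrow> w \<in> B \<Longrightarrow> emeasure (P w) {\<omega>\<in>cpaths. \<omega> s \<in> ball y \<delta>} \<le> f s"
  shows "(\<integral>\<^sup>+s. indicator {a<..} s * emeasure (P x) (E \<inter> {\<omega>\<in>cpaths. \<omega> s \<in> ball y \<delta>}) \<partial>lborel) \<le> (\<integral>\<^sup>+s. indicator {0<..} s * f s \<partial>lborel) * emeasure (P x) E"
proof -
  have Es: "E \<in> sets path_space" using E by (simp add: adapted_def)
  then have Ec: "E \<subseteq> cpaths" using sets.sets_into_space[OF Es] by simp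
  note [measurable] = measurable_occupation1[OF Es]
  have "(\<integral>\<^sup>+s. indicator {a<..} s * emeasure (P x) (E \<inter> {\<omega>\<in>cpaths. \<omega> s \<in> ball y \<delta>}) \<partial>lborel) =
    (\<integral>\<^sup>+s. indicator {a<..} (s + a) * emeasure (P x) (E \<inter> {\<omega>\<in>cpaths. \<omega> (s + a) \<in> ball y \<delta>}) \<partial>lborel)"
    by (rule nn_integral_lborel_translate[symmetric]) measurable
  also have "\<dots> \<le> (\<integral>\<^sup>+s. indicator {0<..} s * f s * emeasure (P x) E \<partial>lborel)"
  proof (intro nn_integral_mono)
    fix s :: real
    show "indicator {a<..} (s + a) * emeasure (P x) (E \<inter> {\<omega>\<in>cpaths. \<omega> (s + a) \<in> ball y \<delta>}) \<le> indicator {0<..} s * f s * emeasure (P x) E"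
    proof (cases "0 < s")
      case True
      have "emeasure (P x) (E \<inter> {\<omega>\<in>cpaths. shift_path a \<omega> \<in> {\<omega>\<in>cpaths. \<omega> s \<in> ball y \<delta>}}) \<le> f s * emeasure (P x) E"
        by (rule markov_le[OF E _ a, where B=B]) (use EB le[OF True] coord_sets[of "ball y \<delta>" s] in simp_all)
      moreover have "E \<inter> {\<omega>\<in>cpaths. shift_path a \<omega> \<in> {\<omega>\<in>cpaths. \<omega> s \<in> ball y \<delta>}} = E \<inter> {\<omega>\<in>cpaths. \<omega> (s + a) \<in> ball y \<delta>}"
        using True a Ec by (intro shift_coord) auto
      ultimately show ?thesis using True by (simp only: indicator_simps) simp
    qed simp
  qed
  also have "\<dots> = (\<integral>\<^sup>+s. indicator {0<..} s * f s \<partial>lborel) * emeasure (P x) E"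
    by (intro nn_integral_multc) measurable
  finally show ?thesis .
qed

end

section \<open>The growth rate of the Wiener sausage\<close>

context brownian
begin

definition bv :: "real \<Rightarrow> real" where "bv r = unit_ball_vol (real DIM('a)) * r ^ DIM('a)"

lemma bv_pos: "0 < r \<Longrightarrow> 0 < bv r" unfolding bv_def by simp

lemma emeasure_ball_bv: "0 \<le> r \<Longrightarrow> emeasure lborel (ball (y::'a) r) = ennreal (bv r)"
  unfolding bv_def by (rule emeasure_ball)

text \<open>For a fixed path the centres \<open>y\<close> whose ball contains
  \<open>\<omega> s\<close> form a ball around \<open>\<omega> s\<close>, whose Lebesgue measure
  does not depend on the path.\<close>

lemma volume_const:
  assumes O: "O' \<in> sets path_space" and r: "0 \<le> r"
  shows "(\<integral>\<^sup>+y. emeasure (W x) (O' \<inter> {\<omega>\<in>cpaths. \<omega> s \<in> ball y r}) \<partial>lborel) = ennreal (bv r) * emeasure (W x) O'"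
proof -
  have "mfam (\<lambda>y. O' \<inter> {\<omega>\<in>cpaths. \<omega> s \<in> ball y r})" by (intro mfam_Int mfam_const O mfam_coord_ball)
  then have "(\<integral>\<^sup>+y. emeasure (W x) (O' \<inter> {\<omega>\<in>cpaths. \<omega> s \<in> ball y r}) \<partial>lborel) = (\<integral>\<^sup>+\<omega>. emeasure lborel {y. \<omega> \<in> O' \<inter> {\<omega>\<in>cpaths. \<omega> s \<in> ball y r}} \<partial>W x)"
    by (intro nn_integral_mfam_swap sigma_finite_lborel) auto
  also have "\<dots> = (\<integral>\<^sup>+\<omega>. ennreal (bv r) * indicator O' \<omega> \<partial>W x)"
  proof (intro nn_integral_cong)
    fix \<omega> assume w: "\<omega> \<in> space (W x)"
    show "emeasure lborel {y. \<omega> \<in> O' \<inter> {\<omega>\<in>cpaths. \<omega> s \<in> ball y r}} = ennreal (bv r) * indicator O' \<omega>"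
    proof (cases "\<omega> \<in> O'")
      case True
      then have "{y. \<omega> \<in> O' \<inter> {\<omega>\<in>cpaths. \<omega> s \<in> ball y r}} = ball (\<omega> s) r" using w by (auto simp: dist_commute)
      then show ?thesis using True emeasure_ball_bv[OF r, of "\<omega> s"] by simp
    qed simp
  qed
  also have "\<dots> = ennreal (bv r) * emeasure (W x) O'" using O by (simp add: nn_integral_cmult_indicator)
  finally show ?thesis .
qed

lemma W_ball_ge:
  assumes "0 < s" "0 < \<delta>" "0 \<le> r" "dist w y < r"
  shows "ennreal (bv \<delta> * newton_density DIM('a) s (r + \<delta>)) \<le> emeasure (W w) {\<omega>\<in>cpaths. \<omega> s \<in> ball y \<delta>}"
proof -
  have "ennreal (bv \<delta> * newton_density DIM('a) s (r + \<delta>)) = ennreal (newton_density DIM('a) s (r + \<delta>)) * emeasure lborel (ball y \<delta>)"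
    using assms bv_pos[of \<delta>] emeasure_ball_bv[of \<delta> y] by (simp add: ennreal_mult' mult.commute)
  also have "\<dots> = (\<integral>\<^sup>+z. ennreal (newton_density DIM('a) s (r + \<delta>)) * indicator (ball y \<delta>) z \<partial>lborel)"
    by (simp add: nn_integral_cmult_indicator)
  also have "\<dots> \<le> (\<integral>\<^sup>+z. ennreal (gauss_kernel s w z) * indicator (ball y \<delta>) z \<partial>lborel)"
  proof (intro nn_integral_mono)
    fix z
    have "newton_density DIM('a) s (r + \<delta>) \<le> gauss_kernel s w z" if "z \<in> ball y \<delta>"
      unfolding gauss_kernel_newton using dist_triangle[of w z y] that assms by (intro newton_density_antimono) auto
    then show "ennreal (newton_density DIM('a) s (r + \<delta>)) * indicator (ball y \<delta>) z \<le> ennreal (gauss_kernel s w z) * indicator (ball y \<delta>) z"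
      by (auto split: split_indicator intro!: ennreal_leI)
  qed
  also have "\<dots> = emeasure (W w) {\<omega>\<in>cpaths. \<omega> s \<in> ball y \<delta>}"
    using assms by (intro emeasure_coord[symmetric]) auto
  finally show ?thesis .
qed

text \<open>The kernel decreases with distance. The alternative \<open>r = 0\<close> covers starting
  points without any restriction, at the price of the kernel's maximum.\<close>

lemma W_ball_le:
  assumes "0 < s" "0 < \<delta>" "0 \<le> r" "r + \<delta> \<le> dist w y \<or> r = 0"
  shows "emeasure (W w) {\<omega>\<in>cpaths. \<omega> s \<in> ball y \<delta>} \<le> ennreal (bv \<delta> * newton_density DIM('a) s r)"
proof -
  have "emeasure (W w) {\<omega>\<in>cpaths. \<omega> s \<in> ball y \<delta>} = (\<integral>\<^sup>+z. ennreal (gauss_kernel s w z) * indicator (ball y \<delta>) z \<partial>lborel)"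
    using assms by (intro emeasure_coord) auto
  also have "\<dots> \<le> (\<integral>\<^sup>+z. ennreal (newton_density DIM('a) s r) * indicator (ball y \<delta>) z \<partial>lborel)"
  proof (intro nn_integral_mono)
    fix z
    have "gauss_kernel s w z \<le> newton_density DIM('a) s r" if "z \<in> ball y \<delta>"
      unfolding gauss_kernel_newton using dist_triangle[of w y z] that assms 
      by (intro newton_density_antimono) (auto simp: dist_commute)
    then show "ennreal (gauss_kernel s w z) * indicator (ball y \<delta>) z \<le> ennreal (newton_density DIM('a) s r) * indicator (ball y \<delta>) z"
      by (auto split: split_indicator intro!: ennreal_leI)
  qed
  also have "\<dots> = ennreal (newton_density DIM('a) s r) * emeasure lborel (ball y \<delta>)"
    by (simp add: nn_integral_cmult_indicator)
  also have "\<dots> = ennreal (bv \<delta> * newton_density DIM('a) s r)"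
    using assms bv_pos[of \<delta>] emeasure_ball_bv[of \<delta> y] by (simp add: ennreal_mult' mult.commute)
  finally show ?thesis .
qed

text \<open>Kernel decay for \<open>s \<ge> 1\<close>, the trivial bound 1 before. It makes the
  expected occupation time of a ball finite, uniformly in the starting point.\<close>

lemma W_ball_le_integrable:
  assumes "0 < s" "0 < \<delta>"
  shows "emeasure (W w) {\<omega>\<in>cpaths. \<omega> s \<in> ball y \<delta>} \<le> ennreal ((2 * bv \<delta> + 2) / (1 + s\<^sup>2))"
proof (cases "1 \<le> s")
  case True
  have "bv \<delta> * newton_density DIM('a) s 0 \<le> bv \<delta> * (2 / (1 + s\<^sup>2))"
    using newton_density_le_large[OF dim True, of 0] bv_pos[OF assms(2)] by (intro mult_left_mono) auto
  also have "\<dots> \<le> (2 * bv \<delta> + 2) / (1 + s\<^sup>2)" by (simp add: divide_right_mono)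
  finally show ?thesis using W_ball_le[of s \<delta> 0 w y] assms by (auto intro: order_trans ennreal_leI)
next
  case False
  then have "s\<^sup>2 \<le> 1" using assms by (simp add: power_le_one)
  then have "1 \<le> 2 / (1 + s\<^sup>2)" by (simp add: pos_le_divide_eq add_pos_nonneg)
  also have "\<dots> \<le> (2 * bv \<delta> + 2) / (1 + s\<^sup>2)" using bv_pos[OF assms(2)] by (simp add: divide_right_mono)
  finally have "ennreal 1 \<le> ennreal ((2 * bv \<delta> + 2) / (1 + s\<^sup>2))" by (rule ennreal_leI)
  then show ?thesis using P.emeasure_space_1 emeasure_space[of "W w" "{\<omega>\<in>cpaths. \<omega> s \<in> ball y \<delta>}"] by (auto intro: order_trans)
qed

text \<open>Half of the exponent is spent on the distance: beyond \<open>2 * \<delta>\<close> it is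
  at most \<open>- \<delta>\<^sup>2 / s\<close>. The other half is the exponent of the kernel at
  time \<open>2 * s\<close>, whose mass is 1; the change of the normalising factor gives
  \<open>2 powr (d/2)\<close>.\<close>

lemma W_start_tail:
  assumes "0 < s" "0 < \<delta>"
  shows "emeasure (W w) {\<omega>\<in>cpaths. 2 * \<delta> < dist (\<omega> s) (\<omega> 0)} \<le> ennreal (2 powr (real DIM('a) / 2) * exp (- \<delta>\<^sup>2 / s))"
proof -
  let ?A = "{z. 2 * \<delta> < dist z w}" and ?c = "2 powr (real DIM('a) / 2) * exp (- \<delta>\<^sup>2 / s)"
  have A: "?A \<in> sets borel" by (intro borel_open open_Collect_less continuous_intros)
  have "emeasure (W w) {\<omega>\<in>cpaths. 2 * \<delta> < dist (\<omega> s) (\<omega> 0)} \<le> emeasure (W w) {\<omega>\<in>cpaths. \<omega> s \<in> ?A}"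
  proof (rule emeasure_mono_AE)
    show "AE \<omega> in W w. \<omega> \<in> {\<omega>\<in>cpaths. 2 * \<delta> < dist (\<omega> s) (\<omega> 0)} \<longrightarrow> \<omega> \<in> {\<omega>\<in>cpaths. \<omega> s \<in> ?A}"
      using P_start[of w] by eventually_elim auto
    show "{\<omega>\<in>cpaths. \<omega> s \<in> ?A} \<in> sets (W w)" using coord_sets[OF A] by simp
  qed
  also have "\<dots> = (\<integral>\<^sup>+z. ennreal (gauss_kernel s w z) * indicator ?A z \<partial>lborel)"
    by (rule emeasure_coord[OF assms(1) A])
  also have "\<dots> \<le> (\<integral>\<^sup>+z. ennreal ?c * ennreal (gauss_kernel (2 * s) w z) \<partial>lborel)"
  proof (intro nn_integral_mono)
    fix z
    have "gauss_kernel s w z \<le> ?c * gauss_kernel (2 * s) w z" if z: "z \<in> ?A"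
    proof -
      have "(2 * \<delta>)\<^sup>2 \<le> (dist w z)\<^sup>2" using z assms by (intro power_mono) (auto simp: dist_commute)
      then have "- (dist w z)\<^sup>2 / (4 * s) \<le> - \<delta>\<^sup>2 / s" using assms by (simp add: field_simps)
      moreover have "- (dist w z)\<^sup>2 / (2 * s) = - (dist w z)\<^sup>2 / (4 * s) + - (dist w z)\<^sup>2 / (2 * (2 * s))" using assms by (simp add: field_simps)
      ultimately have e: "exp (- (dist w z)\<^sup>2 / (2 * s)) \<le> exp (- \<delta>\<^sup>2 / s) * exp (- (dist w z)\<^sup>2 / (2 * (2 * s)))"
        unfolding exp_add[symmetric] exp_le_cancel_iff by linarith
      have "(2 * pi * (2 * s)) powr (- real DIM('a) / 2) = 2 powr (- real DIM('a) / 2) * (2 * pi * s) powr (- real DIM('a) / 2)"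
        using assms powr_mult[of 2 "2 * pi * s" "- real DIM('a) / 2"] by (simp add: mult_ac)
      then have eq: "2 powr (real DIM('a) / 2) * (2 * pi * (2 * s)) powr (- real DIM('a) / 2) = (2 * pi * s) powr (- real DIM('a) / 2)"
        by (simp add: powr_minus field_simps)
      have "?c * gauss_kernel (2 * s) w z = (2 * pi * s) powr (- real DIM('a) / 2) * (exp (- \<delta>\<^sup>2 / s) * exp (- (dist w z)\<^sup>2 / (2 * (2 * s))))"
        unfolding gauss_kernel_def eq[symmetric] by (simp only: ac_simps)
      then show ?thesis unfolding gauss_kernel_def[of s] using e by (simp only:) (intro mult_left_mono, auto)
    qed
    then show "ennreal (gauss_kernel s w z) * indicator ?A z \<le> ennreal ?c * ennreal (gauss_kernel (2 * s) w z)"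
      using assms by (auto split: split_indicator intro!: ennreal_leI simp: ennreal_mult'[symmetric])
  qed
  also have "\<dots> = ennreal ?c * (\<integral>\<^sup>+z. ennreal (gauss_kernel (2 * s) w z) \<partial>lborel)"
    by (intro nn_integral_cmult) measurable
  also have "\<dots> = ennreal ?c" using assms by (simp add: p_nn_integral)
  finally show ?thesis .
qed

lemma oscillation_sets: "{\<omega>\<in>cpaths. c < dist (\<omega> s) (\<omega> t :: 'a)} \<in> sets path_space"
proof -
  note [measurable] = measurable_path_coord
  have "{\<omega>\<in>space path_space. c < dist (\<omega> s) (\<omega> t :: 'a)} \<in> sets path_space" by measurable
  then show ?thesis by simp
qed

lemma W_oscillation:
  assumes "0 < a" "a < s" "s \<le> a + \<eta>" "0 < \<delta>"
  shows "emeasure (W x) {\<omega>\<in>cpaths. 2 * \<delta> < dist (\<omega> s) (\<omega> a)} \<le> ennreal (2 powr (real DIM('a) / 2) * exp (- \<delta>\<^sup>2 / \<eta>))"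
proof -
  let ?F = "{\<omega>\<in>cpaths. 2 * \<delta> < dist (\<omega> (s - a)) (\<omega> 0 :: 'a)}"
  have "{\<omega>\<in>cpaths. 2 * \<delta> < dist (\<omega> s) (\<omega> a)} = cpaths \<inter> {\<omega>\<in>cpaths. shift_path a \<omega> \<in> ?F}"
    using assms by (auto simp: shift_path_cpaths shift_path_def max_absorb1)
  also have "emeasure (W x) \<dots> \<le> ennreal (2 powr (real DIM('a) / 2) * exp (- \<delta>\<^sup>2 / \<eta>)) * emeasure (W x) cpaths"
  proof (rule markov_le[where B=UNIV])
    fix w
    have "\<delta>\<^sup>2 / \<eta> \<le> \<delta>\<^sup>2 / (s - a)" using assms by (intro divide_left_mono) auto
    then show "emeasure (W w) ?F \<le> ennreal (2 powr (real DIM('a) / 2) * exp (- \<delta>\<^sup>2 / \<eta>))"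
      using assms W_start_tail[of "s - a" \<delta> w] by (auto intro!: order_trans[OF W_start_tail] ennreal_leI)
  qed (use assms adapted_cpaths[of a, where 'a='a] oscillation_sets in auto)
  finally show ?thesis using P.emeasure_space_1[of x] by simp
qed

lemma sum_first_hit_Int:
  assumes "B \<in> sets borel" "A \<in> sets path_space" "\<And>k. k \<in> {1..N} \<Longrightarrow> 0 \<le> \<tau> k" "\<And>j k. j < k \<Longrightarrow> \<tau> j \<le> \<tau> k" 
  shows "(\<Sum>k\<in>{1..N}. emeasure (W x) (first_hit \<tau> B k \<inter> A)) \<le> emeasure (W x) A"
proof -
  have "(\<lambda>k. first_hit \<tau> B k \<inter> A) ` {1..N} \<subseteq> sets (W x)"
    using adapted_first_hit[OF assms(1,3,4)] assms(2) unfolding adapted_def by auto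
  moreover have "disjoint_family_on (\<lambda>k. first_hit \<tau> B k \<inter> A) {1..N}"
    using first_hit_disjoint[of \<tau> B N] unfolding disjoint_family_on_def by blast
  ultimately have "(\<Sum>k\<in>{1..N}. emeasure (W x) (first_hit \<tau> B k \<inter> A)) = emeasure (W x) (\<Union>k\<in>{1..N}. first_hit \<tau> B k \<inter> A)"
    by (intro sum_emeasure) auto
  also have "\<dots> \<le> emeasure (W x) A" using assms(2) by (intro emeasure_mono) auto
  finally show ?thesis .
qed

text \<open>After a hit of \<open>ball y r\<close> the expected time spent in \<open>ball y \<delta>\<close> before a further time \<open>K\<close> is at least
  \<open>bv \<delta>\<close> times the potential, while the total occupation time up to \<open>t + K\<close>, integrated over \<open>y\<close>, is \<open>(t + K) * bv \<delta>\<close>.\<close>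
lemma capacity_upper:
  assumes "0 < t" "0 < K" "0 < \<delta>" "0 < r"
  shows "vol r 0 t * newton_potential DIM('a) {0<..K} (r + \<delta>) \<le> t + K"
proof -
  let ?A = "\<lambda>y s. {\<omega>\<in>cpaths. \<omega> s \<in> ball (y::'a) \<delta>}"
  let ?f = "\<lambda>s. ennreal (bv \<delta> * newton_density DIM('a) s (r + \<delta>))"
  define c where "c = ennreal (bv \<delta> * newton_potential DIM('a) {0<..K} (r + \<delta>))"
  have fm: "?f \<in> borel_measurable borel" by measurable
  have cp: "cpaths \<in> sets (path_space :: (real \<Rightarrow> 'a) measure)" using sets.top[of path_space] by simp
  have Am: "?A y s \<in> sets path_space" for y s by (rule coord_sets) simp
  have AI: "cpaths \<inter> ?A y s = ?A y s" for y s by auto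
  have Am1: "(\<lambda>s. emeasure (W 0) (?A y s)) \<in> borel_measurable borel" for y
    using measurable_occupation1[OF cp, of 0 y \<delta>] unfolding AI .
  have c: "(\<integral>\<^sup>+s. indicator {0<..K} s * ?f s \<partial>lborel) = c"
  proof -
    have "(\<integral>\<^sup>+s. indicator {0<..K} s * ?f s \<partial>lborel) = (\<integral>\<^sup>+s. ennreal (bv \<delta>) * (indicator {0<..K} s * ennreal (newton_density DIM('a) s (r + \<delta>))) \<partial>lborel)"
      using bv_pos[OF assms(3)] by (intro nn_integral_cong) (simp add: ennreal_mult' mult.left_commute)
    also have "\<dots> = ennreal (bv \<delta>) * (\<integral>\<^sup>+s. indicator {0<..K} s * ennreal (newton_density DIM('a) s (r + \<delta>)) \<partial>lborel)"
      by (intro nn_integral_cmult) measurable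
    also have "\<dots> = c" unfolding c_def using assms dim bv_pos[OF assms(3)]
      by (subst nn_integral_newton) (auto simp: ennreal_mult')
    finally show ?thesis .
  qed
  have y: "c * emeasure (W 0) (hits (ball y r) 0 t) \<le> (\<integral>\<^sup>+s. indicator {0<..t + K} s * emeasure (W 0) (?A y s) \<partial>lborel)" for y
  proof -
    have "c * emeasure (W 0) {\<omega>\<in>cpaths. \<exists>k\<in>{1..(2::nat)^n}. \<omega> (0 + real k * ((t - 0) / 2^n)) \<in> ball y r} \<le> (\<integral>\<^sup>+s. indicator {0<..t + K} s * emeasure (W 0) (?A y s) \<partial>lborel)" for n
    proof -
      define \<tau> where "\<tau> k = 0 + real k * ((t - 0) / 2^n)" for k :: nat
      have mono: "\<tau> j \<le> \<tau> k" if "j < k" for j k using that assms unfolding \<tau>_def by (intro add_left_mono mult_right_mono) auto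
      have pos: "\<tau> k > 0" if "k \<in> {1..}" for k using that assms unfolding \<tau>_def by auto
      have ub: "\<tau> k \<le> t" if "k \<in> {1..2^n}" for k
        using that mono[of k "2^n"] by (cases "k = 2^n") (auto simp: \<tau>_def)
      have bb: "ball y r \<in> sets borel" by simp
      have ad: "adapted (\<tau> k) (first_hit \<tau> (ball y r) k)" if "k \<in> {1..2^n}" for k
        using pos[of k] that mono by (intro adapted_first_hit[OF bb]) auto
      have fs: "first_hit \<tau> (ball y r) k \<in> sets path_space" if "k \<in> {1..2^n}" for k using ad[OF that] by (simp add: adapted_def)
      \<comment> \<open>The time window of length \<open>K\<close> after the hit stays inside
        \<open>{0<..t + K}\<close> because \<open>\<tau> k \<le> t\<close>.\<close>
      have step: "c * emeasure (W 0) (first_hit \<tau> (ball y r) k) \<le> (\<integral>\<^sup>+s. indicator {0<..t + K} s * emeasure (W 0) (first_hit \<tau> (ball y r) k \<inter> ?A y s) \<partial>lborel)"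
        if k: "k \<in> {1..2^n}" for k
      proof -
        have "c * emeasure (W 0) (first_hit \<tau> (ball y r) k) \<le> (\<integral>\<^sup>+s. indicator {\<tau> k<..\<tau> k + K} s * emeasure (W 0) (first_hit \<tau> (ball y r) k \<inter> ?A y s) \<partial>lborel)"
          unfolding c[symmetric]
        proof (rule occupation_ge[OF ad[OF k] _ _ fm, where B="ball y r"])
          show "0 < \<tau> k" using pos k by auto
          show "\<omega> (\<tau> k) \<in> ball y r" if "\<omega> \<in> first_hit \<tau> (ball y r) k" for \<omega> using that by (simp add: first_hit_def)
          show "?f s \<le> emeasure (W w) {\<omega>\<in>cpaths. \<omega> s \<in> ball y \<delta>}" if "s \<in> {0<..K}" "w \<in> ball y r" for s w
            using that assms by (intro W_ball_ge) (auto simp: dist_commute)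
        qed
        also have "\<dots> \<le> (\<integral>\<^sup>+s. indicator {0<..t + K} s * emeasure (W 0) (first_hit \<tau> (ball y r) k \<inter> ?A y s) \<partial>lborel)"
          using ub[OF k] pos[of k] k by (intro nn_integral_mono mult_right_mono) (auto simp: indicator_def)
        finally show ?thesis .
      qed
      have "c * emeasure (W 0) {\<omega>\<in>cpaths. \<exists>k\<in>{1..(2::nat)^n}. \<omega> (\<tau> k) \<in> ball y r} = (\<Sum>k\<in>{1..2^n}. c * emeasure (W 0) (first_hit \<tau> (ball y r) k))"
        unfolding sum_distrib_left[symmetric] using pos mono by (subst sum_first_hit[OF bb]) (auto simp: less_imp_le)
      also have "\<dots> \<le> (\<Sum>k\<in>{1..2^n}. \<integral>\<^sup>+s. indicator {0<..t + K} s * emeasure (W 0) (first_hit \<tau> (ball y r) k \<inter> ?A y s) \<partial>lborel)"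
        by (rule sum_mono[OF step])
      also have "\<dots> = (\<integral>\<^sup>+s. (\<Sum>k\<in>{1..2^n}. indicator {0<..t + K} s * emeasure (W 0) (first_hit \<tau> (ball y r) k \<inter> ?A y s)) \<partial>lborel)"
        using measurable_occupation1[OF fs] by (intro nn_integral_sum[symmetric]) simp
      \<comment> \<open>The first-hit events are disjoint, so their occupation times add up to at
        most the total one, uniformly in the grid.\<close>
      also have "\<dots> \<le> (\<integral>\<^sup>+s. indicator {0<..t + K} s * emeasure (W 0) (?A y s) \<partial>lborel)"
        unfolding sum_distrib_left[symmetric] using pos mono
        by (intro nn_integral_mono mult_left_mono sum_first_hit_Int Am bb) (auto simp: less_imp_le)
      finally show ?thesis unfolding \<tau>_def .
    qed
    then show ?thesis using assms(1) by (subst emeasure_hits_SUP) (auto simp: SUP_mult_left_ennreal intro!: SUP_least)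
  qed
  have m2: "(\<lambda>(y, s). indicator {0<..t + K} s * emeasure (W 0) (?A y s)) \<in> borel_measurable (lborel \<Otimes>\<^sub>M lborel)"
  proof -
    have "(\<lambda>z. (snd z, fst z)) \<in> (lborel :: 'a measure) \<Otimes>\<^sub>M (lborel :: real measure) \<rightarrow>\<^sub>M borel \<Otimes>\<^sub>M borel" by measurable
    from measurable_compose[OF this measurable_occupation[OF mfam_const[OF cp], of 0 \<delta>]]
    have "(\<lambda>z. emeasure (W 0) (?A (fst z) (snd z))) \<in> borel_measurable ((lborel :: 'a measure) \<Otimes>\<^sub>M (lborel :: real measure))" 
      unfolding AI by simp
    then show ?thesis unfolding case_prod_beta' by measurable
  qed
  have LL: "pair_sigma_finite (lborel :: 'a measure) (lborel :: real measure)"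
    by (simp add: pair_sigma_finite_def sigma_finite_lborel)
  have "c * ennreal (vol r 0 t) = (\<integral>\<^sup>+y. c * emeasure (W 0) (hits (ball y r) 0 t) \<partial>lborel)"
    using ennreal_vol[of t 0 r] assms(1) by (subst nn_integral_cmult) auto
  also have "\<dots> \<le> (\<integral>\<^sup>+y. (\<integral>\<^sup>+s. indicator {0<..t + K} s * emeasure (W 0) (?A y s) \<partial>lborel) \<partial>lborel)"
    by (intro nn_integral_mono y)
  also have "\<dots> = (\<integral>\<^sup>+s. (\<integral>\<^sup>+y. indicator {0<..t + K} s * emeasure (W 0) (?A y s) \<partial>lborel) \<partial>lborel)"
    using pair_sigma_finite.Fubini'[OF LL m2] by simp
  also have "\<dots> = (\<integral>\<^sup>+s. ennreal (bv \<delta>) * indicator {0<..t + K} s \<partial>lborel)"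
  proof (intro nn_integral_cong)
    fix s
    have "(\<integral>\<^sup>+y. indicator {0<..t + K} s * emeasure (W 0) (?A y s) \<partial>lborel) = indicator {0<..t + K} s * (\<integral>\<^sup>+y. emeasure (W 0) (?A y s) \<partial>lborel)"
      using mfam_emeasure_measurable2[OF mfam_coord_ball, of "\<lambda>_. 0" lborel "\<lambda>y. y" s \<delta>] by (intro nn_integral_cmult) simp
    then show "(\<integral>\<^sup>+y. indicator {0<..t + K} s * emeasure (W 0) (?A y s) \<partial>lborel) = ennreal (bv \<delta>) * indicator {0<..t + K} s"
      using volume_const[OF cp, of \<delta> 0 s] assms(3) P.emeasure_space_1[of 0] unfolding AI by (simp add: mult.commute)
  qed
  also have "\<dots> = ennreal (bv \<delta> * (t + K))" using assms bv_pos[OF assms(3)] by (simp add: nn_integral_cmult_indicator ennreal_mult')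
  finally have "ennreal (bv \<delta> * (newton_potential DIM('a) {0<..K} (r + \<delta>) * vol r 0 t)) \<le> ennreal (bv \<delta> * (t + K))"
    unfolding c_def using vol_nonneg newton_potential_nonneg bv_pos[OF assms(3)] by (simp add: ennreal_mult' mult.assoc[symmetric])
  then have "bv \<delta> * (newton_potential DIM('a) {0<..K} (r + \<delta>) * vol r 0 t) \<le> bv \<delta> * (t + K)"
    using assms bv_pos[OF assms(3)] by (subst (asm) ennreal_le_iff) auto
  then show ?thesis using bv_pos[OF assms(3)] by (simp add: mult.commute)
qed

text \<open>At the first hit of \<open>ball y r\<close> along the grid \<open>\<eta>\<nat>\<close> the process is at distance at least \<open>r - 2 * \<delta>\<close> from \<open>y\<close>
  unless it has just moved by more than \<open>2 * \<delta>\<close> within time \<open>\<eta>\<close>, which has probability \<open>o(\<eta>)\<close>.\<close>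
lemma capacity_lower:
  assumes \<delta>: "0 < \<delta>" "3 * \<delta> < r"
  obtains c where "0 < c" "\<And>\<eta> m. 0 < \<eta> \<Longrightarrow> real m * \<eta> * bv \<delta> \<le> \<eta> * bv \<delta> + real m * \<eta> * bv \<delta> * (2 powr (real DIM('a) / 2) * exp (- \<delta>\<^sup>2 / \<eta>))
     + bv \<delta> * newton_potential DIM('a) {0<..} (r - 3 * \<delta>) * vol r 0 (real m * \<eta>)
     + c * (1 + real m * (2 powr (real DIM('a) / 2) * exp (- \<delta>\<^sup>2 / \<eta>)))"
proof -
  \<comment> \<open>A bound for the expected occupation time of \<open>ball y \<delta>\<close> from
    any start. It is used for the hits that overshoot far into \<open>ball y r\<close>, where the
    potential at radius \<open>r - 3 * \<delta>\<close> gives no bound.\<close>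
  define S where "S = (LBINT s. indicator {0<..} s * ((2 * bv \<delta> + 2) / (1 + s\<^sup>2)))"
  have Sn: "(\<integral>\<^sup>+s. indicator {0<..} s * ennreal ((2 * bv \<delta> + 2) / (1 + s\<^sup>2)) \<partial>lborel) = ennreal S"
  proof -
    have "(\<integral>\<^sup>+s. indicator {0<..} s * ennreal ((2 * bv \<delta> + 2) / (1 + s\<^sup>2)) \<partial>lborel) = (\<integral>\<^sup>+s. ennreal (indicator {0<..} s * ((2 * bv \<delta> + 2) / (1 + s\<^sup>2))) \<partial>lborel)"
      by (intro nn_integral_cong) (auto simp: indicator_def)
    also have "\<dots> = ennreal S" unfolding S_def
      using bv_pos[OF \<delta>(1)] by (intro nn_integral_eq_integral integrable_dominator) (auto intro!: divide_nonneg_nonneg)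
    finally show ?thesis .
  qed
  have S0: "0 \<le> S" unfolding S_def using bv_pos[OF \<delta>(1)] by (intro integral_nonneg_AE AE_I2) (auto intro!: divide_nonneg_nonneg)
  define G where "G = newton_potential DIM('a) {0<..} (r - 3 * \<delta>)"
  have G0: "0 \<le> G" unfolding G_def by (rule newton_potential_nonneg)
  have r: "0 < r" using \<delta> by linarith
  have cp: "cpaths \<in> sets (path_space :: (real \<Rightarrow> 'a) measure)" using sets.top[of path_space] by simp
  have main: "ennreal (real m * \<eta> * bv \<delta>) \<le> ennreal (\<eta> * bv \<delta>) + ennreal (real m * \<eta> * bv \<delta> * q) + ennreal (bv \<delta> * G * vol r 0 (real m * \<eta>)) + ennreal (S * bv r * (1 + real m * q))"
    if \<eta>: "0 < \<eta>" and q: "q = 2 powr (real DIM('a) / 2) * exp (- \<delta>\<^sup>2 / \<eta>)" for \<eta> q :: real and m :: nat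
  proof -
    have q0: "0 \<le> q" unfolding q by simp
    define \<tau> where "\<tau> k = real k * \<eta>" for k :: nat
    have mono: "\<tau> j \<le> \<tau> k" if "j < k" for j k using that \<eta> unfolding \<tau>_def by auto
    have pos: "\<tau> k > 0" if "k \<in> {1..}" for k using that \<eta> unfolding \<tau>_def by auto
    let ?A = "\<lambda>y s. {\<omega>\<in>cpaths. \<omega> s \<in> ball (y::'a) \<delta>}"
    let ?H = "\<lambda>j y. first_hit \<tau> (ball y r) j"
    let ?t = "real m * \<eta>"
    have Am: "?A y s \<in> sets path_space" for y s by (rule coord_sets) simp
    have AI: "cpaths \<inter> ?A y s = ?A y s" for y s by auto
    have Hm: "mfam (?H j)" for j by (rule mfam_first_hit)
    have Hs: "?H j y \<in> sets path_space" for j y by (rule mfam_sets[OF Hm])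
    have HAm: "(\<lambda>y. emeasure (W 0) (?H j y \<inter> ?A y s)) \<in> borel_measurable lborel" for j s
      using mfam_emeasure_measurable2[OF mfam_Int[OF Hm mfam_coord_ball], of "\<lambda>_. 0" lborel "\<lambda>y. y" j s \<delta>] by simp
    define I where "I j = (\<integral>\<^sup>+s. indicator {\<tau> j<..} s * (\<integral>\<^sup>+y. emeasure (W 0) (?H j y \<inter> ?A y s) \<partial>lborel) \<partial>lborel)" for j
    have HA2: "(\<lambda>z. emeasure (W 0) (?H j (snd z) \<inter> ?A (snd z) (fst z))) \<in> borel_measurable ((borel::real measure) \<Otimes>\<^sub>M borel)" for j
      by (rule measurable_occupation[OF Hm])
    have Jm: "(\<lambda>s. \<integral>\<^sup>+y. emeasure (W 0) (?H j y \<inter> ?A y s) \<partial>lborel) \<in> borel_measurable borel" for j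
    proof -
      have "(\<lambda>(s, y). emeasure (W 0) (?H j y \<inter> ?A y s)) \<in> borel_measurable ((borel::real measure) \<Otimes>\<^sub>M lborel)"
        using HA2[of j] by (simp add: case_prod_beta')
      then show ?thesis by (rule lborel.borel_measurable_nn_integral)
    qed
    \<comment> \<open>For a fixed instant \<open>s\<close> the left side is the volume of the
      centres whose \<open>\<delta>\<close>-ball is occupied. Either \<open>s\<close> precedes the
      first grid time, or the last step before \<open>s\<close> was larger than
      \<open>2 * \<delta>\<close>, or \<open>ball y r\<close> was hit along the grid before
      \<open>s\<close>.\<close>
    have pt: "ennreal (bv \<delta>) \<le> ennreal (bv \<delta>) * indicator {0<..\<eta>} s + ennreal (bv \<delta> * q)
      + (\<Sum>j\<in>{1..m}. indicator {\<tau> j<..} s * (\<integral>\<^sup>+y. emeasure (W 0) (?H j y \<inter> ?A y s) \<partial>lborel))" if s: "s \<in> {0<..?t}" for s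
    proof (cases "s \<le> \<eta>")
      case True
      then show ?thesis using s by (simp add: add.assoc add_increasing2)
    next
      case False
      \<comment> \<open>The last grid index strictly before \<open>s\<close>; strictness is needed
        for the indicator of \<open>{\<tau> j<..}\<close>.\<close>
      define k where "k = nat (\<lceil>s / \<eta>\<rceil> - 1)"
      have "1 < s / \<eta>" using False \<eta> by simp
      then have "2 \<le> \<lceil>s / \<eta>\<rceil>" by linarith
      then have "int k = \<lceil>s / \<eta>\<rceil> - 1" unfolding k_def by (intro int_nat_eq[THEN trans]) (simp only: if_P)
      then have k: "1 \<le> k" "real k = of_int \<lceil>s / \<eta>\<rceil> - 1"
        using \<open>2 \<le> \<lceil>s / \<eta>\<rceil>\<close> of_int_of_nat_eq[where 'a=real, of k] by (linarith, simp)
      have "real k < s / \<eta>" "s / \<eta> \<le> real k + 1" unfolding k(2) by linarith+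
      then have ks: "\<tau> k < s" "s \<le> \<tau> k + \<eta>" unfolding \<tau>_def using \<eta> by (simp_all add: field_simps)
      have "\<tau> k < real m * \<eta>" using ks s by simp
      then have km: "k < m" unfolding \<tau>_def using \<eta> by simp
      let ?O = "{\<omega>\<in>cpaths. 2 * \<delta> < dist (\<omega> s) (\<omega> (\<tau> k) :: 'a)}"
      have Os: "?O \<in> sets path_space" by (rule oscillation_sets)
      have sub: "?A y s \<subseteq> (?O \<inter> ?A y s) \<union> (\<Union>j\<in>{1..k}. ?H j y \<inter> ?A y s)" for y
      proof
        fix \<omega> assume w: "\<omega> \<in> ?A y s"
        show "\<omega> \<in> (?O \<inter> ?A y s) \<union> (\<Union>j\<in>{1..k}. ?H j y \<inter> ?A y s)"
        proof (cases "\<exists>j\<in>{1..k}. \<omega> (\<tau> j) \<in> ball y r")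
          case True
          then have "\<omega> \<in> (\<Union>j\<in>{1..k}. ?H j y)" unfolding first_hit_Union using w by auto
          then show ?thesis using w by blast
        next
          case False
          then have "r \<le> dist y (\<omega> (\<tau> k))" using k(1) by force
          moreover have "dist y (\<omega> s) < \<delta>" using w by simp
          \<comment> \<open>The distance exceeds \<open>r - \<delta>\<close>, so this is where
            \<open>3 * \<delta> < r\<close> is used.\<close>
          ultimately have "2 * \<delta> < dist (\<omega> s) (\<omega> (\<tau> k))" using dist_triangle[of y "\<omega> (\<tau> k)" "\<omega> s"] \<delta> by linarith
          then show ?thesis using w by blast
        qed
      qed
      have "ennreal (bv \<delta>) = (\<integral>\<^sup>+y. emeasure (W 0) (?A y s) \<partial>lborel)"
        using volume_const[OF cp, of \<delta> 0 s] \<delta>(1) P.emeasure_space_1[of 0] unfolding AI by simp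
      also have "\<dots> \<le> (\<integral>\<^sup>+y. emeasure (W 0) (?O \<inter> ?A y s) + (\<Sum>j\<in>{1..k}. emeasure (W 0) (?H j y \<inter> ?A y s)) \<partial>lborel)"
      proof (intro nn_integral_mono)
        fix y
        have 1: "(\<Union>j\<in>{1..k}. ?H j y \<inter> ?A y s) \<in> sets (W 0)" using Hs Am by auto
        have 2: "?O \<inter> ?A y s \<in> sets (W 0)" using Os Am by auto
        have "emeasure (W 0) (?A y s) \<le> emeasure (W 0) ((?O \<inter> ?A y s) \<union> (\<Union>j\<in>{1..k}. ?H j y \<inter> ?A y s))"
          by (intro emeasure_mono sub sets.Un 1 2)
        also have "\<dots> \<le> emeasure (W 0) (?O \<inter> ?A y s) + emeasure (W 0) (\<Union>j\<in>{1..k}. ?H j y \<inter> ?A y s)"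
          by (rule emeasure_subadditive[OF 2 1])
        also have "\<dots> \<le> emeasure (W 0) (?O \<inter> ?A y s) + (\<Sum>j\<in>{1..k}. emeasure (W 0) (?H j y \<inter> ?A y s))"
          using Hs Am by (intro add_left_mono emeasure_subadditive_finite) auto
        finally show "emeasure (W 0) (?A y s) \<le> emeasure (W 0) (?O \<inter> ?A y s) + (\<Sum>j\<in>{1..k}. emeasure (W 0) (?H j y \<inter> ?A y s))" .
      qed
      also have "\<dots> = (\<integral>\<^sup>+y. emeasure (W 0) (?O \<inter> ?A y s) \<partial>lborel) + (\<Sum>j\<in>{1..k}. \<integral>\<^sup>+y. emeasure (W 0) (?H j y \<inter> ?A y s) \<partial>lborel)"
      proof -
        have "(\<lambda>y. emeasure (W 0) (?O \<inter> ?A y s)) \<in> borel_measurable lborel"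
          using mfam_emeasure_measurable2[OF mfam_Int[OF mfam_const[OF Os] mfam_coord_ball], of "\<lambda>_. 0" lborel "\<lambda>y. y" s \<delta>] by simp
        moreover have "(\<lambda>y. \<Sum>j\<in>{1..k}. emeasure (W 0) (?H j y \<inter> ?A y s)) \<in> borel_measurable lborel"
          by (intro borel_measurable_sum HAm)
        ultimately show ?thesis using nn_integral_sum[of "{1..k}" "\<lambda>j y. emeasure (W 0) (?H j y \<inter> ?A y s)" lborel] HAm
          by (subst nn_integral_add) auto
      qed
      also have "(\<integral>\<^sup>+y. emeasure (W 0) (?O \<inter> ?A y s) \<partial>lborel) \<le> ennreal (bv \<delta> * q)"
      proof -
        have "emeasure (W 0) ?O \<le> ennreal q" unfolding q
          using ks k(1) pos \<delta>(1) by (intro W_oscillation) auto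
        then show ?thesis using volume_const[OF Os, of \<delta> 0 s] \<delta>(1) bv_pos[OF \<delta>(1)]
          by (simp add: ennreal_mult' mult_left_mono)
      qed
      also have "(\<Sum>j\<in>{1..k}. \<integral>\<^sup>+y. emeasure (W 0) (?H j y \<inter> ?A y s) \<partial>lborel) = (\<Sum>j\<in>{1..k}. indicator {\<tau> j<..} s * (\<integral>\<^sup>+y. emeasure (W 0) (?H j y \<inter> ?A y s) \<partial>lborel))"
      proof (intro sum.cong refl)
        fix j assume "j \<in> {1..k}"
        then have "\<tau> j \<le> \<tau> k" using mono[of j k] by (cases "j = k") auto
        then show "(\<integral>\<^sup>+y. emeasure (W 0) (?H j y \<inter> ?A y s) \<partial>lborel) = indicator {\<tau> j<..} s * (\<integral>\<^sup>+y. emeasure (W 0) (?H j y \<inter> ?A y s) \<partial>lborel)"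
          using ks by simp
      qed
      also have "\<dots> \<le> (\<Sum>j\<in>{1..m}. indicator {\<tau> j<..} s * (\<integral>\<^sup>+y. emeasure (W 0) (?H j y \<inter> ?A y s) \<partial>lborel))"
        using km by (intro sum_mono2) auto
      finally show ?thesis using False by (simp add: add_mono)
    qed
    \<comment> \<open>Occupation after a first hit at \<open>\<tau> j\<close>. If the path is then
      at distance at least \<open>r - 2 * \<delta>\<close> from \<open>y\<close>, points of
      \<open>ball y \<delta>\<close> are at distance at least \<open>r - 3 * \<delta>\<close> and
      the potential \<open>G\<close> applies. Otherwise the path has jumped over a shell of width
      \<open>2 * \<delta>\<close>.\<close>
    have Ij: "I j \<le> ennreal (bv \<delta> * G) * (\<integral>\<^sup>+y. emeasure (W 0) (?H j y) \<partial>lborel) + ennreal (S * bv r) * (if j = 1 then 1 else ennreal q)" if j: "j \<in> {1..m}" for j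
    proof -
      \<comment> \<open>For \<open>j = 1\<close> there is no earlier grid time to compare with, so
        nothing is gained; this single index causes the summand 1 in the error
        \<open>1 + m * q\<close>.\<close>
      define D where "D = (if j = 1 then cpaths else {\<omega>\<in>cpaths. 2 * \<delta> < dist (\<omega> (\<tau> j)) (\<omega> (\<tau> (j - 1)) :: 'a)})"
      have Ds: "D \<in> sets path_space" unfolding D_def using cp oscillation_sets by simp
      have Dq: "emeasure (W 0) D \<le> (if j = 1 then 1 else ennreal q)"
      proof (cases "j = 1")
        case True
        then show ?thesis using P.emeasure_space_1[of 0] by (simp add: D_def)
      next
        case False
        have "\<tau> j = \<tau> (j - 1) + \<eta>" unfolding \<tau>_def using j by (cases j) (auto simp: algebra_simps)
        then have "emeasure (W 0) {\<omega>\<in>cpaths. 2 * \<delta> < dist (\<omega> (\<tau> j)) (\<omega> (\<tau> (j - 1)) :: 'a)} \<le> ennreal q"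
          unfolding q using pos[of "j - 1"] j False \<eta> \<delta>(1) by (intro W_oscillation) auto
        then show ?thesis using False by (simp add: D_def)
      qed
      let ?B = "\<lambda>y. {\<omega>\<in>cpaths. \<omega> (\<tau> j) \<in> ball (y::'a) (r - 2 * \<delta>)}"
      let ?R = "\<lambda>y. {\<omega>\<in>cpaths. \<omega> (\<tau> j) \<in> ball (y::'a) r}"
      have one: "(\<integral>\<^sup>+s. indicator {\<tau> j<..} s * emeasure (W 0) (?H j y \<inter> ?A y s) \<partial>lborel) \<le> ennreal (bv \<delta> * G) * emeasure (W 0) (?H j y) + ennreal S * emeasure (W 0) (D \<inter> ?R y)" for y
      proof -
        have tj: "0 < \<tau> j" using pos j by auto
        have Bm: "adapted (\<tau> j) (?B y)" using tj by (intro adapted_coord) auto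
        have Ha: "adapted (\<tau> j) (?H j y)" using tj mono by (intro adapted_first_hit) auto
        have g: "adapted (\<tau> j) (?H j y - ?B y)" by (rule adapted_Diff[OF Ha Bm])
        have b: "adapted (\<tau> j) (?H j y \<inter> ?B y)" by (rule adapted_Int[OF Ha Bm])
        have gs: "?H j y - ?B y \<in> sets path_space" and bs: "?H j y \<inter> ?B y \<in> sets path_space" using g b by (simp_all add: adapted_def)
        have sp: "emeasure (W 0) (?H j y \<inter> ?A y s) \<le> emeasure (W 0) ((?H j y - ?B y) \<inter> ?A y s) + emeasure (W 0) ((?H j y \<inter> ?B y) \<inter> ?A y s)" for s
        proof -
          have "?H j y \<inter> ?A y s = ((?H j y - ?B y) \<inter> ?A y s) \<union> ((?H j y \<inter> ?B y) \<inter> ?A y s)" by blast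
          then show ?thesis using emeasure_subadditive[of "(?H j y - ?B y) \<inter> ?A y s" "W 0" "(?H j y \<inter> ?B y) \<inter> ?A y s"] gs bs Am by auto
        qed
        have "(\<integral>\<^sup>+s. indicator {\<tau> j<..} s * emeasure (W 0) (?H j y \<inter> ?A y s) \<partial>lborel) \<le>
          (\<integral>\<^sup>+s. indicator {\<tau> j<..} s * emeasure (W 0) ((?H j y - ?B y) \<inter> ?A y s) + indicator {\<tau> j<..} s * emeasure (W 0) ((?H j y \<inter> ?B y) \<inter> ?A y s) \<partial>lborel)"
          unfolding distrib_left[symmetric] by (intro nn_integral_mono mult_left_mono sp) auto
        also have "\<dots> = (\<integral>\<^sup>+s. indicator {\<tau> j<..} s * emeasure (W 0) ((?H j y - ?B y) \<inter> ?A y s) \<partial>lborel) + (\<integral>\<^sup>+s. indicator {\<tau> j<..} s * emeasure (W 0) ((?H j y \<inter> ?B y) \<inter> ?A y s) \<partial>lborel)"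
          using measurable_occupation1[OF gs] measurable_occupation1[OF bs] by (intro nn_integral_add) auto
        also have "\<dots> \<le> (\<integral>\<^sup>+s. indicator {0<..} s * ennreal (bv \<delta> * newton_density DIM('a) s (r - 3 * \<delta>)) \<partial>lborel) * emeasure (W 0) (?H j y - ?B y)
           + (\<integral>\<^sup>+s. indicator {0<..} s * ennreal ((2 * bv \<delta> + 2) / (1 + s\<^sup>2)) \<partial>lborel) * emeasure (W 0) (?H j y \<inter> ?B y)"
        proof (intro add_mono)
          show "(\<integral>\<^sup>+s. indicator {\<tau> j<..} s * emeasure (W 0) ((?H j y - ?B y) \<inter> ?A y s) \<partial>lborel) \<le> (\<integral>\<^sup>+s. indicator {0<..} s * ennreal (bv \<delta> * newton_density DIM('a) s (r - 3 * \<delta>)) \<partial>lborel) * emeasure (W 0) (?H j y - ?B y)"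
          proof (rule occupation_le[OF g tj, where B="- ball y (r - 2 * \<delta>)"])
            show "\<omega> (\<tau> j) \<in> - ball y (r - 2 * \<delta>)" if "\<omega> \<in> ?H j y - ?B y" for \<omega> using that by (auto simp: first_hit_def)
            show "emeasure (W w) {\<omega>\<in>cpaths. \<omega> s \<in> ball y \<delta>} \<le> ennreal (bv \<delta> * newton_density DIM('a) s (r - 3 * \<delta>))" if "0 < s" "w \<in> - ball y (r - 2 * \<delta>)" for s w
              using that \<delta> by (intro W_ball_le) (auto simp: dist_commute)
          qed measurable
          show "(\<integral>\<^sup>+s. indicator {\<tau> j<..} s * emeasure (W 0) ((?H j y \<inter> ?B y) \<inter> ?A y s) \<partial>lborel) \<le> (\<integral>\<^sup>+s. indicator {0<..} s * ennreal ((2 * bv \<delta> + 2) / (1 + s\<^sup>2)) \<partial>lborel) * emeasure (W 0) (?H j y \<inter> ?B y)"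
            by (rule occupation_le[OF b tj, where B=UNIV]) (use W_ball_le_integrable[OF _ \<delta>(1)] in simp_all)
        qed
        also have "(\<integral>\<^sup>+s. indicator {0<..} s * ennreal (bv \<delta> * newton_density DIM('a) s (r - 3 * \<delta>)) \<partial>lborel) = ennreal (bv \<delta> * G)"
        proof -
          have "(\<integral>\<^sup>+s. indicator {0<..} s * ennreal (bv \<delta> * newton_density DIM('a) s (r - 3 * \<delta>)) \<partial>lborel) = (\<integral>\<^sup>+s. ennreal (bv \<delta>) * (indicator {0<..} s * ennreal (newton_density DIM('a) s (r - 3 * \<delta>))) \<partial>lborel)"
            using bv_pos[OF \<delta>(1)] by (intro nn_integral_cong) (simp add: ennreal_mult' mult.left_commute)
          also have "\<dots> = ennreal (bv \<delta>) * (\<integral>\<^sup>+s. indicator {0<..} s * ennreal (newton_density DIM('a) s (r - 3 * \<delta>)) \<partial>lborel)"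
            by (intro nn_integral_cmult) measurable
          also have "\<dots> = ennreal (bv \<delta> * G)" unfolding G_def using \<delta> dim bv_pos[OF \<delta>(1)]
            by (subst nn_integral_newton) (auto simp: ennreal_mult')
          finally show ?thesis .
        qed
        also note Sn
        also have "ennreal (bv \<delta> * G) * emeasure (W 0) (?H j y - ?B y) + ennreal S * emeasure (W 0) (?H j y \<inter> ?B y) \<le> ennreal (bv \<delta> * G) * emeasure (W 0) (?H j y) + ennreal S * emeasure (W 0) (D \<inter> ?R y)"
        proof (intro add_mono mult_left_mono emeasure_mono)
          \<comment> \<open>The previous grid position was outside \<open>ball y r\<close>. The
            factor \<open>?R y\<close> is kept because it makes the integral over the centres
            \<open>y\<close> finite.\<close>
          show "?H j y \<inter> ?B y \<subseteq> D \<inter> ?R y"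
          proof
            fix \<omega> assume w: "\<omega> \<in> ?H j y \<inter> ?B y"
            then have wc: "\<omega> \<in> cpaths" "\<omega> (\<tau> j) \<in> ball y r" "dist y (\<omega> (\<tau> j)) < r - 2 * \<delta>" by (auto simp: first_hit_def)
            have "\<omega> \<in> D"
            proof (cases "j = 1")
              case False
              then have "\<omega> (\<tau> (j - 1)) \<notin> ball y r" using w j by (auto simp: first_hit_def)
              then have "2 * \<delta> < dist (\<omega> (\<tau> j)) (\<omega> (\<tau> (j - 1)))" using wc dist_triangle[of y "\<omega> (\<tau> (j - 1))" "\<omega> (\<tau> j)"] by simp
              then show ?thesis using False wc by (simp add: D_def)
            qed (use wc in \<open>simp add: D_def\<close>)
            then show "\<omega> \<in> D \<inter> ?R y" using wc by blast
          qed
          show "D \<inter> ?R y \<in> sets (W 0)" using Ds coord_sets[of "ball y r" "\<tau> j"] by auto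
          show "?H j y \<in> sets (W 0)" using Hs by simp
        qed auto
        finally show ?thesis .
      qed
      have DRm: "(\<lambda>y. emeasure (W 0) (D \<inter> ?R y)) \<in> borel_measurable lborel"
        using mfam_emeasure_measurable2[OF mfam_Int[OF mfam_const[OF Ds] mfam_coord_ball], of "\<lambda>_. 0" lborel "\<lambda>y. y" "\<tau> j" r] by simp
      have H1m: "(\<lambda>y. emeasure (W 0) (?H j y)) \<in> borel_measurable lborel"
        using mfam_emeasure_measurable2[OF Hm, of "\<lambda>_. 0" lborel "\<lambda>y. y" j] by simp
      have LL: "pair_sigma_finite (lborel :: real measure) (lborel :: 'a measure)"
        by (simp add: pair_sigma_finite_def sigma_finite_lborel)
      have m2: "(\<lambda>(s, y). indicator {\<tau> j<..} s * emeasure (W 0) (?H j y \<inter> ?A y s)) \<in> borel_measurable ((lborel::real measure) \<Otimes>\<^sub>M lborel)"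
        using HA2[of j] unfolding case_prod_beta' by measurable
      have "I j = (\<integral>\<^sup>+s. (\<integral>\<^sup>+y. indicator {\<tau> j<..} s * emeasure (W 0) (?H j y \<inter> ?A y s) \<partial>lborel) \<partial>lborel)"
        unfolding I_def using HAm by (intro nn_integral_cong nn_integral_cmult[symmetric]) simp
      also have "\<dots> = (\<integral>\<^sup>+y. (\<integral>\<^sup>+s. indicator {\<tau> j<..} s * emeasure (W 0) (?H j y \<inter> ?A y s) \<partial>lborel) \<partial>lborel)"
        using pair_sigma_finite.Fubini'[OF LL m2] by simp
      also have "\<dots> \<le> (\<integral>\<^sup>+y. ennreal (bv \<delta> * G) * emeasure (W 0) (?H j y) + ennreal S * emeasure (W 0) (D \<inter> ?R y) \<partial>lborel)"
        by (intro nn_integral_mono one)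
      also have "\<dots> = ennreal (bv \<delta> * G) * (\<integral>\<^sup>+y. emeasure (W 0) (?H j y) \<partial>lborel) + ennreal S * (\<integral>\<^sup>+y. emeasure (W 0) (D \<inter> ?R y) \<partial>lborel)"
        using DRm H1m by (simp add: nn_integral_add nn_integral_cmult)
      also have "(\<integral>\<^sup>+y. emeasure (W 0) (D \<inter> ?R y) \<partial>lborel) = ennreal (bv r) * emeasure (W 0) D"
        using r by (intro volume_const Ds) simp
      also have "ennreal S * (ennreal (bv r) * emeasure (W 0) D) \<le> ennreal (S * bv r) * (if j = 1 then 1 else ennreal q)"
        using Dq S0 by (simp add: ennreal_mult' mult.assoc[symmetric] mult_left_mono split del: if_split)
      finally show ?thesis by (simp add: add_mono split del: if_split)
    qed
    have sumH: "(\<Sum>j\<in>{1..m}. \<integral>\<^sup>+y. emeasure (W 0) (?H j y) \<partial>lborel) \<le> ennreal (vol r 0 ?t)"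
    proof -
      have "(\<Sum>j\<in>{1..m}. \<integral>\<^sup>+y. emeasure (W 0) (?H j y) \<partial>lborel) = (\<integral>\<^sup>+y. (\<Sum>j\<in>{1..m}. emeasure (W 0) (?H j y)) \<partial>lborel)"
        using mfam_emeasure_measurable2[OF Hm, of "\<lambda>_. 0" lborel "\<lambda>y. y"] by (intro nn_integral_sum[symmetric]) simp
      also have "\<dots> \<le> (\<integral>\<^sup>+y. emeasure (W 0) (hits (ball y r) 0 ?t) \<partial>lborel)"
      proof (intro nn_integral_mono)
        fix y
        have "(\<Sum>j\<in>{1..m}. emeasure (W 0) (?H j y)) = emeasure (W 0) {\<omega>\<in>cpaths. \<exists>k\<in>{1..m}. \<omega> (\<tau> k) \<in> ball y r}"
          using pos mono by (intro sum_first_hit) (auto simp: less_imp_le)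
        also have "\<dots> \<le> emeasure (W 0) (hits (ball y r) 0 ?t)"
        proof (rule emeasure_mono)
          show "{\<omega>\<in>cpaths. \<exists>k\<in>{1..m}. \<omega> (\<tau> k) \<in> ball y r} \<subseteq> hits (ball y r) 0 ?t"
            unfolding hits_def \<tau>_def using \<eta> by (fastforce intro!: bexI mult_right_mono)
          show "hits (ball y r) 0 ?t \<in> sets (W 0)" using \<eta> by (intro hits_sets_P) auto
        qed
        finally show "(\<Sum>j\<in>{1..m}. emeasure (W 0) (?H j y)) \<le> emeasure (W 0) (hits (ball y r) 0 ?t)" .
      qed
      also have "\<dots> = ennreal (vol r 0 ?t)" using \<eta> by (intro ennreal_vol) simp
      finally show ?thesis .
    qed
    have sumq: "(\<Sum>j\<in>{1..m}. (if j = 1 then 1 else ennreal q)) \<le> ennreal (1 + real m * q)"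
    proof -
      have "(\<Sum>j\<in>{1..m}. (if j = 1 then 1 else ennreal q)) \<le> (\<Sum>j\<in>{1..m}. (if j = 1 then 1 else 0) + ennreal q)"
        by (intro sum_mono) auto
      also have "\<dots> \<le> 1 + (\<Sum>j\<in>{1..m}. ennreal q)" unfolding sum.distrib by (intro add_mono) (simp_all add: sum.delta)
      also have "\<dots> = ennreal (1 + real m * q)" using q0 by (simp add: ennreal_of_nat_eq_real_of_nat ennreal_mult' ennreal_plus)
      finally show ?thesis .
    qed
    have "ennreal (?t * bv \<delta>) = (\<integral>\<^sup>+s. ennreal (bv \<delta>) * indicator {0<..?t} s \<partial>lborel)"
      using \<eta> bv_pos[OF \<delta>(1)] by (simp add: nn_integral_cmult_indicator ennreal_mult' mult.commute)
    also have "\<dots> \<le> (\<integral>\<^sup>+s. ennreal (bv \<delta>) * indicator {0<..\<eta>} s + ennreal (bv \<delta> * q) * indicator {0<..?t} s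
      + (\<Sum>j\<in>{1..m}. indicator {\<tau> j<..} s * (\<integral>\<^sup>+y. emeasure (W 0) (?H j y \<inter> ?A y s) \<partial>lborel)) \<partial>lborel)"
    proof (intro nn_integral_mono)
      fix s
      show "ennreal (bv \<delta>) * indicator {0<..?t} s \<le> ennreal (bv \<delta>) * indicator {0<..\<eta>} s + ennreal (bv \<delta> * q) * indicator {0<..?t} s
        + (\<Sum>j\<in>{1..m}. indicator {\<tau> j<..} s * (\<integral>\<^sup>+y. emeasure (W 0) (?H j y \<inter> ?A y s) \<partial>lborel))"
      proof (cases "s \<in> {0<..?t}")
        case True
        then show ?thesis using pt[OF True] by simp
      next
        case False
        then have "indicator {0<..?t} s = (0::ennreal)" by (simp add: indicator_def)
        then show ?thesis by (simp only: mult_zero_right zero_le)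
      qed
    qed
    also have "\<dots> = (\<integral>\<^sup>+s. ennreal (bv \<delta>) * indicator {0<..\<eta>} s \<partial>lborel) + (\<integral>\<^sup>+s. ennreal (bv \<delta> * q) * indicator {0<..?t} s \<partial>lborel) + (\<Sum>j\<in>{1..m}. I j)"
    proof -
      have "(\<lambda>s. indicator {\<tau> j<..} s * (\<integral>\<^sup>+y. emeasure (W 0) (?H j y \<inter> ?A y s) \<partial>lborel)) \<in> borel_measurable lborel" for j
        using Jm[of j] by (intro borel_measurable_times_ennreal borel_measurable_indicator) auto
      moreover have "(\<integral>\<^sup>+s. f s + g s + (\<Sum>j\<in>J. h j s) \<partial>lborel) = (\<integral>\<^sup>+s. f s \<partial>lborel) + (\<integral>\<^sup>+s. g s \<partial>lborel) + (\<Sum>j\<in>J. \<integral>\<^sup>+s. h j s \<partial>lborel)"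
        if "f \<in> borel_measurable lborel" "g \<in> borel_measurable lborel" "\<And>j. h j \<in> borel_measurable lborel"
        for f g :: "real \<Rightarrow> ennreal" and h :: "nat \<Rightarrow> real \<Rightarrow> ennreal" and J
        using that by (simp add: nn_integral_add nn_integral_sum)
      ultimately show ?thesis unfolding I_def by (simp only: borel_measurable_times_ennreal borel_measurable_indicator borel_measurable_const greaterThanAtMost_borel sets_lborel)
    qed
    also have "\<dots> = ennreal (\<eta> * bv \<delta>) + ennreal (?t * bv \<delta> * q) + (\<Sum>j\<in>{1..m}. I j)"
      using \<eta> bv_pos[OF \<delta>(1)] q0 by (simp add: nn_integral_cmult_indicator ennreal_mult'[symmetric] mult_ac)
    also have "(\<Sum>j\<in>{1..m}. I j) \<le> (\<Sum>j\<in>{1..m}. ennreal (bv \<delta> * G) * (\<integral>\<^sup>+y. emeasure (W 0) (?H j y) \<partial>lborel) + ennreal (S * bv r) * (if j = 1 then 1 else ennreal q))"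
      by (rule sum_mono[OF Ij])
    also have "\<dots> = ennreal (bv \<delta> * G) * (\<Sum>j\<in>{1..m}. \<integral>\<^sup>+y. emeasure (W 0) (?H j y) \<partial>lborel) + ennreal (S * bv r) * (\<Sum>j\<in>{1..m}. (if j = 1 then 1 else ennreal q))"
      by (simp only: sum.distrib sum_distrib_left)
    also have "\<dots> \<le> ennreal (bv \<delta> * G) * ennreal (vol r 0 ?t) + ennreal (S * bv r) * ennreal (1 + real m * q)"
      by (intro add_mono mult_left_mono sumH sumq) auto
    also have "\<dots> = ennreal (bv \<delta> * G * vol r 0 ?t) + ennreal (S * bv r * (1 + real m * q))"
      using vol_nonneg[of r 0 ?t] q0 by (intro arg_cong2[where f="(+)"] ennreal_mult''[symmetric]) auto
    finally show ?thesis by (simp add: add.assoc add_mono)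
  qed
  show ?thesis
  proof (rule that)
    \<comment> \<open>The summand 1 only serves to make the constant positive.\<close>
    show "0 < S * bv r + 1" using S0 bv_pos[OF r] by (simp add: add_nonneg_pos)
    fix \<eta> :: real and m :: nat assume \<eta>: "0 < \<eta>"
    define q where "q = 2 powr (real DIM('a) / 2) * exp (- \<delta>\<^sup>2 / \<eta>)"
    have q0: "0 \<le> q" unfolding q_def by simp
    have nn: "0 \<le> \<eta> * bv \<delta>" "0 \<le> real m * \<eta> * bv \<delta> * q" "0 \<le> bv \<delta> * G * vol r 0 (real m * \<eta>)" "0 \<le> S * bv r * (1 + real m * q)"
      using \<eta> bv_pos[OF \<delta>(1)] bv_pos[OF r] q0 G0 S0 vol_nonneg[of r 0 "real m * \<eta>"] by simp_all
    have "ennreal (real m * \<eta> * bv \<delta>) \<le> ennreal (\<eta> * bv \<delta> + real m * \<eta> * bv \<delta> * q + bv \<delta> * G * vol r 0 (real m * \<eta>) + S * bv r * (1 + real m * q))"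
      using main[OF \<eta> q_def, of m] nn by (simp add: ennreal_plus)
    then have "real m * \<eta> * bv \<delta> \<le> \<eta> * bv \<delta> + real m * \<eta> * bv \<delta> * q + bv \<delta> * G * vol r 0 (real m * \<eta>) + S * bv r * (1 + real m * q)"
      using nn by (subst (asm) ennreal_le_iff) auto
    moreover have "S * bv r * (1 + real m * q) \<le> (S * bv r + 1) * (1 + real m * q)" using q0 by (intro mult_right_mono) auto
    ultimately show "real m * \<eta> * bv \<delta> \<le> \<eta> * bv \<delta> + real m * \<eta> * bv \<delta> * (2 powr (real DIM('a) / 2) * exp (- \<delta>\<^sup>2 / \<eta>))
      + bv \<delta> * newton_potential DIM('a) {0<..} (r - 3 * \<delta>) * vol r 0 (real m * \<eta>)
      + (S * bv r + 1) * (1 + real m * (2 powr (real DIM('a) / 2) * exp (- \<delta>\<^sup>2 / \<eta>)))"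
      unfolding q_def[symmetric] G_def[symmetric] by linarith
  qed
qed

end

text \<open>Stands for dividing by \<open>n\<close> and letting \<open>n\<close> tend to
  infinity.\<close>

lemma nonpos_if_multiples_bounded: "(\<And>n::nat. real n * e \<le> B) \<Longrightarrow> e \<le> (0::real)"
proof (rule ccontr)
  assume *: "\<And>n::nat. real n * e \<le> B" and "\<not> e \<le> 0"
  then have e: "e > 0" by simp
  obtain n :: nat where "B / e < real n" using reals_Archimedean2 by blast
  then have "B < real n * e" using e by (simp add: pos_divide_less_eq)
  then show False using *[of n] by simp
qed

section \<open>Brownian increments against the capacity\<close>

context brownian
begin

text \<open>By \<open>vol_increment\<close> the volume at time \<open>u + n * h\<close> is
  \<open>n * a\<close> up to \<open>n * K\<close> and a constant, \<open>a\<close> being one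
  increment. Inserting this into both capacity bounds and dividing by \<open>n\<close> encloses
  \<open>a\<close> between \<open>h / G - K\<close> and \<open>h / G + K\<close>; thus the error is
  governed by \<open>u\<close> alone, no rate of convergence of the volume being needed.\<close>

lemma vol_increment_capacity:
  assumes r: "0 < r"
  shows "\<exists>C>0. \<forall>u\<ge>1. \<forall>h\<in>{0..1}. \<bar>vol r 0 (u + h) - vol r 0 u - h * newton_cap_ball DIM('a) r\<bar> \<le> C / u\<^sup>2"
proof -
  obtain C where C: "C > 0" "\<And>u h n. u \<ge> 1 \<Longrightarrow> h \<in> {0..1} \<Longrightarrow>
     \<bar>vol r 0 (u + real n * h) - vol r 0 u - real n * (vol r 0 (u + h) - vol r 0 u)\<bar> \<le> real n * (C / u\<^sup>2)"
    using vol_increment[of r] by blast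
  define G where "G = newton_potential DIM('a) {0<..} r"
  have G0: "0 \<le> G" unfolding G_def by (rule newton_potential_nonneg)
  have "\<bar>vol r 0 (u + h) - vol r 0 u - h * (1 / G)\<bar> \<le> C / u\<^sup>2" if u: "u \<ge> 1" and h: "h \<in> {0..1}" for u h
  proof (cases "h = 0")
    case True
    then show ?thesis using C(1) by simp
  next
    case False
    then have h0: "h > 0" using h by simp
    define a where "a = vol r 0 (u + h) - vol r 0 u"
    define K where "K = C / u\<^sup>2"
    have K: "K > 0" unfolding K_def using C(1) u by simp
    have a0: "a \<ge> 0" unfolding a_def using vol_newly[of u "u + h" 0 r] u h0 by simp
    have vn: "\<bar>vol r 0 (u + real n * h) - vol r 0 u - real n * a\<bar> \<le> real n * K" for n
      using C(2)[OF u h, of n] unfolding a_def K_def .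
    \<comment> \<open>\<open>capacity_upper\<close> at time \<open>u + n * h\<close>; its additive
      error \<open>k\<close> is lost on division by \<open>n\<close>.\<close>
    have up: "(a - K) * newton_potential DIM('a) {0<..k} (r + \<delta>) \<le> h" if "0 < k" "0 < \<delta>" for k \<delta>
    proof -
      let ?g = "newton_potential DIM('a) {0<..k} (r + \<delta>)"
      have g0: "0 \<le> ?g" by (rule newton_potential_nonneg)
      have "real n * ((a - K) * ?g - h) \<le> u + k" for n
      proof -
        have "real n * (a - K) \<le> vol r 0 (u + real n * h)" using vn[of n] vol_nonneg[of r 0 u] by (simp add: algebra_simps abs_le_iff)
        then have "real n * (a - K) * ?g \<le> vol r 0 (u + real n * h) * ?g" using g0 by (rule mult_right_mono)
        also have "\<dots> \<le> u + real n * h + k" using that r u h0 by (intro capacity_upper) (auto intro!: add_pos_nonneg)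
        finally show ?thesis by (simp add: algebra_simps)
      qed
      then have "(a - K) * ?g - h \<le> 0" by (rule nonpos_if_multiples_bounded)
      then show ?thesis by simp
    qed
    have U: "(a - K) * G \<le> h"
    proof (rule LIMSEQ_le_const2)
      have "(\<lambda>n. newton_potential DIM('a) {0<..real (Suc n)} (r + 1 / real (Suc n))) \<longlonglongrightarrow> G"
        unfolding G_def
      proof (rule newton_potential_tendsto[OF dim r])
        have "(\<lambda>n. r + inverse (real (Suc n))) \<longlonglongrightarrow> r + 0" by (intro tendsto_intros LIMSEQ_inverse_real_of_nat)
        then show "(\<lambda>n. r + 1 / real (Suc n)) \<longlonglongrightarrow> r" by (simp add: inverse_eq_divide)
        show "\<forall>\<^sub>F n in sequentially. s \<in> {0<..real (Suc n)}" if s: "0 < s" for s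
        proof -
          obtain N :: nat where "s < real N" using reals_Archimedean2 by blast
          then show ?thesis using s by (intro eventually_sequentiallyI[of N]) auto
        qed
        show "r / 2 \<le> r + 1 / real (Suc n)" for n using r by (simp add: add_increasing2)
      qed (use r in auto)
      then show "(\<lambda>n. (a - K) * newton_potential DIM('a) {0<..real (Suc n)} (r + 1 / real (Suc n))) \<longlonglongrightarrow> (a - K) * G"
        by (intro tendsto_intros)
      show "\<exists>N. \<forall>n\<ge>N. (a - K) * newton_potential DIM('a) {0<..real (Suc n)} (r + 1 / real (Suc n)) \<le> h"
        by (intro exI allI impI up) auto
    qed
    have lo: "h \<le> (a + K) * newton_potential DIM('a) {0<..} (r - 3 * \<delta>)" if \<delta>: "0 < \<delta>" "3 * \<delta> < r" for \<delta>
    proof -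
      define v where "v = bv \<delta>"
      define g where "g = newton_potential DIM('a) {0<..} (r - 3 * \<delta>)"
      define c2 where "c2 = 2 powr (real DIM('a) / 2)"
      have v: "v > 0" unfolding v_def using bv_pos[OF \<delta>(1)] .
      have g0: "0 \<le> g" unfolding g_def by (rule newton_potential_nonneg)
      have c2: "c2 > 0" unfolding c2_def by simp
      obtain c where c: "0 < c" "\<And>\<eta> m. 0 < \<eta> \<Longrightarrow> real m * \<eta> * v \<le> \<eta> * v + real m * \<eta> * v * (c2 * exp (- \<delta>\<^sup>2 / \<eta>)) + v * g * vol r 0 (real m * \<eta>) + c * (1 + real m * (c2 * exp (- \<delta>\<^sup>2 / \<eta>)))"
        using capacity_lower[OF \<delta>] unfolding v_def g_def c2_def by blast
      \<comment> \<open>For a fixed mesh \<open>\<eta>\<close>: the grid with \<open>m\<close> the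
        floor of \<open>T / \<eta>\<close> ends within \<open>\<eta>\<close> of
        \<open>T = u + n * h\<close>. Terms constant in \<open>n\<close> disappear and the
        oscillation error proportional to \<open>n\<close> stays.\<close>
      have step: "h * v - v * g * (a + K) \<le> h * q * (v + c / \<eta>)" if \<eta>: "0 < \<eta>" and q: "q = c2 * exp (- \<delta>\<^sup>2 / \<eta>)" for \<eta> q
      proof -
        have q0: "0 \<le> q" unfolding q using c2 by simp
        have "real n * (h * v - v * g * (a + K) - h * q * (v + c / \<eta>)) \<le> 2 * \<eta> * v + u * v * q + v * g * vol r 0 u + c + c * q * u / \<eta>" for n
        proof -
          define T where "T = u + real n * h"
          have T: "T > 0" unfolding T_def using u h0 by (simp add: add_pos_nonneg)
          define m where "m = nat \<lfloor>T / \<eta>\<rfloor>"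
          have m1: "real m \<le> T / \<eta>" unfolding m_def using T \<eta> by simp
          have "T / \<eta> < real m + 1" unfolding m_def using T \<eta> by (simp add: of_nat_nat)
          then have m2: "T - \<eta> \<le> real m * \<eta>" using \<eta> by (simp add: pos_divide_less_eq algebra_simps)
          have m3: "real m * \<eta> \<le> T" using m1 \<eta> by (simp add: pos_le_divide_eq)
          have "vol r 0 (real m * \<eta>) \<le> vol r 0 T" using vol_newly[of "real m * \<eta>" T 0 r] m3 \<eta> by simp
          also have "\<dots> \<le> vol r 0 u + real n * (a + K)" using vn[of n] unfolding T_def by (simp add: algebra_simps abs_le_iff)
          finally have "v * g * vol r 0 (real m * \<eta>) \<le> v * g * (vol r 0 u + real n * (a + K))"
            using v g0 by (intro mult_left_mono) auto
          moreover have "real m * \<eta> * v * q \<le> T * v * q" using m3 v q0 by (intro mult_right_mono) auto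
          moreover have "c * (1 + real m * q) \<le> c * (1 + T / \<eta> * q)" using m1 c(1) q0 by (intro mult_left_mono add_left_mono mult_right_mono) auto
          moreover have "(T - \<eta>) * v \<le> real m * \<eta> * v" using m2 v by (intro mult_right_mono) auto
          ultimately have "(T - \<eta>) * v \<le> \<eta> * v + T * v * q + v * g * (vol r 0 u + real n * (a + K)) + c * (1 + T / \<eta> * q)"
            using c(2)[OF \<eta>, of m] unfolding q[symmetric] by linarith
          moreover have "(T - \<eta>) * v = u * v + real n * (h * v) - \<eta> * v" unfolding T_def by (simp add: algebra_simps)
          moreover have "T * v * q = u * v * q + real n * (h * q * v)" unfolding T_def by (simp add: algebra_simps)
          moreover have "v * g * (vol r 0 u + real n * (a + K)) = v * g * vol r 0 u + real n * (v * g * (a + K))" by (simp only: distrib_left mult.left_commute)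
          moreover have "c * (1 + T / \<eta> * q) = c + c * q * u / \<eta> + real n * (h * q * (c / \<eta>))" unfolding T_def using \<eta> by (simp add: field_simps)
          moreover have "0 \<le> u * v" using u v by simp
          ultimately have "real n * (h * v) - real n * (v * g * (a + K)) - real n * (h * q * v) - real n * (h * q * (c / \<eta>)) \<le> 2 * (\<eta> * v) + u * v * q + v * g * vol r 0 u + c + c * q * u / \<eta>"
            by linarith
          then show ?thesis by (simp add: right_diff_distrib distrib_left)
        qed
        then have "h * v - v * g * (a + K) - h * q * (v + c / \<eta>) \<le> 0" by (rule nonpos_if_multiples_bounded)
        then show ?thesis by simp
      qed
      \<comment> \<open>Now the mesh tends to 0 through \<open>\<eta> = 1 / n\<close>. The error is
        of order \<open>n * exp (- \<delta>\<^sup>2 * n)\<close>, and even \<open>n\<close> times it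
        stays bounded: \<open>x\<^sup>2 / 2 \<le> exp x\<close> with
        \<open>x = \<delta>\<^sup>2 * n\<close> gives \<open>2 / \<delta> ^ 4\<close>.\<close>
      have "real n * (h * v - v * g * (a + K)) \<le> h * (v + c) * c2 * (2 / \<delta> ^ 4)" for n :: nat
      proof (cases "n = 0")
        case True
        then show ?thesis using h0 v c(1) c2 by (simp del: of_nat_0_le_iff)
      next
        case False
        then have n: "1 \<le> real n" by simp
        define e where "e = exp (- \<delta>\<^sup>2 * real n)"
        have e0: "e > 0" unfolding e_def by simp
        have "(\<delta>\<^sup>2 * real n)\<^sup>2 / fact 2 \<le> exp (\<delta>\<^sup>2 * real n)" by (intro power_div_fact_le_exp) simp
        then have "(\<delta>\<^sup>2 * real n)\<^sup>2 / 2 * e \<le> exp (\<delta>\<^sup>2 * real n) * e" using e0 by (intro mult_right_mono) auto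
        also have "\<dots> = 1" unfolding e_def exp_add[symmetric] by simp
        finally have "\<delta> ^ 4 * (real n * real n * e) \<le> 2" by (simp add: power_mult_distrib power2_eq_square power4_eq_xxxx mult_ac)
        then have ne: "real n * real n * e \<le> 2 / \<delta> ^ 4" using \<delta>(1) by (simp add: pos_le_divide_eq mult.commute)
        have "h * v - v * g * (a + K) \<le> h * (c2 * e) * (v + c * real n)"
          using step[of "1 / real n" "c2 * e"] n unfolding e_def by simp
        also have "\<dots> \<le> h * (c2 * e) * (v * real n + c * real n)"
          using h0 c2 e0 v n by (intro mult_left_mono add_right_mono) auto
        finally have "real n * (h * v - v * g * (a + K)) \<le> real n * (h * (c2 * e) * (v * real n + c * real n))"
          using n by (intro mult_left_mono) auto
        also have "\<dots> = h * (v + c) * c2 * (real n * real n * e)" by (simp add: algebra_simps)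
        also have "\<dots> \<le> h * (v + c) * c2 * (2 / \<delta> ^ 4)" using ne h0 v c(1) c2 by (intro mult_left_mono) auto
        finally show ?thesis .
      qed
      then have "h * v - v * g * (a + K) \<le> 0" by (rule nonpos_if_multiples_bounded)
      then have "v * h \<le> v * ((a + K) * g)" by (simp add: algebra_simps)
      then show ?thesis using v unfolding g_def by simp
    qed
    have L: "h \<le> (a + K) * G"
    proof (rule LIMSEQ_le_const)
      \<comment> \<open>The factor 1/6 keeps \<open>r - 3 * ?d n\<close> above \<open>r / 2\<close>,
        as \<open>newton_potential_tendsto\<close> requires.\<close>
      let ?d = "\<lambda>n. r / 6 / real (Suc n)"
      have "(\<lambda>n. newton_potential DIM('a) {0<..} (r - 3 * ?d n)) \<longlonglongrightarrow> G"
        unfolding G_def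
      proof (rule newton_potential_tendsto[OF dim r])
        have "(\<lambda>n. r - 3 * (r / 6 * inverse (real (Suc n)))) \<longlonglongrightarrow> r - 3 * (r / 6 * 0)" by (intro tendsto_intros LIMSEQ_inverse_real_of_nat)
        moreover have "r - 3 * (r / 6 * inverse (real (Suc n))) = r - 3 * ?d n" for n by (simp only: divide_inverse mult.assoc)
        ultimately show "(\<lambda>n. r - 3 * ?d n) \<longlonglongrightarrow> r" by (simp only: mult_zero_right diff_zero)
        show "r / 2 \<le> r - 3 * ?d n" for n
        proof -
          have "r / 6 / real (Suc n) \<le> r / 6 / 1" using r by (intro divide_left_mono) auto
          then show ?thesis by linarith
        qed
      qed (use r in auto)
      then show "(\<lambda>n. (a + K) * newton_potential DIM('a) {0<..} (r - 3 * ?d n)) \<longlonglongrightarrow> (a + K) * G"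
        by (intro tendsto_intros)
      have "3 * ?d n < r" "0 < ?d n" for n
      proof -
        have "r / 6 / real (Suc n) \<le> r / 6 / 1" using r by (intro divide_left_mono) auto
        then show "3 * ?d n < r" using r by linarith
        show "0 < ?d n" using r by simp
      qed
      then show "\<exists>N. \<forall>n\<ge>N. h \<le> (a + K) * newton_potential DIM('a) {0<..} (r - 3 * ?d n)"
        by (intro exI allI impI lo) auto
    qed
    have "G \<noteq> 0" using L h0 by auto
    then have Gp: "G > 0" using G0 by simp
    have "a - K \<le> h / G" "h / G \<le> a + K" using U L Gp by (simp_all add: pos_le_divide_eq pos_divide_le_eq)
    then show ?thesis unfolding a_def[symmetric] K_def[symmetric] by (simp add: abs_le_iff)
  qed
  moreover have "newton_cap_ball DIM('a) r = 1 / G"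
    unfolding newton_cap_ball_def G_def newton_potential_def newton_density_def ..
  ultimately show ?thesis using C(1) by auto
qed

end

section \<open>Bounded modifications\<close>

definition hit_set :: "'a set \<Rightarrow> (real \<Rightarrow> 'a) \<Rightarrow> real set" where
  "hit_set D \<omega> = {s. 0 \<le> s \<and> \<omega> s \<in> D}"

lemma bdd_below_hit_set: "bdd_below (hit_set D \<omega>)"
  by (rule bdd_belowI[of _ 0]) (simp add: hit_set_def)

text \<open>Identifies the pointwise definition with stopping at the infimum of the hitting times.
  The empty case is separate because the infimum of the empty set carries no information. If
  \<open>t\<close> does not exceed the infimum but a hit occurs up to \<open>t\<close>, both times
  coincide.\<close>

lemma stopped_at_eq:
  assumes w: "\<omega> \<in> cpaths"
  shows "stopped_at D \<omega> = (if hit_set D \<omega> = {} then \<omega> else stop_path (Inf (hit_set D \<omega>)) \<omega>)"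
proof
  fix t
  let ?S = "hit_set D \<omega>"
  have ex: "(\<exists>s\<in>{0..t}. \<omega> s \<in> D) \<longleftrightarrow> (\<exists>s\<in>?S. s \<le> t)" by (auto simp: hit_set_def)
  have st: "stopped_at D \<omega> t = (if \<exists>s\<in>?S. s \<le> t then \<omega> (Inf ?S) else \<omega> t)"
    unfolding stopped_at_def ex unfolding hit_set_def ..
  show "stopped_at D \<omega> t = (if ?S = {} then \<omega> else stop_path (Inf ?S) \<omega>) t"
  proof (cases "?S = {}")
    case True
    then show ?thesis unfolding st by simp
  next
    case False
    show ?thesis
    proof (cases "t \<le> Inf ?S")
      case True
      have "\<omega> (Inf ?S) = \<omega> t" if "s \<in> ?S" "s \<le> t" for s
      proof -
        have "Inf ?S \<le> s" using that by (intro cInf_lower bdd_below_hit_set) auto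
        then have "Inf ?S = t" using True that by auto
        then show ?thesis by simp
      qed
      then have "stopped_at D \<omega> t = \<omega> t" unfolding st by auto
      then show ?thesis using False True by (simp add: stop_path_def min_absorb1)
    next
      case 2: False
      then obtain s where "s \<in> ?S" "s < t" using cInf_lessD[OF False, of t] by auto
      then have "stopped_at D \<omega> t = \<omega> (Inf ?S)" unfolding st by auto
      then show ?thesis using False 2 by (simp add: stop_path_def min_absorb2)
    qed
  qed
qed

lemma hitting_time_nonneg: "hit_set D \<omega> \<noteq> {} \<Longrightarrow> 0 \<le> Inf (hit_set D \<omega>)"
  by (rule cInf_greatest) (auto simp: hit_set_def)

lemma stopped_at_cpaths: "\<omega> \<in> cpaths \<Longrightarrow> stopped_at D \<omega> \<in> cpaths"
  by (simp add: stopped_at_eq stop_path_cpaths hitting_time_nonneg)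

text \<open>The stopped path at \<open>t\<close> is the path evaluated at the random time
  \<open>\<sigma>\<close>, the minimum of \<open>t\<close> and the hitting time. For
  \<open>c \<le> t\<close> the event \<open>\<sigma> \<omega> < c\<close> is a union of hitting
  events of the open set \<open>D\<close> over rational times, and
  \<open>path_eval_measurable\<close> does the rest.\<close>

lemma measurable_stopped_at:
  fixes D :: "'a::euclidean_space set"
  assumes D: "open D"
  shows "stopped_at D \<in> path_space \<rightarrow>\<^sub>M path_space"
proof (rule measurable_path_spaceI)
  show "stopped_at D \<omega> \<in> cpaths" if "\<omega> \<in> space path_space" for \<omega> :: "real \<Rightarrow> 'a" using that by (simp add: stopped_at_cpaths)
  fix t :: real
  define \<sigma> where "\<sigma> \<omega> = (if hit_set D \<omega> = {} then t else min t (Inf (hit_set D \<omega>)))" for \<omega> :: "real \<Rightarrow> 'a"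
  have eq: "stopped_at D \<omega> t = \<omega> (\<sigma> \<omega>)" if "\<omega> \<in> cpaths" for \<omega>
    unfolding stopped_at_eq[OF that] \<sigma>_def by (simp add: stop_path_def)
  have lt: "\<sigma> \<omega> < c \<longleftrightarrow> t < c \<or> (\<exists>q\<in>\<rat> \<inter> {0..<c}. \<omega> \<in> hits D 0 q)" if w: "\<omega> \<in> cpaths" for \<omega> :: "real \<Rightarrow> 'a" and c
  proof
    assume "\<sigma> \<omega> < c"
    show "t < c \<or> (\<exists>q\<in>\<rat> \<inter> {0..<c}. \<omega> \<in> hits D 0 q)"
    proof (cases "t < c")
      case False
      then have ne: "hit_set D \<omega> \<noteq> {}" and "Inf (hit_set D \<omega>) < c"
        using \<open>\<sigma> \<omega> < c\<close> unfolding \<sigma>_def by (auto split: if_splits)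
      then obtain s where s: "0 \<le> s" "\<omega> s \<in> D" "s < c" using cInf_lessD[OF ne, of c] by (auto simp: hit_set_def)
      obtain q where "q \<in> \<rat>" "s < q" "q < c" using Rats_dense_in_real[OF s(3)] by blast
      then show ?thesis using s w by (intro disjI2 bexI[of _ q]) (auto simp: hits_def)
    qed simp
  next
    assume "t < c \<or> (\<exists>q\<in>\<rat> \<inter> {0..<c}. \<omega> \<in> hits D 0 q)"
    then show "\<sigma> \<omega> < c"
    proof
      assume "\<exists>q\<in>\<rat> \<inter> {0..<c}. \<omega> \<in> hits D 0 q"
      then obtain s where s: "0 \<le> s" "s < c" "\<omega> s \<in> D" by (auto simp: hits_def)
      have "Inf (hit_set D \<omega>) \<le> s" using s by (intro cInf_lower bdd_below_hit_set) (simp add: hit_set_def)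
      moreover have "hit_set D \<omega> \<noteq> {}" using s by (auto simp: hit_set_def)
      ultimately show ?thesis using s unfolding \<sigma>_def by auto
    qed (auto simp: \<sigma>_def)
  qed
  have "\<sigma> \<in> borel_measurable path_space"
  proof (rule borel_measurableI_less)
    fix c
    have "{\<omega>\<in>space path_space. \<sigma> \<omega> < c} = (if t < c then cpaths else (\<Union>q\<in>\<rat> \<inter> {0..<c}. hits D 0 q))"
      using lt by (auto simp: hits_def)
    moreover have "(\<Union>q\<in>\<rat> \<inter> {0..<c}. hits D 0 q) \<in> sets path_space"
      by (intro sets.countable_UN'' hits_sets D) (auto intro: countable_subset[OF _ countable_rat])
    ultimately show "{\<omega>\<in>space path_space. \<sigma> \<omega> < c} \<in> sets path_space"
      using sets.top[of "path_space :: (real \<Rightarrow> 'a) measure"] by simp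
  qed
  then have "(\<lambda>\<omega>. (\<omega>, \<sigma> \<omega>)) \<in> path_space \<rightarrow>\<^sub>M path_space \<Otimes>\<^sub>M borel" by simp
  from measurable_compose[OF this path_eval_measurable]
  have "(\<lambda>\<omega>. \<omega> (\<sigma> \<omega>)) \<in> path_space \<rightarrow>\<^sub>M borel" by simp
  then show "(\<lambda>\<omega>. stopped_at D \<omega> t) \<in> path_space \<rightarrow>\<^sub>M borel"
    by (rule measurable_cong[THEN iffD1, rotated]) (simp add: eq)
qed

text \<open>At its hitting time of an open set the path lies in the closure and possibly not in the
  set. Requiring \<open>B\<close> to contain the closure makes the hit of \<open>B\<close> visible
  to the stopped path, and a path that avoids \<open>B\<close> up to \<open>b\<close> has not been
  stopped by then.\<close>

lemma stopped_at_hits: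
  fixes D :: "'a::metric_space set"
  assumes w: "\<omega> \<in> cpaths" and DB: "closure D \<subseteq> B"
  shows "stopped_at D \<omega> \<in> hits B 0 b \<longleftrightarrow> \<omega> \<in> hits B 0 b"
    and "\<omega> \<notin> hits B 0 b \<Longrightarrow> s \<le> b \<Longrightarrow> 0 \<le> b \<Longrightarrow> stopped_at D \<omega> s = \<omega> s"
proof -
  let ?S = "(hit_set D \<omega>)" and ?T = "Inf (hit_set D \<omega>)"
  have T: "\<omega> ?T \<in> B" if ne: "?S \<noteq> {}"
  proof -
    have "?T \<in> closure ?S" using ne by (intro closure_contains_Inf bdd_below_hit_set)
    then have "\<omega> ?T \<in> \<omega> ` closure ?S" by (rule imageI)
    also have "\<omega> ` closure ?S \<subseteq> closure D"
      by (rule image_closure_subset[OF cpaths_cont[OF w]]) (auto simp: hit_set_def intro: closure_subset[THEN subsetD])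
    finally show ?thesis using DB by blast
  qed
  show "stopped_at D \<omega> \<in> hits B 0 b \<longleftrightarrow> \<omega> \<in> hits B 0 b"
  proof (cases "?S = {}")
    case True
    then show ?thesis by (simp add: stopped_at_eq[OF w])
  next
    case False
    then have e: "stopped_at D \<omega> s = \<omega> (min s ?T)" for s by (simp add: stopped_at_eq[OF w] stop_path_def)
    have T0: "0 \<le> ?T" by (rule hitting_time_nonneg[OF False])
    show ?thesis
    proof
      assume "stopped_at D \<omega> \<in> hits B 0 b"
      then obtain s where s: "0 \<le> s" "s \<le> b" "\<omega> (min s ?T) \<in> B" by (auto simp: hits_def e)
      then show "\<omega> \<in> hits B 0 b" using w T0 unfolding hits_def by (auto intro!: bexI[of _ "min s ?T"])
    next
      assume "\<omega> \<in> hits B 0 b"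
      then obtain s where s: "0 \<le> s" "s \<le> b" "\<omega> s \<in> B" by (auto simp: hits_def)
      have "stopped_at D \<omega> s \<in> B" using s T[OF False] unfolding e by (simp add: min_def)
      then show "stopped_at D \<omega> \<in> hits B 0 b" using s stopped_at_cpaths[OF w] unfolding hits_def by auto
    qed
  qed
  assume n: "\<omega> \<notin> hits B 0 b" and s: "s \<le> b" and b: "0 \<le> b"
  show "stopped_at D \<omega> s = \<omega> s"
  proof (cases "?S = {}")
    case True
    then show ?thesis by (simp add: stopped_at_eq[OF w])
  next
    case False
    have "b < ?T"
    proof (rule ccontr)
      assume "\<not> b < ?T"
      then have "\<omega> \<in> hits B 0 b" using T[OF False] w hitting_time_nonneg[OF False] unfolding hits_def by auto
      then show False using n by simp
    qed
    then show ?thesis using False s by (simp add: stopped_at_eq[OF w] stop_path_def)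
  qed
qed

text \<open>Off the visits to \<open>B\<close> the event is decided by the stopped path, so its
  probability is determined by the law that bounded modification preserves.\<close>

lemma stopped_at_newly:
  fixes D :: "'a::metric_space set"
  assumes DB: "closure D \<subseteq> B" and b: "0 \<le> b" "u \<le> b" "v \<le> b"
  shows "stopped_at D -` (newly r u v y - hits B 0 b) \<inter> cpaths = newly r u v y - hits B 0 b"
proof -
  have "stopped_at D \<omega> \<in> hits A 0 c \<longleftrightarrow> \<omega> \<in> hits A 0 c" if w: "\<omega> \<in> cpaths" and n: "\<omega> \<notin> hits B 0 b" and c: "c \<le> b" for \<omega> A c
  proof -
    have "stopped_at D \<omega> s = \<omega> s" if "s \<in> {0..c}" for s
      using that c by (intro stopped_at_hits(2)[OF w DB n _ b(1)]) auto
    then show ?thesis using w stopped_at_cpaths[OF w] unfolding hits_def by auto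
  qed
  moreover have "newly r u v y \<subseteq> cpaths" unfolding newly_def hits_def by auto
  ultimately show ?thesis using stopped_at_hits(1)[OF _ DB, of _ b] b unfolding newly_def by blast
qed

text \<open>The two measures restricted to the complement of \<open>D\<close> coincide, and
  \<open>f\<close> does not see \<open>D\<close>.\<close>

lemma nn_integral_eq_off:
  fixes \<mu> \<nu> :: "'a::euclidean_space measure"
  assumes s [measurable_cong]: "sets \<mu> = sets borel" "sets \<nu> = sets borel" and D: "D \<in> sets borel"
    and eq: "\<And>A. A \<in> sets borel \<Longrightarrow> A \<subseteq> - D \<Longrightarrow> emeasure \<mu> A = emeasure \<nu> A"
    and f: "f \<in> borel_measurable borel" "\<And>y. y \<in> D \<Longrightarrow> f y = 0"
  shows "(\<integral>\<^sup>+y. f y \<partial>\<mu>) = (\<integral>\<^sup>+y. f y \<partial>\<nu>)"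
proof -
  have cD: "- D \<in> sets \<mu>" "- D \<in> sets \<nu>" using D s by auto
  have "density \<mu> (indicator (- D)) = density \<nu> (indicator (- D))"
  proof (rule measure_eqI)
    fix A assume "A \<in> sets (density \<mu> (indicator (- D)))"
    then have A: "A \<in> sets borel" using s by simp
    have "emeasure M (A \<inter> - D) = emeasure (density M (indicator (- D))) A" if "sets M = sets borel" for M :: "'a measure"
      using that A D by (subst emeasure_density) (auto simp: indicator_inter_arith[symmetric] Int_commute)
    then show "emeasure (density \<mu> (indicator (- D))) A = emeasure (density \<nu> (indicator (- D))) A"
      using s eq[of "A \<inter> - D"] A D by auto
  qed (use s in simp)
  moreover have "(\<integral>\<^sup>+y. f y \<partial>M) = (\<integral>\<^sup>+y. f y \<partial>density M (indicator (- D)))" if M: "sets M = sets borel" for M :: "'a measure"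
  proof -
    have fm: "f \<in> borel_measurable M" using f(1) M by (simp cong: measurable_cong_sets)
    have "(\<integral>\<^sup>+y. f y \<partial>density M (indicator (- D))) = (\<integral>\<^sup>+y. indicator (- D) y * f y \<partial>M)"
      using fm D M by (intro nn_integral_density) auto
    also have "\<dots> = (\<integral>\<^sup>+y. f y \<partial>M)" using f(2) by (intro nn_integral_cong) (auto split: split_indicator)
    finally show ?thesis by simp
  qed
  ultimately show ?thesis using s by metis
qed

text \<open>Steps of length 1 give a summable series along the integers; steps of length less than 1
  show that the values in between follow.\<close>

lemma convergent_of_square_increments:
  fixes g :: "real \<Rightarrow> real"
  assumes "\<And>n h. 2 \<le> n \<Longrightarrow> h \<in> {0..1} \<Longrightarrow> \<bar>g (real n + h) - g (real n)\<bar> \<le> C / (real n)\<^sup>2"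
  shows "\<exists>L. (g \<longlongrightarrow> L) at_top"
proof -
  have "summable (\<lambda>n. g (real (Suc n)) - g (real n))"
  proof (rule summable_comparison_test'[where N=2])
    show "summable (\<lambda>n. C * inverse ((real n)\<^sup>2))" by (intro summable_mult inverse_power_summable) simp
    show "norm (g (real (Suc n)) - g (real n)) \<le> C * inverse ((real n)\<^sup>2)" if "2 \<le> n" for n
      using assms[OF that, of 1] by (simp add: divide_inverse add.commute)
  qed
  then have "convergent (\<lambda>n. \<Sum>k<n. g (real (Suc k)) - g (real k))" by (simp add: summable_iff_convergent)
  then have "convergent (\<lambda>n. g (real n) - g (real 0))"
    using sum_lessThan_telescope[of "\<lambda>n. g (real n)"] by simp
  then obtain L where "(\<lambda>n. g (real n) - g (real 0)) \<longlonglongrightarrow> L" unfolding convergent_def by blast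
  then have "(\<lambda>n. g (real n) - g (real 0) + g (real 0)) \<longlonglongrightarrow> L + g (real 0)" by (intro tendsto_intros)
  then have L: "(\<lambda>n. g (real n)) \<longlonglongrightarrow> L + g 0" by simp
  have fl: "filterlim (\<lambda>t::real. nat \<lfloor>t\<rfloor>) sequentially at_top"
    by (intro filterlim_compose[OF filterlim_nat_sequentially] filterlim_floor_sequentially)
  have 1: "((\<lambda>t::real. g (real (nat \<lfloor>t\<rfloor>))) \<longlongrightarrow> L + g 0) at_top" by (rule filterlim_compose[OF L fl])
  have "(\<lambda>n. C * inverse ((real n)\<^sup>2)) \<longlonglongrightarrow> 0"
    by (intro summable_LIMSEQ_zero summable_mult inverse_power_summable) simp
  then have 2: "((\<lambda>t::real. C * inverse ((real (nat \<lfloor>t\<rfloor>))\<^sup>2)) \<longlongrightarrow> 0) at_top" by (rule filterlim_compose[OF _ fl])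
  have "((\<lambda>t. g t - g (real (nat \<lfloor>t\<rfloor>))) \<longlongrightarrow> 0) at_top"
  proof (rule Lim_null_comparison[OF _ 2])
    show "\<forall>\<^sub>F t in at_top. norm (g t - g (real (nat \<lfloor>t\<rfloor>))) \<le> C * inverse ((real (nat \<lfloor>t\<rfloor>))\<^sup>2)"
      using eventually_ge_at_top[of 2]
    proof eventually_elim
      case (elim t)
      define n where "n = nat \<lfloor>t\<rfloor>"
      have n: "2 \<le> n" "t - real n \<in> {0..1}" using elim unfolding n_def by (auto simp: le_nat_floor of_nat_nat) linarith+
      show ?case using assms[OF n] unfolding n_def[symmetric] by (simp add: divide_inverse)
    qed
  qed
  from tendsto_add[OF this 1] show ?thesis by auto
qed

section \<open>Expected sausage volume and ball volumes of the modified measure\<close>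

lemma (in kernel_process) measurable_volume:
  assumes A: "mfam A" and N: "sigma_finite_measure N" "sets N = sets borel"
  shows "(\<lambda>z. \<integral>\<^sup>+y. emeasure (P z) (A y) \<partial>N) \<in> borel_measurable borel"
proof -
  have [measurable_cong]: "sets N = sets borel" by fact
  have "(\<lambda>(z, y). emeasure (P z) (A y)) \<in> borel_measurable (borel \<Otimes>\<^sub>M N)"
    using mfam_emeasure_measurable2[OF A, of fst "borel \<Otimes>\<^sub>M N" snd] by (simp add: case_prod_beta')
  then show ?thesis by (rule sigma_finite_measure.borel_measurable_nn_integral[OF N(1)])
qed

text \<open>A path has bounded range on \<open>{0..t}\<close>, so each sausage lies in a ball and
  has finite measure; hence the real-valued \<open>measure\<close> agrees with
  \<open>emeasure\<close>, and the claim is Tonelli.\<close>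

lemma (in gaussian_process) expected_sausage_vol:
  assumes t: "0 \<le> t"
  shows "(\<integral>\<omega>. sausage_vol \<mu> r t \<omega> \<partial>P x) = vol r x t"
proof -
  let ?V = "\<lambda>\<omega>. {y. \<omega> \<in> hits (ball y r) 0 t}"
  have m: "mfam (\<lambda>y::'a. hits (ball y r) 0 t)" by (rule mfam_hits_ball[OF t])
  have V: "(\<Union>s\<in>{0..t}. ball (\<omega> s) r) = ?V \<omega>" if "\<omega> \<in> cpaths" for \<omega> :: "real \<Rightarrow> 'a"
    using that by (auto simp: hits_def dist_commute)
  have "{z\<in>space (path_space \<Otimes>\<^sub>M borel). fst z \<in> hits (ball (snd z) r) 0 t} \<in> sets (path_space \<Otimes>\<^sub>M (borel :: 'a measure))"
    using m by (simp add: mfam_def)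
  then have Q: "{z\<in>space (path_space \<Otimes>\<^sub>M borel). fst z \<in> hits (ball (snd z) r) 0 t} \<in> sets (path_space \<Otimes>\<^sub>M \<mu>)"
    by (simp cong: sets_pair_measure_cong)
  have em: "(\<lambda>\<omega>. emeasure \<mu> (?V \<omega>)) \<in> borel_measurable path_space"
  proof -
    have "Pair \<omega> -` {z\<in>space (path_space \<Otimes>\<^sub>M borel). fst z \<in> hits (ball (snd z) r) 0 t} = ?V \<omega>" if "\<omega> \<in> space path_space" for \<omega> :: "real \<Rightarrow> 'a"
      using that by (auto simp: space_pair_measure)
    then show ?thesis
      by (intro measurable_cong[THEN iffD1, OF _ mu.measurable_emeasure_Pair[OF Q]]) (simp only:)
  qed
  have fin: "emeasure \<mu> (?V \<omega>) = ennreal (measure \<mu> (?V \<omega>))" if w: "\<omega> \<in> cpaths" for \<omega>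
  proof (rule emeasure_eq_ennreal_measure)
    have "bounded (\<omega> ` {0..t})" using cpaths_cont[OF w] by (intro compact_imp_bounded compact_continuous_image) auto
    then obtain B where "\<forall>z\<in>\<omega> ` {0..t}. dist 0 z \<le> B" unfolding bounded_any_center[where a=0] by blast
    then have B: "dist 0 (\<omega> s) \<le> B" if "s \<in> {0..t}" for s using that by blast
    have "?V \<omega> \<subseteq> ball 0 (B + r)"
    proof
      fix y assume "y \<in> ?V \<omega>"
      then obtain s where "s \<in> {0..t}" "dist y (\<omega> s) < r" by (auto simp: hits_def)
      then show "y \<in> ball 0 (B + r)" using B[of s] dist_triangle[of 0 y "\<omega> s"] by (simp add: dist_commute)
    qed
    then have "emeasure \<mu> (?V \<omega>) \<le> emeasure \<mu> (ball 0 (B + r))" by (intro emeasure_mono) auto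
    moreover obtain K where "emeasure \<mu> (ball 0 (B + r)) \<le> ennreal K" using mu_ball by blast
    ultimately show "emeasure \<mu> (?V \<omega>) \<noteq> \<top>" by (metis ennreal_less_top leD order_trans top_greatest top.not_eq_extremum)
  qed
  have sv: "sausage_vol \<mu> r t \<omega> = measure \<mu> (?V \<omega>)" if "\<omega> \<in> cpaths" for \<omega> unfolding sausage_vol_def V[OF that] ..
  have "(\<integral>\<omega>. sausage_vol \<mu> r t \<omega> \<partial>P x) = (\<integral>\<omega>. measure \<mu> (?V \<omega>) \<partial>P x)"
    by (intro Bochner_Integration.integral_cong refl sv) simp
  also have "\<dots> = enn2real (\<integral>\<^sup>+\<omega>. ennreal (measure \<mu> (?V \<omega>)) \<partial>P x)"
    using em by (intro integral_eq_nn_integral) (auto simp: measure_def)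
  also have "(\<integral>\<^sup>+\<omega>. ennreal (measure \<mu> (?V \<omega>)) \<partial>P x) = (\<integral>\<^sup>+\<omega>. emeasure \<mu> (?V \<omega>) \<partial>P x)"
    using fin by (intro nn_integral_cong) simp
  also have "\<dots> = (\<integral>\<^sup>+y. emeasure (P x) (hits (ball y r) 0 t) \<partial>\<mu>)"
    by (rule nn_integral_mfam_swap[OF m sigma_finite_mu sets_mu, symmetric])
  finally show ?thesis unfolding vol_def .
qed

text \<open>A large ball contains a ball of a quarter of its radius that avoids \<open>D\<close>,
  where the measure is Lebesgue. For bounded radii, centres far from \<open>D\<close> are equally
  harmless, and centres near \<open>D\<close> are handled by compactness and positivity on
  balls.\<close>

lemma lebesgue_off_bounded_lower:
  fixes \<mu> :: "'a::euclidean_space measure"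
  assumes s: "sets \<mu> = sets borel" and D: "bounded D"
    and eq: "\<And>A. A \<in> sets borel \<Longrightarrow> A \<subseteq> - D \<Longrightarrow> emeasure \<mu> A = emeasure lborel A"
    and pos: "\<And>x r. 0 < r \<Longrightarrow> 0 < emeasure \<mu> (ball x r)" and fin: "\<And>x r. emeasure \<mu> (ball x r) < \<infinity>"
  obtains c where "0 < c" "\<And>R y. 1 \<le> R \<Longrightarrow> ennreal (c * R ^ DIM('a)) \<le> emeasure \<mu> (ball y R)"
proof -
  define U where "U = unit_ball_vol (real DIM('a))"
  have U: "U > 0" by (simp add: U_def)
  obtain \<rho> where \<rho>: "0 < \<rho>" "D \<subseteq> ball 0 \<rho>" using bounded_subset_ballD[OF D, of 0] by blast
  have vol: "ennreal (U * r ^ DIM('a)) \<le> emeasure \<mu> (ball y R)" if "0 \<le> r" "ball z r \<subseteq> ball y R" "ball z r \<subseteq> - D" for z y r R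
  proof -
    have "ennreal (U * r ^ DIM('a)) = emeasure \<mu> (ball z r)" unfolding U_def using eq[of "ball z r"] that by (simp add: emeasure_ball)
    also have "\<dots> \<le> emeasure \<mu> (ball y R)" using that s by (intro emeasure_mono) auto
    finally show ?thesis .
  qed
  have large: "ennreal (U * (R / 4) ^ DIM('a)) \<le> emeasure \<mu> (ball y R)" if R: "4 * \<rho> \<le> R" for R y
  proof -
    obtain b :: 'a where "b \<in> Basis" using nonempty_Basis by blast
    then have nb: "norm b = 1" by simp
    define v where "v = (R / 2) *\<^sub>R b"
    have R0: "R > 0" using R \<rho> by linarith
    have nv: "norm v = R / 2" using nb R0 by (simp add: v_def)
    have "R = norm ((y + v) - (y - v))" using nb R0 by (simp add: v_def scaleR_2[symmetric])
    also have "\<dots> \<le> norm (y + v) + norm (y - v)" by (rule norm_triangle_ineq4)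
    \<comment> \<open>Of two opposite points at distance \<open>R / 2\<close> from \<open>y\<close>,
      one is at least \<open>R / 2\<close> away from the origin. Its \<open>R / 4\<close>-ball then
      avoids \<open>ball 0 \<rho>\<close> because \<open>\<rho> \<le> R / 4\<close>.\<close>
    finally have "R / 2 \<le> norm (y + v) \<or> R / 2 \<le> norm (y - v)" by linarith
    then obtain z where z: "dist y z = R / 2" "R / 2 \<le> norm z"
    proof
      assume "R / 2 \<le> norm (y + v)"
      then show ?thesis using that[of "y + v"] nv by (simp add: dist_norm)
    next
      assume "R / 2 \<le> norm (y - v)"
      then show ?thesis using that[of "y - v"] nv by (simp add: dist_norm)
    qed
    have "ball z (R / 4) \<subseteq> ball y R"
    proof
      fix w assume "w \<in> ball z (R / 4)"
      then show "w \<in> ball y R" using dist_triangle[of y w z] z R0 by simp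
    qed
    moreover have "ball z (R / 4) \<subseteq> - D"
    proof
      fix w assume w: "w \<in> ball z (R / 4)"
      have "norm z \<le> norm w + dist z w" using norm_triangle_ineq[of w "z - w"] by (simp add: dist_norm)
      then have "w \<notin> ball 0 \<rho>" using w z R by simp
      then show "w \<in> - D" using \<rho> by blast
    qed
    ultimately show ?thesis using R0 by (intro vol) auto
  qed
  \<comment> \<open>Finitely many balls of radius 1/2 cover the critical centres. Every unit ball
    around such a centre contains one of them entirely, so their least mass is a lower
    bound.\<close>
  obtain k where k: "finite k" "k \<subseteq> cball 0 (\<rho> + 1)" "cball (0::'a) (\<rho> + 1) \<subseteq> (\<Union>c\<in>k. ball c (1/2))"
  proof -
    have "cball (0::'a) (\<rho> + 1) \<subseteq> (\<Union>c\<in>cball 0 (\<rho> + 1). ball c (1/2))" by auto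
    from compactE_image[OF compact_cball _ this] show ?thesis using that by (metis open_ball)
  qed
  have "k \<noteq> {}" using k(3) \<rho>(1) by fastforce
  define m where "m = Min ((\<lambda>c. measure \<mu> (ball c (1/2))) ` k)"
  have me: "ennreal (measure \<mu> (ball c r)) = emeasure \<mu> (ball c r)" for c r
    using fin[of c r] by (intro emeasure_eq_ennreal_measure[symmetric]) auto
  have "0 < measure \<mu> (ball c (1/2))" for c using pos[of "1/2" c] me[of c "1/2"] by (metis ennreal_0 less_irrefl measure_le_0_iff not_le half_gt_zero zero_less_one)
  then have m: "0 < m" unfolding m_def using k(1) \<open>k \<noteq> {}\<close> by (simp add: Min_gr_iff)
  have small: "ennreal (min U m) \<le> emeasure \<mu> (ball y R)" if R: "1 \<le> R" for y R
  proof (cases "norm y \<le> \<rho> + 1")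
    case True
    then have "y \<in> cball 0 (\<rho> + 1)" by simp
    then obtain c where c: "c \<in> k" "y \<in> ball c (1/2)" using k(3) by blast
    have "ennreal (min U m) \<le> ennreal (measure \<mu> (ball c (1/2)))"
      unfolding m_def using k(1) c(1) by (intro ennreal_leI min.coboundedI2 Min_le) auto
    also have "\<dots> \<le> emeasure \<mu> (ball y R)"
    proof -
      have "ball c (1/2) \<subseteq> ball y R"
      proof
        fix w assume "w \<in> ball c (1/2)"
        then show "w \<in> ball y R" using c(2) dist_triangle[of y w c] R by (simp add: dist_commute)
      qed
      then show ?thesis unfolding me using s by (intro emeasure_mono) auto
    qed
    finally show ?thesis .
  next
    case False
    have "ball y 1 \<subseteq> - D"
    proof
      fix w assume w: "w \<in> ball y 1"
      have "norm y \<le> norm w + dist y w" using norm_triangle_ineq[of w "y - w"] by (simp add: dist_norm)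
      then have "w \<notin> ball 0 \<rho>" using w False by simp
      then show "w \<in> - D" using \<rho> by blast
    qed
    then have "ennreal (U * 1 ^ DIM('a)) \<le> emeasure \<mu> (ball y R)" using R by (intro vol[of 1 y y R]) (auto intro: subset_ball[THEN subsetD])
    moreover have "ennreal (min U m) \<le> ennreal (U * 1 ^ DIM('a))" by (intro ennreal_leI) simp
    ultimately show ?thesis by (rule order_trans[rotated])
  qed
  \<comment> \<open>The first entry serves radii \<open>R \<ge> 4 * \<rho>\<close>, the second radii
    below, where \<open>R ^ DIM('a)\<close> is at most
    \<open>(4 * \<rho>) ^ DIM('a)\<close>.\<close>
  define c where "c = min (U / 4 ^ DIM('a)) (min U m / (4 * \<rho>) ^ DIM('a))"
  show ?thesis
  proof (rule that)
    show "0 < c" unfolding c_def using U m \<rho>(1) by simp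
    fix R :: real and y :: 'a assume R: "1 \<le> R"
    show "ennreal (c * R ^ DIM('a)) \<le> emeasure \<mu> (ball y R)"
    proof (cases "4 * \<rho> \<le> R")
      case True
      have "c * R ^ DIM('a) \<le> U / 4 ^ DIM('a) * R ^ DIM('a)" unfolding c_def using R by (intro mult_right_mono) auto
      also have "\<dots> = U * (R / 4) ^ DIM('a)" by (simp add: power_divide)
      finally show ?thesis using large[OF True, of y] by (auto intro: order_trans ennreal_leI)
    next
      case False
      have "c * R ^ DIM('a) \<le> min U m / (4 * \<rho>) ^ DIM('a) * (4 * \<rho>) ^ DIM('a)"
        using False R U m \<rho>(1) unfolding c_def by (intro mult_mono power_mono) auto
      also have "\<dots> = min U m" using \<rho>(1) by simp
      finally show ?thesis by (rule order_trans[OF ennreal_leI small[OF R]])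
    qed
  qed
qed

lemma mmd_gaussian_process:
  fixes \<mu> :: "'a::euclidean_space measure"
  assumes mmd: "mmd_space \<mu> p P" and fhk: "FHK2 \<mu> p" and dim: "DIM('a) \<ge> 6"
    and up: "\<And>R y. 0 < R \<Longrightarrow> measure \<mu> (ball y R) \<le> C * R ^ DIM('a)"
    and D: "bounded D" and eq: "\<And>A. A \<in> sets borel \<Longrightarrow> A \<subseteq> - D \<Longrightarrow> emeasure \<mu> A = emeasure lborel A"
  shows "gaussian_process \<mu> p P"
proof -
  have s: "sets \<mu> = sets borel" and U: "\<And>V. open V \<Longrightarrow> bounded V \<Longrightarrow> V \<noteq> {} \<Longrightarrow> 0 < emeasure \<mu> V \<and> emeasure \<mu> (closure V) < \<infinity>"
    using mmd unfolding mmd_space_def mmd_measure_def by blast+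
  have hk: "heat_kernel \<mu> p" and mp: "markov_process \<mu> p P" using mmd unfolding mmd_space_def by blast+
  have pos: "0 < emeasure \<mu> (ball x r)" if "0 < r" for x r using U[of "ball x r"] that by simp
  have fin: "emeasure \<mu> (ball x r) < \<infinity>" for x r
  proof (cases "ball x r = {}")
    case False
    have "emeasure \<mu> (ball x r) \<le> emeasure \<mu> (closure (ball x r))" using s by (intro emeasure_mono closure_subset) auto
    also have "\<dots> < \<infinity>" using U[of "ball x r"] False by blast
    finally show ?thesis .
  qed (simp only: emeasure_empty, simp)
  obtain c where c: "0 < c" "\<And>R y. 1 \<le> R \<Longrightarrow> ennreal (c * R ^ DIM('a)) \<le> emeasure \<mu> (ball y R)"
    using lebesgue_off_bounded_lower[OF s D eq pos fin] by blast
  have kp: "kernel_process \<mu> p P"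
  proof
    show "sets \<mu> = sets borel" by fact
    show "\<exists>A. countable A \<and> A \<subseteq> sets \<mu> \<and> \<Union>A = space \<mu> \<and> (\<forall>a\<in>A. emeasure \<mu> a \<noteq> \<infinity>)"
    proof (intro exI[of _ "range (\<lambda>n. ball 0 (real n))"] conjI ballI)
      show "\<Union>(range (\<lambda>n. ball 0 (real n))) = space \<mu>"
        using sets_eq_imp_space_eq[OF s] by (auto intro: reals_Archimedean2)
    qed (use s fin in \<open>auto simp: less_top\<close>)
    show "case_prod (p t) \<in> borel_measurable (borel \<Otimes>\<^sub>M borel)" if t: "0 < t" for t
    proof -
      have c: "continuous_on ({0<..} \<times> UNIV \<times> UNIV) (\<lambda>(t, x, y). p t x y)" using hk unfolding heat_kernel_def by blast
      have "continuous_on UNIV (\<lambda>z. (\<lambda>(t, x, y). p t x y) (t, fst z, snd z))"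
        by (rule continuous_on_compose2[OF c]) (use t in \<open>auto intro!: continuous_intros\<close>)
      then have "(\<lambda>z. p t (fst z) (snd z)) \<in> borel_measurable borel" by (intro borel_measurable_continuous_onI) (simp add: case_prod_beta')
      then show ?thesis by (simp add: borel_prod case_prod_beta')
    qed
    show "0 \<le> p t x y" if "0 < t" for t x y using hk that unfolding heat_kernel_def by blast
    show "markov_process \<mu> p P" by (rule mp)
  qed
  show ?thesis
  proof (rule gaussian_processI[OF kp _ fhk dim _ _ c(2) c(1)])
    show "p t x y = p t y x" if "0 < t" for t x y using hk that unfolding heat_kernel_def by blast
    \<comment> \<open>\<open>\<bar>C\<bar> + 1\<close> provides the positive constant that
      \<open>gaussian_processI\<close> asks for.\<close>
    show "emeasure \<mu> (ball y R) \<le> ennreal ((\<bar>C\<bar> + 1) * R ^ DIM('a))" if "0 < R" for R y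
    proof -
      have "emeasure \<mu> (ball y R) = ennreal (measure \<mu> (ball y R))" using fin[of y R] by (intro emeasure_eq_ennreal_measure) auto
      also have "\<dots> \<le> ennreal ((\<bar>C\<bar> + 1) * R ^ DIM('a))"
        using up[OF that, of y] that by (intro ennreal_leI order_trans[OF up[OF that]] mult_right_mono) auto
      finally show ?thesis .
    qed
  qed simp_all
qed

text \<open>Restart both processes from the position \<open>z\<close> at time \<open>s\<close> and
  compare the volumes newly visited during the last step. From \<open>z\<close> outside
  \<open>D\<close> they differ only on paths that meet \<open>ball 0 R\<close>; from
  \<open>z\<close> in \<open>D\<close> only crude bounds are used, but that set has finite measure.
  Integration against a kernel of size \<open>1 / s ^ 3\<close> makes both errors small.\<close>

lemma modification_increment:
  fixes \<mu> :: "'a::euclidean_space measure"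
  assumes "gaussian_process \<mu> p P" "brownian W" and D: "open D" "bounded D"
    and eq: "\<And>A. A \<in> sets borel \<Longrightarrow> A \<subseteq> - D \<Longrightarrow> emeasure \<mu> A = emeasure lborel A"
    and law: "\<And>z. z \<notin> D \<Longrightarrow> distr (P z) path_space (stopped_at D) = distr (W z) path_space (stopped_at D)"
    and r: "0 < r"
  shows "\<exists>C. \<forall>n\<ge>2. \<forall>h\<in>{0..1}. \<bar>gaussian_process.vol \<mu> P r x (real n + h) - gaussian_process.vol \<mu> P r x (real n) - h * newton_cap_ball DIM('a) r\<bar> \<le> C / (real n)\<^sup>2"
proof -
  interpret M: gaussian_process \<mu> p P by fact
  interpret B: brownian W by fact
  obtain \<rho> where \<rho>: "0 < \<rho>" "D \<subseteq> ball 0 \<rho>" using bounded_subset_ballD[OF D(2), of 0] by blast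
  \<comment> \<open>Large enough to contain the closure of \<open>D\<close> and every
    \<open>ball y r\<close> with \<open>y\<close> in \<open>D\<close>: visiting the neighbourhood of
    a point of \<open>D\<close> thus counts as meeting \<open>ball 0 R\<close>.\<close>
  define R where "R = \<rho> + r + 1"
  have "closure D \<subseteq> cball 0 \<rho>" using \<rho>(2) by (intro closure_minimal) (auto intro: less_imp_le)
  then have DB: "closure D \<subseteq> ball 0 R" using r \<rho>(1) unfolding R_def by auto
  have yB: "ball y r \<subseteq> ball 0 R" if "y \<in> D" for y
  proof
    fix w assume "w \<in> ball y r"
    then show "w \<in> ball 0 R" using that \<rho>(2) dist_triangle[of 0 w y] unfolding R_def by auto
  qed
  have Db: "D \<in> sets borel" using D(1) by simp
  obtain d0 where d0: "0 \<le> d0" "emeasure \<mu> D \<le> ennreal d0"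
  proof -
    obtain K where K: "K > 0" "\<And>y. emeasure \<mu> (ball y \<rho>) \<le> ennreal K" using M.mu_ball[of \<rho>] by blast
    have "emeasure \<mu> D \<le> emeasure \<mu> (ball 0 \<rho>)" using \<rho>(2) by (intro emeasure_mono) auto
    then show ?thesis using that[of K] K(1) K(2)[of 0] by (auto intro: order_trans)
  qed
  obtain KM where KM: "KM > 0" "\<And>a z. a \<ge> 0 \<Longrightarrow> (\<integral>\<^sup>+y. emeasure (P z) (hits (ball y r) a (a + 1)) \<partial>\<mu>) \<le> ennreal KM"
    using M.hits_unit_volume[of r] by blast
  obtain KW where KW: "KW > 0" "\<And>a z. a \<ge> 0 \<Longrightarrow> (\<integral>\<^sup>+y. emeasure (W z) (hits (ball y r) a (a + 1)) \<partial>lborel) \<le> ennreal KW"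
    using B.hits_unit_volume[of r] by blast
  obtain CM where CM: "CM > 0" "\<And>u. u \<ge> 1 \<Longrightarrow> (\<integral>\<^sup>+z. (\<integral>\<^sup>+y. emeasure (P z) (hits (ball y r) (real u) (real u + 1) \<inter> hits (ball 0 R) 0 (real u + 1)) \<partial>\<mu>) \<partial>\<mu>) \<le> ennreal (CM * real u)"
    using M.double_visit_volume[of r 0 R] by blast
  obtain CW where CW: "CW > 0" "\<And>u. u \<ge> 1 \<Longrightarrow> (\<integral>\<^sup>+z. (\<integral>\<^sup>+y. emeasure (W z) (hits (ball y r) (real u) (real u + 1) \<inter> hits (ball 0 R) 0 (real u + 1)) \<partial>lborel) \<partial>lborel) \<le> ennreal (CW * real u)"
    using B.double_visit_volume[of r 0 R] by blast
  obtain A where A: "A > 0" "\<And>t x y. t \<ge> 1 \<Longrightarrow> p t x y \<le> A / t ^ 3" using M.p_decay by blast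
  obtain C1 where C1: "C1 > 0" "\<And>s u h x. s > 0 \<Longrightarrow> u \<ge> 1 \<Longrightarrow> h \<in> {0..1} \<Longrightarrow> 
     let I = \<integral>\<^sup>+y. emeasure (P x) (newly r (s + u) (s + u + h) y) \<partial>\<mu>;
     J = \<integral>\<^sup>+z. ennreal (p s x z) * (\<integral>\<^sup>+y. emeasure (P z) (newly r u (u + h) y) \<partial>\<mu>) \<partial>\<mu>
     in I \<le> J \<and> J \<le> I + ennreal (C1 / u\<^sup>2)"
    using M.newly_compare[of r] by blast
  obtain CB where CB: "CB > 0" "\<And>u h. u \<ge> 1 \<Longrightarrow> h \<in> {0..1} \<Longrightarrow> \<bar>B.vol r 0 (u + h) - B.vol r 0 u - h * newton_cap_ball DIM('a) r\<bar> \<le> CB / u\<^sup>2"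
    using B.vol_increment_capacity[OF r] by blast
  \<comment> \<open>The event is its own preimage under \<open>stopped_at D\<close>, and the stopped
    laws agree.\<close>
  have off: "emeasure (P z) (newly r u v y - hits (ball 0 R) 0 b) = emeasure (W z) (newly r u v y - hits (ball 0 R) 0 b)"
    if z: "z \<notin> D" and uv: "0 \<le> u" "u \<le> v" "v \<le> b" for z u v b y
  proof -
    let ?E = "newly r u v y - hits (ball 0 R) 0 b"
    have E: "?E \<in> sets path_space" using uv mfam_sets[OF mfam_newly[of u v r]] by (intro sets.Diff hits_sets) auto
    have pre: "stopped_at D -` ?E \<inter> cpaths = ?E" using uv by (intro stopped_at_newly[OF DB]) auto
    have "emeasure (P z) ?E = emeasure (distr (P z) path_space (stopped_at D)) ?E"
      using measurable_stopped_at[OF D(1)] E pre by (subst emeasure_distr) auto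
    also have "\<dots> = emeasure (W z) ?E"
      using measurable_stopped_at[OF D(1)] E pre unfolding law[OF z] by (subst emeasure_distr) auto
    finally show ?thesis .
  qed
  have main: "\<bar>M.vol r x (real n + h) - M.vol r x (real n) - h * newton_cap_ball DIM('a) r\<bar> \<le> (16 * C1 + 16 * CB + 8 * A * (CM + CW + (KM + KW) * d0)) / (real n)\<^sup>2"
    if n: "n \<ge> 2" and h: "h \<in> {0..1}" for n h
  proof -
    \<comment> \<open>Both parts are comparable to \<open>n\<close>: \<open>u\<close> makes the
      forgotten past negligible, \<open>s\<close> makes the kernel small.\<close>
    define u where "u = n div 2"
    define s where "s = real n - real u"
    have u1: "1 \<le> u" using n by (simp add: u_def)
    have un: "2 * u \<le> n" "n \<le> 2 * u + 1" unfolding u_def by auto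
    have unr: "2 * real u \<le> real n" using of_nat_mono[OF un(1), where 'a=real] by simp
    have u4: "real n \<le> 4 * real u" using un(2) u1 by linarith
    have s2: "real n \<le> 2 * s" unfolding s_def right_diff_distrib using unr by simp
    have s1: "1 \<le> s" using s2 n by linarith
    have su: "s + real u = real n" by (simp add: s_def)
    have u0: "0 \<le> real u" "real u \<le> real u + h" "real u + h \<le> real u + 1" using h by auto
    let ?N = "newly r (real u) (real u + h) :: 'a \<Rightarrow> _"
    let ?H = "hits (ball (0::'a) R) 0 (real u + 1)"
    let ?Y = "\<lambda>y. hits (ball y r) (real u) (real u + 1) \<inter> ?H"
    have Nm: "mfam ?N" by (rule mfam_newly[OF u0(1,2)])
    have Hs: "?H \<in> sets path_space" by (rule hits_sets) auto
    have Xm: "mfam (\<lambda>y. ?N y - ?H)" by (intro mfam_Diff Nm mfam_const Hs)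
    have Ym: "mfam ?Y" by (intro mfam_Int mfam_hits_ball mfam_const Hs) auto
    have Nsub: "?N y \<subseteq> hits (ball y r) (real u) (real u + 1)" for y
    proof -
      have "hits (ball y r) 0 (real u + h) = hits (ball y r) 0 (real u) \<union> hits (ball y r) (real u) (real u + h)"
        using u0 by (intro hits_Un) auto
      moreover have "hits (ball y r) (real u) (real u + h) \<subseteq> hits (ball y r) (real u) (real u + 1)" using h by (intro hits_mono) auto
      ultimately show ?thesis unfolding newly_def by blast
    qed
    define w where "w = B.vol r 0 (real u + h) - B.vol r 0 (real u)"
    have w0: "0 \<le> w" and wz: "(\<integral>\<^sup>+y. emeasure (W z) (?N y) \<partial>lborel) = ennreal w" for z
      using B.W_newly_translate[OF u0(1,2), of z r] B.vol_newly[OF u0(1,2), of 0 r] by (simp_all add: w_def)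
    define \<psi> where "\<psi> z = (\<integral>\<^sup>+y. emeasure (P z) (?N y) \<partial>\<mu>)" for z
    define \<phi>M where "\<phi>M z = (\<integral>\<^sup>+y. emeasure (P z) (?Y y) \<partial>\<mu>)" for z
    define \<phi>W where "\<phi>W z = (\<integral>\<^sup>+y. emeasure (W z) (?Y y) \<partial>lborel)" for z
    have \<psi>m: "\<psi> \<in> borel_measurable borel" unfolding \<psi>_def by (intro M.measurable_volume Nm M.sigma_finite_mu M.sets_mu)
    have \<phi>Mm: "\<phi>M \<in> borel_measurable borel" unfolding \<phi>M_def by (intro M.measurable_volume Ym M.sigma_finite_mu M.sets_mu)
    have \<phi>Wm: "\<phi>W \<in> borel_measurable borel" unfolding \<phi>W_def by (intro B.measurable_volume Ym sigma_finite_lborel sets_lborel)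
    have split: "emeasure Q (?N y) \<le> emeasure Q (?N y - ?H) + emeasure Q (?Y y)" if "sets Q = sets path_space" for Q y
    proof -
      have "emeasure Q (?N y) \<le> emeasure Q ((?N y - ?H) \<union> ?Y y)"
        using Nsub[of y] that mfam_sets[OF Xm, of y] mfam_sets[OF Ym, of y] by (intro emeasure_mono) auto
      also have "\<dots> \<le> emeasure Q (?N y - ?H) + emeasure Q (?Y y)"
        using that mfam_sets[OF Xm, of y] mfam_sets[OF Ym, of y] by (intro emeasure_subadditive) auto
      finally show ?thesis .
    qed
    \<comment> \<open>Laws and measures are exchanged together: for centres \<open>y\<close> in
      \<open>D\<close> the event is empty by the choice of \<open>R\<close>, and elsewhere \<mu> is
      Lebesgue measure.\<close>
    have X: "(\<integral>\<^sup>+y. emeasure (P z) (?N y - ?H) \<partial>\<mu>) = (\<integral>\<^sup>+y. emeasure (W z) (?N y - ?H) \<partial>lborel)" if z: "z \<notin> D" for z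
    proof -
      have e: "emeasure (P z) (?N y - ?H) = emeasure (W z) (?N y - ?H)" for y
        by (rule off[OF z u0])
      have "(\<integral>\<^sup>+y. emeasure (W z) (?N y - ?H) \<partial>\<mu>) = (\<integral>\<^sup>+y. emeasure (W z) (?N y - ?H) \<partial>lborel)"
      proof (rule nn_integral_eq_off[OF M.sets_mu sets_lborel Db eq])
        show "(\<lambda>y. emeasure (W z) (?N y - ?H)) \<in> borel_measurable borel" by (rule B.mfam_emeasure_measurable2[OF Xm]) auto
        fix y assume "y \<in> D"
        then have "hits (ball y r) (real u) (real u + 1) \<subseteq> ?H" using yB by (intro hits_mono) auto
        then have "?N y - ?H = {}" using Nsub[of y] by blast
        then show "emeasure (W z) (?N y - ?H) = 0" by (simp only: emeasure_empty)
      qed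
      then show ?thesis by (simp only: e)
    qed
    have \<psi>1: "\<psi> z \<le> ennreal w + (\<phi>M z + ennreal KM * indicator D z)" for z
    proof (cases "z \<in> D")
      case True
      have "\<psi> z \<le> (\<integral>\<^sup>+y. emeasure (P z) (hits (ball y r) (real u) (real u + 1)) \<partial>\<mu>)"
        unfolding \<psi>_def using Nsub by (intro nn_integral_mono emeasure_mono M.hits_sets_P) auto
      also have "\<dots> \<le> ennreal KM" by (rule KM(2)) simp
      finally have "\<psi> z \<le> ennreal KM" .
      then show ?thesis using True by (simp add: add_increasing)
    next
      case False
      have "\<psi> z \<le> (\<integral>\<^sup>+y. emeasure (P z) (?N y - ?H) + emeasure (P z) (?Y y) \<partial>\<mu>)"
        unfolding \<psi>_def by (intro nn_integral_mono split M.sets_P)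
      also have "\<dots> = (\<integral>\<^sup>+y. emeasure (P z) (?N y - ?H) \<partial>\<mu>) + \<phi>M z"
        unfolding \<phi>M_def using M.mfam_emeasure_measurable2[OF Xm, of "\<lambda>_. z" \<mu> "\<lambda>y. y"] M.mfam_emeasure_measurable2[OF Ym, of "\<lambda>_. z" \<mu> "\<lambda>y. y"]
        by (intro nn_integral_add) auto
      also have "(\<integral>\<^sup>+y. emeasure (P z) (?N y - ?H) \<partial>\<mu>) \<le> ennreal w"
        unfolding X[OF False] wz[of z, symmetric] by (intro nn_integral_mono emeasure_mono) (use mfam_sets[OF Nm] in auto)
      finally show ?thesis using False by (simp add: add_mono)
    qed
    \<comment> \<open>The factor \<open>indicator (- D)\<close> is kept so that the integral of
      \<open>\<phi>W\<close> against \<mu> can be turned into one against Lebesgue measure, for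
      which \<open>CW\<close> was obtained.\<close>
    have \<psi>2: "ennreal w \<le> \<psi> z + (indicator (- D) z * \<phi>W z + ennreal KW * indicator D z)" for z
    proof (cases "z \<in> D")
      case True
      have "ennreal w \<le> (\<integral>\<^sup>+y. emeasure (W z) (hits (ball y r) (real u) (real u + 1)) \<partial>lborel)"
        unfolding wz[of z, symmetric] using Nsub by (intro nn_integral_mono emeasure_mono B.hits_sets_P) auto
      also have "\<dots> \<le> ennreal KW" by (rule KW(2)) simp
      finally show ?thesis using True by (simp add: add_increasing)
    next
      case False
      have "ennreal w \<le> (\<integral>\<^sup>+y. emeasure (W z) (?N y - ?H) + emeasure (W z) (?Y y) \<partial>lborel)"
        unfolding wz[of z, symmetric] by (intro nn_integral_mono split B.sets_P)
      also have "\<dots> = (\<integral>\<^sup>+y. emeasure (W z) (?N y - ?H) \<partial>lborel) + \<phi>W z"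
        unfolding \<phi>W_def using B.mfam_emeasure_measurable2[OF Xm, of "\<lambda>_. z" lborel "\<lambda>y. y"] B.mfam_emeasure_measurable2[OF Ym, of "\<lambda>_. z" lborel "\<lambda>y. y"]
        by (intro nn_integral_add) auto
      also have "(\<integral>\<^sup>+y. emeasure (W z) (?N y - ?H) \<partial>lborel) \<le> \<psi> z"
        unfolding X[OF False, symmetric] \<psi>_def by (intro nn_integral_mono emeasure_mono) (use mfam_sets[OF Nm] in auto)
      finally show ?thesis using False by (simp add: add_mono)
    qed
    have s0: "0 < s" using s1 by linarith
    note [measurable] = M.p_measurable1[OF s0] \<psi>m \<phi>Mm \<phi>Wm Db
    let ?p = "\<lambda>z. ennreal (p s x z)"
    have pm: "?p \<in> borel_measurable \<mu>" by simp
    \<comment> \<open>The position at time \<open>s\<close> is forgotten: the kernel is replaced by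
      its supremum, leaving an integral over all starting points.\<close>
    have pint: "(\<integral>\<^sup>+z. ?p z * g z \<partial>\<mu>) \<le> ennreal (A / s ^ 3) * (\<integral>\<^sup>+z. g z \<partial>\<mu>)" if g: "g \<in> borel_measurable borel" for g
    proof -
      have "(\<integral>\<^sup>+z. ?p z * g z \<partial>\<mu>) \<le> (\<integral>\<^sup>+z. ennreal (A / s ^ 3) * g z \<partial>\<mu>)"
        using A(2)[OF s1] by (intro nn_integral_mono mult_right_mono ennreal_leI) auto
      also have "\<dots> = ennreal (A / s ^ 3) * (\<integral>\<^sup>+z. g z \<partial>\<mu>)" using g by (intro nn_integral_cmult) simp
      finally show ?thesis .
    qed
    have pw: "(\<integral>\<^sup>+z. ?p z * ennreal w \<partial>\<mu>) = ennreal w"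
      using M.p_nn_integral[OF s0, of x] by (simp add: nn_integral_multc)
    define J where "J = (\<integral>\<^sup>+z. ?p z * \<psi> z \<partial>\<mu>)"
    have iD: "(\<integral>\<^sup>+z. ennreal k * indicator D z \<partial>\<mu>) \<le> ennreal (k * d0)" if "k > 0" for k
      using that d0 Db by (simp add: nn_integral_cmult_indicator ennreal_mult' mult_left_mono)
    have lin: "ennreal a * (ennreal b + ennreal c) = ennreal (a * (b + c))" if "0 \<le> a" "0 \<le> b" "0 \<le> c" for a b c
      using that by (simp add: ennreal_mult'[symmetric] ennreal_plus[symmetric] del: ennreal_plus)
    have J1: "J \<le> ennreal w + ennreal (A / s ^ 3 * (CM * real u + KM * d0))"
    proof -
      have "J \<le> (\<integral>\<^sup>+z. ?p z * ennreal w + ?p z * (\<phi>M z + ennreal KM * indicator D z) \<partial>\<mu>)"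
        unfolding J_def distrib_left[symmetric] by (intro nn_integral_mono mult_left_mono \<psi>1) auto
      also have "\<dots> = (\<integral>\<^sup>+z. ?p z * ennreal w \<partial>\<mu>) + (\<integral>\<^sup>+z. ?p z * (\<phi>M z + ennreal KM * indicator D z) \<partial>\<mu>)"
        by (intro nn_integral_add) auto
      also note pw
      also have "(\<integral>\<^sup>+z. ?p z * (\<phi>M z + ennreal KM * indicator D z) \<partial>\<mu>) \<le> ennreal (A / s ^ 3) * (\<integral>\<^sup>+z. \<phi>M z + ennreal KM * indicator D z \<partial>\<mu>)"
        by (rule pint) measurable
      also have "(\<integral>\<^sup>+z. \<phi>M z + ennreal KM * indicator D z \<partial>\<mu>) = (\<integral>\<^sup>+z. \<phi>M z \<partial>\<mu>) + (\<integral>\<^sup>+z. ennreal KM * indicator D z \<partial>\<mu>)"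
        by (intro nn_integral_add) auto
      also have "\<dots> \<le> ennreal (CM * real u) + ennreal (KM * d0)"
        using CM(2)[OF u1] unfolding \<phi>M_def by (intro add_mono iD KM(1))
      also have "ennreal (A / s ^ 3) * (ennreal (CM * real u) + ennreal (KM * d0)) = ennreal (A / s ^ 3 * (CM * real u + KM * d0))"
        using A(1) CM(1) KM(1) d0(1) s0 by (intro lin) auto
      finally show ?thesis by (simp add: add_mono mult_left_mono)
    qed
    have J2: "ennreal w \<le> J + ennreal (A / s ^ 3 * (CW * real u + KW * d0))"
    proof -
      let ?g = "\<lambda>z. indicator (- D) z * \<phi>W z + ennreal KW * indicator D z"
      have "ennreal w = (\<integral>\<^sup>+z. ?p z * ennreal w \<partial>\<mu>)" by (rule pw[symmetric])
      also have "\<dots> \<le> (\<integral>\<^sup>+z. ?p z * (\<psi> z + ?g z) \<partial>\<mu>)"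
        by (intro nn_integral_mono mult_left_mono \<psi>2) auto
      also have "\<dots> = (\<integral>\<^sup>+z. ?p z * \<psi> z + ?p z * ?g z \<partial>\<mu>)"
        by (simp only: distrib_left[of "ennreal _" "\<psi> _"])
      also have "\<dots> = J + (\<integral>\<^sup>+z. ?p z * ?g z \<partial>\<mu>)"
        unfolding J_def by (intro nn_integral_add) auto
      also have "(\<integral>\<^sup>+z. ?p z * ?g z \<partial>\<mu>) \<le> ennreal (A / s ^ 3) * (\<integral>\<^sup>+z. ?g z \<partial>\<mu>)"
        by (rule pint) measurable
      also have "(\<integral>\<^sup>+z. ?g z \<partial>\<mu>) = (\<integral>\<^sup>+z. indicator (- D) z * \<phi>W z \<partial>\<mu>) + (\<integral>\<^sup>+z. ennreal KW * indicator D z \<partial>\<mu>)"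
        by (intro nn_integral_add) auto
      also have "(\<integral>\<^sup>+z. indicator (- D) z * \<phi>W z \<partial>\<mu>) = (\<integral>\<^sup>+z. indicator (- D) z * \<phi>W z \<partial>lborel)"
        by (rule nn_integral_eq_off[OF M.sets_mu sets_lborel Db eq]) auto
      also have "\<dots> \<le> (\<integral>\<^sup>+z. \<phi>W z \<partial>lborel)" by (intro nn_integral_mono) (auto split: split_indicator)
      also have "\<dots> \<le> ennreal (CW * real u)" using CW(2)[OF u1] unfolding \<phi>W_def .
      also have "ennreal (CW * real u) + (\<integral>\<^sup>+z. ennreal KW * indicator D z \<partial>\<mu>) \<le> ennreal (CW * real u) + ennreal (KW * d0)"
        by (intro add_mono iD KW(1)) simp
      also have "ennreal (A / s ^ 3) * (ennreal (CW * real u) + ennreal (KW * d0)) = ennreal (A / s ^ 3 * (CW * real u + KW * d0))"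
        using A(1) CW(1) KW(1) d0(1) s0 by (intro lin) auto
      finally show ?thesis by (simp add: add_mono mult_left_mono)
    qed
    define i where "i = M.vol r x (real n + h) - M.vol r x (real n)"
    have i0: "0 \<le> i" and I: "(\<integral>\<^sup>+y. emeasure (P x) (newly r (s + real u) (s + real u + h) y) \<partial>\<mu>) = ennreal i"
      using M.vol_newly[of "real n" "real n + h" x r] h unfolding su i_def by auto
    have IJ: "ennreal i \<le> J" "J \<le> ennreal i + ennreal (C1 / (real u)\<^sup>2)"
      using C1(2)[OF s0 _ h, of "real u" x] u1 unfolding Let_def I J_def \<psi>_def by auto
    have e0: "0 \<le> A / s ^ 3 * (CM * real u + KM * d0)" "0 \<le> A / s ^ 3 * (CW * real u + KW * d0)"
      using A(1) CM(1) CW(1) KM(1) KW(1) d0(1) s0 by simp_all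
    have "ennreal i \<le> ennreal (w + A / s ^ 3 * (CM * real u + KM * d0))"
      using order_trans[OF IJ(1) J1] w0 e0 by (simp add: ennreal_plus)
    then have b1: "i \<le> w + A / s ^ 3 * (CM * real u + KM * d0)" using w0 e0 by (subst (asm) ennreal_le_iff) auto
    have "ennreal w \<le> ennreal i + ennreal (C1 / (real u)\<^sup>2) + ennreal (A / s ^ 3 * (CW * real u + KW * d0))"
      using order_trans[OF J2 add_right_mono[OF IJ(2)]] .
    then have "ennreal w \<le> ennreal (i + C1 / (real u)\<^sup>2 + A / s ^ 3 * (CW * real u + KW * d0))"
      using i0 e0 C1(1) by (simp add: ennreal_plus)
    then have b2: "w \<le> i + C1 / (real u)\<^sup>2 + A / s ^ 3 * (CW * real u + KW * d0)" using i0 e0 C1(1) by (subst (asm) ennreal_le_iff) auto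
    have b3: "\<bar>w - h * newton_cap_ball DIM('a) r\<bar> \<le> CB / (real u)\<^sup>2" unfolding w_def using u1 h by (intro CB(2)) auto
    have n0: "0 < real n" using n by simp
    \<comment> \<open>The factor 16 comes from \<open>n \<le> 4 * u\<close>.\<close>
    have sq: "k / (real u)\<^sup>2 \<le> 16 * k / (real n)\<^sup>2" if "k > 0" for k
    proof -
      have "(real n)\<^sup>2 \<le> (4 * real u)\<^sup>2" using u4 by (intro power_mono) auto
      then have "k * (real n)\<^sup>2 \<le> k * (16 * (real u)\<^sup>2)" using that by (intro mult_left_mono) (auto simp: power_mult_distrib)
      then show ?thesis using n0 u1 by (simp add: divide_le_eq le_divide_eq mult_ac)
    qed
    \<comment> \<open>The factor 8 comes from \<open>n \<le> 2 * s\<close>; the linear growth in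
      \<open>u\<close> costs one of the three powers.\<close>
    have cb: "A / s ^ 3 * (k * real u + k' * d0) \<le> 8 * A * (k + k' * d0) / (real n)\<^sup>2" if "k > 0" "k' > 0" for k k'
    proof -
      have "(real n / 2) ^ 3 \<le> s ^ 3" using s2 by (intro power_mono) auto
      then have "A / s ^ 3 \<le> A / (real n / 2) ^ 3" using A(1) n0 s0 by (intro divide_left_mono) auto
      moreover have "k * real u + k' * d0 \<le> (k + k' * d0) * real n"
      proof -
        have "k * real u \<le> k * real n" using that un by (intro mult_left_mono) auto
        moreover have "k' * d0 * 1 \<le> k' * d0 * real n" using that d0(1) n by (intro mult_left_mono) auto
        ultimately show ?thesis by (simp add: distrib_right)
      qed
      ultimately have "A / s ^ 3 * (k * real u + k' * d0) \<le> A / (real n / 2) ^ 3 * ((k + k' * d0) * real n)"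
        using that A(1) d0(1) n0 by (intro mult_mono) auto
      also have "\<dots> = 8 * A * (k + k' * d0) / (real n)\<^sup>2"
        using n0 by (simp add: power_divide power2_eq_square power3_eq_cube)
      finally show ?thesis .
    qed
    \<comment> \<open>Names for the error terms turn the final estimate into a linear one.\<close>
    define N2 where "N2 = (real n)\<^sup>2"
    define a1 where "a1 = 8 * A * (CM + KM * d0) / N2"
    define a2 where "a2 = 8 * A * (CW + KW * d0) / N2"
    define a3 where "a3 = 16 * C1 / N2"
    define a4 where "a4 = 16 * CB / N2"
    have nn: "0 \<le> a1" "0 \<le> a2" "0 \<le> a3" unfolding a1_def a2_def a3_def N2_def using A(1) CM(1) CW(1) KM(1) KW(1) d0(1) C1(1) by simp_all
    have "\<bar>i - h * newton_cap_ball DIM('a) r\<bar> \<le> a3 + a4 + (a1 + a2)"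
      using b1 b2 b3 sq[OF C1(1)] sq[OF CB(1)] cb[OF CM(1) KM(1)] cb[OF CW(1) KW(1)] nn
      unfolding N2_def[symmetric] a1_def[symmetric] a2_def[symmetric] a3_def[symmetric] a4_def[symmetric] by linarith
    also have "\<dots> = (16 * C1 + 16 * CB + 8 * A * (CM + CW + (KM + KW) * d0)) / (real n)\<^sup>2"
      unfolding a1_def a2_def a3_def a4_def N2_def add_divide_distrib[symmetric] by (simp add: algebra_simps)
    finally show ?thesis unfolding i_def .
  qed
  then show ?thesis by blast
qed

theorem theorem1p6:
  fixes \<mu> :: "(real^'n) measure"
    and p :: "real \<Rightarrow> real^'n \<Rightarrow> real^'n \<Rightarrow> real"
    and P :: "real^'n \<Rightarrow> (real \<Rightarrow> real^'n) measure"
    and \<epsilon> :: real and x :: "real^'n"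
  assumes "CARD('n) \<ge> 6" and "\<epsilon> > 0"
    and "mmd_space \<mu> p P"
    and "\<exists>W. markov_process lborel gauss_kernel W \<and> bounded_modification \<mu> P lborel W"
    and "FHK2 \<mu> p"
    and "\<exists>C. \<forall>R>0. \<forall>y. measure \<mu> (ball y R) \<le> C * R ^ CARD('n)"
  shows "\<exists>L::real. ((\<lambda>t. (\<integral>\<omega>. sausage_vol \<mu> \<epsilon> t \<omega> \<partial>P x) - t * newton_cap_ball CARD('n) \<epsilon>) \<longlongrightarrow> L) at_top"
proof -
  have dim: "DIM(real^'n) = CARD('n)" by simp
  obtain W where W: "markov_process lborel gauss_kernel W" "bounded_modification \<mu> P lborel W" using assms(4) by blast
  obtain D where D: "open D" "bounded D"
    and eq: "\<And>A. A \<in> sets borel \<Longrightarrow> A \<subseteq> - D \<Longrightarrow> emeasure \<mu> A = emeasure lborel A"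
    and law: "\<And>z. z \<notin> D \<Longrightarrow> distr (P z) path_space (stopped_at D) = distr (W z) path_space (stopped_at D)"
    using W(2) unfolding bounded_modification_def by blast
  obtain C where C: "\<And>R y. R > 0 \<Longrightarrow> measure \<mu> (ball y R) \<le> C * R ^ CARD('n)" using assms(6) by blast
  have gp: "gaussian_process \<mu> p P"
    using assms(1) C by (intro mmd_gaussian_process[OF assms(3,5) _ _ D(2) eq, of C]) (auto simp: dim)
  have bm: "brownian W" using W(1) assms(1) by (intro brownian.intro) (auto simp: dim)
  interpret M: gaussian_process \<mu> p P by (rule gp)
  obtain K where K: "\<And>n h. 2 \<le> n \<Longrightarrow> h \<in> {0..1} \<Longrightarrow> \<bar>M.vol \<epsilon> x (real n + h) - M.vol \<epsilon> x (real n) - h * newton_cap_ball CARD('n) \<epsilon>\<bar> \<le> K / (real n)\<^sup>2"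
    using modification_increment[OF gp bm D eq law assms(2), of x] unfolding dim by blast
  have "\<exists>L. ((\<lambda>t. M.vol \<epsilon> x t - t * newton_cap_ball CARD('n) \<epsilon>) \<longlongrightarrow> L) at_top"
  proof (rule convergent_of_square_increments)
    fix n :: nat and h :: real assume "2 \<le> n" "h \<in> {0..1}"
    then show "\<bar>(M.vol \<epsilon> x (real n + h) - (real n + h) * newton_cap_ball CARD('n) \<epsilon>) - (M.vol \<epsilon> x (real n) - real n * newton_cap_ball CARD('n) \<epsilon>)\<bar> \<le> K / (real n)\<^sup>2"
      using K[of n h] by (simp add: algebra_simps)
  qed
  then obtain L where L: "((\<lambda>t. M.vol \<epsilon> x t - t * newton_cap_ball CARD('n) \<epsilon>) \<longlongrightarrow> L) at_top" by blast
  \<comment> \<open>\<open>vol\<close> equals the expectation for \<open>t \<ge> 0\<close>, which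
    suffices at infinity.\<close>
  have "\<forall>\<^sub>F t in at_top. M.vol \<epsilon> x t - t * newton_cap_ball CARD('n) \<epsilon> = (\<integral>\<omega>. sausage_vol \<mu> \<epsilon> t \<omega> \<partial>P x) - t * newton_cap_ball CARD('n) \<epsilon>"
    using eventually_ge_at_top[of 0] by eventually_elim (simp add: M.expected_sausage_vol)
  from Lim_transform_eventually[OF L this] show ?thesis by blast
qed

end
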